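(* Let $R$ be a commutative ring and let $X$ and $Y$ be spaces (pointed simplicial sets). Suppose that $X$ is gradual, i.e. the sets $X_n$, $n\ge 0$, are finite. Then the chain homomorphism $$\epsilon_*(X,Y)\colon D_*(X,Y)\to G_*(X,Y)$$ is an isomorphism.
   Context: Conventions. A space is a pointed simplicial set; a map is a basepoint-preserving simplicial map. For a space $Z$, $C_*(Z)$ is the reduced (unnormalized) simplicial chain complex with coefficients in $R$: $C_n(Z)=R[Z_n]/R[*]$ for $n\ge 0$, i.e. the free $R$-module on the non-basepoint $n$-simplices (with $[*]=0$), $C_n(Z)=0$ for $n<0$, boundary $\partial=\sum_i(-1)^i d_i$; $[z]$ denotes the class of the simplex $z$. $Z^{\wedge s}$ is the $s$-fold smash power; for $x_1,\dots,x_s\in Z_n$, $x_1\cdots x_s\in (Z^{\wedge s})_n$ denotes the image of $(x_1,\dots,x_s)\in (Z^s)_n$. Diagonal complexes. A bicomplex $W^*_*$ of $R$-modules has commuting differentials $d'\colon W^{p-1}_q\to W^p_q$ and $d''\colon W^p_q\to W^p_{q-1}$. Its diagonal chain complex has $W_n=\prod_{q-p=n}W^p_q$ and differential $(\partial w)^p_q=d''(w^p_{q+1})-(-1)^n d'(w^{p-1}_q)$ for $w=(w^p_q)_{q-p=n}\in W_n$ and $q-p=n-1$. The complex $D_*(X,Y)$. For a pointed set $S$, $Y^S$ is the space whose $q$-simplices are the basepoint-preserving functions $S\to Y_q$ (the fibre over the basepoint of the projection $\prod_{s\in S}Y\to Y$ at $s=*$). The spaces $Y^{X_p}$, $p\ge0$,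 form a cosimplicial space, with coface maps $\delta^i\colon Y^{X_{p-1}}\to Y^{X_p}$ induced by the face maps $d_i\colon X_p\to X_{p-1}$. $D_*(X,Y)$ is the diagonal complex of the bicomplex with terms $C_q(Y^{X_p})$ in position $(p,q)$, $p,q\ge0$ (zero otherwise), $d'=\sum_{i=0}^p(-1)^iC_q(\delta^i)$, and $d''$ the boundary operator of $C_*(Y^{X_p})$. Thus $D_n(X,Y)=\prod_{q-p=n}C_q(Y^{X_p})$. The complex $G_*(X,Y)$. Let $\Omega$ be the category with objects $\langle s\rangle=\{1,\dots,s\}$, $s>0$, and morphisms all surjective functions; $\Omega^\circ$ is its dual (opposite) category. For $n\in\mathbb{Z}$ the functor $M_n(X)\colon\Omega^\circ\to R\text{-Mod}$ is given by $M_n(X)(\langle s\rangle)=C_n(X^{\wedge s})$ and, for a surjection $h\colon\langle t\rangle\to\langle s\rangle$, $M_n(X)(h)=C_n(h^\sharp)\colon C_n(X^{\wedge s})\to C_n(X^{\wedge t})$, where $h^\sharp(x_1\cdots x_s)=x_{h(1)}\cdots x_{h(t)}$. The boundary operators make $M_*(X)$ a chain complex of functors. $G_*(X,Y)=\mathrm{Hom}_*(M_*(X),M_*(Y))$ is the diagonal complex of the bicomplex with terms $\mathrm{Hom}(M_p(X),M_q(Y))$ (natural transformations) in position $(p,q)$ and differentials induced by (precomposition, respectively postcomposition with) the boundary operators of $M_*(X)$ and $M_*(Y)$. The homomorphism $\epsilon_*(X,Y)$. For $s>0$, $p,q\ge0$ define ${}^s\epsilon^p_q\colon C_q(Y^{X_p})\to\mathrm{Hom}(C_p(X^{\wedge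 s}),C_q(Y^{\wedge s}))$ by ${}^s\epsilon^p_q([v])([x_1\cdots x_s])=[v(x_1)\cdots v(x_s)]$ for $x_1,\dots,x_s\in X_p$ and $v\in(Y^{X_p})_q$ (a basepoint-preserving function $v\colon X_p\to Y_q$). Over all $s$ these give homomorphisms $C_q(Y^{X_p})\to\mathrm{Hom}(M_p(X),M_q(Y))$, which form a homomorphism of bicomplexes and hence the chain homomorphism $\epsilon_*(X,Y)$. *)

theory Defs
  imports "HOL-Algebra.Module" "HOL-Library.FuncSet"
begin

section \<open>Pointed simplicial sets\<close>

text \<open>
  \<open>face Z n i\<close> and \<open>degen Z n i\<close> are the operators \<open>d\<^sub>i : Z\<^sub>n \<rightarrow> Z\<^sub>n\<^sub>-\<^sub>1\<close> and \<open>s\<^sub>i : Z\<^sub>n \<rightarrow> Z\<^sub>n\<^sub>+\<^sub>1\<close>;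
  the index \<open>n\<close> is always the dimension of the source. All \<open>Z\<^sub>n\<close> are subsets of one type,
  not necessarily disjoint.
\<close>

record 'a sspace =
  simplices :: "nat \<Rightarrow> 'a set"
  face :: "nat \<Rightarrow> nat \<Rightarrow> 'a \<Rightarrow> 'a"
  degen :: "nat \<Rightarrow> nat \<Rightarrow> 'a \<Rightarrow> 'a"
  base :: "nat \<Rightarrow> 'a"

locale pointed_simplicial_set =
  fixes Z :: "'a sspace"
  assumes base_closed: "base Z n \<in> simplices Z n"
    and face_closed: "\<lbrakk>i \<le> Suc n; z \<in> simplices Z (Suc n)\<rbrakk> \<Longrightarrow> face Z (Suc n) i z \<in> simplices Z n"
    and degen_closed: "\<lbrakk>i \<le> n; z \<in> simplices Z n\<rbrakk> \<Longrightarrow> degen Z n i z \<in> simplices Z (Suc n)"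
    and face_base: "i \<le> Suc n \<Longrightarrow> face Z (Suc n) i (base Z (Suc n)) = base Z n"
    and degen_base: "i \<le> n \<Longrightarrow> degen Z n i (base Z n) = base Z (Suc n)"
    and face_face: "\<lbrakk>i < j; j \<le> Suc (Suc n); z \<in> simplices Z (Suc (Suc n))\<rbrakk> \<Longrightarrow>
      face Z (Suc n) i (face Z (Suc (Suc n)) j z) =
      face Z (Suc n) (j - 1) (face Z (Suc (Suc n)) i z)"
    and face_degen_less: "\<lbrakk>i < j; j \<le> Suc n; z \<in> simplices Z (Suc n)\<rbrakk> \<Longrightarrow>
      face Z (Suc (Suc n)) i (degen Z (Suc n) j z) = degen Z n (j - 1) (face Z (Suc n) i z)"
    and face_degen_same: "\<lbrakk>j \<le> n; z \<in> simplices Z n\<rbrakk> \<Longrightarrow> face Z (Suc n) j (degen Z n j z) = z"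
    and face_degen_Suc: "\<lbrakk>j \<le> n; z \<in> simplices Z n\<rbrakk> \<Longrightarrow> face Z (Suc n) (Suc j) (degen Z n j z) = z"
    and face_degen_greater: "\<lbrakk>Suc j < i; i \<le> Suc (Suc n); z \<in> simplices Z (Suc n)\<rbrakk> \<Longrightarrow>
      face Z (Suc (Suc n)) i (degen Z (Suc n) j z) = degen Z n j (face Z (Suc n) (i - 1) z)"
    and degen_degen: "\<lbrakk>i \<le> j; j \<le> n; z \<in> simplices Z n\<rbrakk> \<Longrightarrow>
      degen Z (Suc n) i (degen Z n j z) = degen Z (Suc n) (Suc j) (degen Z n i z)"

definition gradual :: "'a sspace \<Rightarrow> bool" where
  "gradual Z \<longleftrightarrow> (\<forall>n. finite (simplices Z n))"

text \<open>
  Smash powers. An element of the quotient \<open>(Z\<^sup>\<and>\<^sup>s)\<^sub>n\<close> of \<open>(Z\<^sub>n)\<^sup>s\<close> is stored as its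
  canonical representative: the constant basepoint tuple for the class of all tuples with some
  basepoint entry, the tuple itself otherwise. Thus \<open>smash_proj Z s n x\<close> is
  \<open>x\<^sub>1\<cdots>x\<^sub>s\<close>.
\<close>

definition smash_proj :: "'a sspace \<Rightarrow> nat \<Rightarrow> nat \<Rightarrow> (nat \<Rightarrow> 'a) \<Rightarrow> (nat \<Rightarrow> 'a)" where
  "smash_proj Z s n x = (if \<exists>k\<in>{1..s}. x k = base Z n then (\<lambda>k\<in>{1..s}. base Z n) else x)"

definition smash_power :: "'a sspace \<Rightarrow> nat \<Rightarrow> (nat \<Rightarrow> 'a) sspace" where
  "smash_power Z s =
    \<lparr>simplices = (\<lambda>n. smash_proj Z s n ` ({1..s} \<rightarrow>\<^sub>E simplices Z n)),
     face = (\<lambda>n i x. smash_proj Z s (n - 1) (\<lambda>k\<in>{1..s}. face Z n i (x k))),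
     degen = (\<lambda>n i x. smash_proj Z s (n + 1) (\<lambda>k\<in>{1..s}. degen Z n i (x k))),
     base = (\<lambda>n. \<lambda>k\<in>{1..s}. base Z n)\<rparr>"

text \<open>\<open>fun_space S a Y\<close> is \<open>Y\<^sup>S\<close> for the set \<open>S\<close> pointed by \<open>a\<close>.\<close>

definition fun_space :: "'s set \<Rightarrow> 's \<Rightarrow> 'b sspace \<Rightarrow> ('s \<Rightarrow> 'b) sspace" where
  "fun_space S a Y =
    \<lparr>simplices = (\<lambda>q. {v \<in> S \<rightarrow>\<^sub>E simplices Y q. v a = base Y q}),
     face = (\<lambda>q i v. \<lambda>x\<in>S. face Y q i (v x)),
     degen = (\<lambda>q i v. \<lambda>x\<in>S. degen Y q i (v x)),
     base = (\<lambda>q. \<lambda>x\<in>S. base Y q)\<rparr>"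

abbreviation level_power :: "'a sspace \<Rightarrow> 'b sspace \<Rightarrow> nat \<Rightarrow> ('a \<Rightarrow> 'b) sspace" where
  "level_power X Y p \<equiv> fun_space (simplices X p) (base X p) Y"

text \<open>The coface map \<open>\<delta>\<^sup>i\<close> from \<open>Y\<close> to the \<open>X\<^sub>p\<^sub>-\<^sub>1\<close> to \<open>Y\<close> to the \<open>X\<^sub>p\<close>, for \<open>p \<ge> 1\<close>.\<close>

definition coface :: "'a sspace \<Rightarrow> nat \<Rightarrow> nat \<Rightarrow> ('a \<Rightarrow> 'b) \<Rightarrow> ('a \<Rightarrow> 'b)" where
  "coface X p i v = (\<lambda>x\<in>simplices X p. v (face X p i x))"

section \<open>Modules\<close>

text \<open>The ring fields \<open>mult\<close> and \<open>one\<close> of a module record carry no meaning.\<close>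

definition linear_maps ::
  "('r, 'x) ring_scheme \<Rightarrow> ('r, 'm) module \<Rightarrow> ('r, 'n) module \<Rightarrow> ('m \<Rightarrow> 'n) set" where
  "linear_maps R M N = {f \<in> carrier M \<rightarrow> carrier N.
     (\<forall>x\<in>carrier M. \<forall>y\<in>carrier M. f (x \<oplus>\<^bsub>M\<^esub> y) = f x \<oplus>\<^bsub>N\<^esub> f y) \<and>
     (\<forall>r\<in>carrier R. \<forall>x\<in>carrier M. f (r \<odot>\<^bsub>M\<^esub> x) = r \<odot>\<^bsub>N\<^esub> f x)}"

definition alt_sign :: "('r, 'm) module \<Rightarrow> int \<Rightarrow> 'm \<Rightarrow> 'm" where
  "alt_sign M n x = (if even n then x else \<ominus>\<^bsub>M\<^esub> x)"

definition free_module :: "('r, 'x) ring_scheme \<Rightarrow> 'a set \<Rightarrow> ('r, 'a \<Rightarrow> 'r) module" where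
  "free_module R A =
    \<lparr>carrier = {c. (\<forall>z. c z \<in> carrier R) \<and> finite {z. c z \<noteq> \<zero>\<^bsub>R\<^esub>} \<and> (\<forall>z. z \<notin> A \<longrightarrow> c z = \<zero>\<^bsub>R\<^esub>)},
     mult = undefined, one = undefined,
     zero = (\<lambda>z. \<zero>\<^bsub>R\<^esub>),
     add = (\<lambda>c d z. c z \<oplus>\<^bsub>R\<^esub> d z),
     smult = (\<lambda>r c z. r \<otimes>\<^bsub>R\<^esub> c z)\<rparr>"

text \<open>The linear map out of a free module determined by its values \<open>f\<close> on the basis.\<close>

definition lin_ext :: "('r, 'x) ring_scheme \<Rightarrow> ('r, 'm) module \<Rightarrow> ('a \<Rightarrow> 'm) \<Rightarrow> ('a \<Rightarrow> 'r) \<Rightarrow> 'm" where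
  "lin_ext R M f c = (\<Oplus>\<^bsub>M\<^esub> z\<in>{z. c z \<noteq> \<zero>\<^bsub>R\<^esub>}. c z \<odot>\<^bsub>M\<^esub> f z)"

definition prod_module :: "'i set \<Rightarrow> ('i \<Rightarrow> ('r, 'm) module) \<Rightarrow> ('r, 'i \<Rightarrow> 'm) module" where
  "prod_module I M =
    \<lparr>carrier = (\<Pi>\<^sub>E i\<in>I. carrier (M i)),
     mult = undefined, one = undefined,
     zero = (\<lambda>i\<in>I. \<zero>\<^bsub>M i\<^esub>),
     add = (\<lambda>v w. \<lambda>i\<in>I. v i \<oplus>\<^bsub>M i\<^esub> w i),
     smult = (\<lambda>r v. \<lambda>i\<in>I. r \<odot>\<^bsub>M i\<^esub> v i)\<rparr>"

section \<open>Chain complexes and diagonal complexes\<close>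

record ('r, 'm) complex =
  chain_module :: "int \<Rightarrow> ('r, 'm) module"
  differential :: "int \<Rightarrow> 'm \<Rightarrow> 'm"  \<comment> \<open>\<open>differential C n\<close> goes from degree \<open>n\<close> to degree \<open>n - 1\<close>\<close>

definition chain_complex :: "('r, 'x) ring_scheme \<Rightarrow> ('r, 'm) complex \<Rightarrow> bool" where
  "chain_complex R C \<longleftrightarrow>
    (\<forall>n. module R (chain_module C n)) \<and>
    (\<forall>n. differential C n \<in> linear_maps R (chain_module C n) (chain_module C (n - 1))) \<and>
    (\<forall>n. \<forall>c\<in>carrier (chain_module C n).
       differential C (n - 1) (differential C n c) = \<zero>\<^bsub>chain_module C (n - 2)\<^esub>)"

definition chain_hom ::
  "('r, 'x) ring_scheme \<Rightarrow> ('r, 'm) complex \<Rightarrow> ('r, 'n) complex \<Rightarrow> (int \<Rightarrow> 'm \<Rightarrow> 'n) \<Rightarrow> bool" where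
  "chain_hom R C D f \<longleftrightarrow> chain_complex R C \<and> chain_complex R D \<and>
    (\<forall>n. f n \<in> linear_maps R (chain_module C n) (chain_module D n)) \<and>
    (\<forall>n. \<forall>c\<in>carrier (chain_module C n).
       f (n - 1) (differential C n c) = differential D n (f n c))"

definition chain_iso ::
  "('r, 'x) ring_scheme \<Rightarrow> ('r, 'm) complex \<Rightarrow> ('r, 'n) complex \<Rightarrow> (int \<Rightarrow> 'm \<Rightarrow> 'n) \<Rightarrow> bool" where
  "chain_iso R C D f \<longleftrightarrow> chain_hom R C D f \<and>
    (\<forall>n. bij_betw (f n) (carrier (chain_module C n)) (carrier (chain_module D n)))"

text \<open>
  \<open>bi_module W p q\<close> is \<open>W\<close> with upper index \<open>p\<close> and lower index \<open>q\<close>;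
  \<open>hdiff W p q\<close> is \<open>d'\<close> with target in position \<open>(p, q)\<close>, and
  \<open>vdiff W p q\<close> is \<open>d''\<close> with source in position \<open>(p, q)\<close>.
\<close>

record ('r, 'w) bicomplex =
  bi_module :: "int \<Rightarrow> int \<Rightarrow> ('r, 'w) module"
  hdiff :: "int \<Rightarrow> int \<Rightarrow> 'w \<Rightarrow> 'w"
  vdiff :: "int \<Rightarrow> int \<Rightarrow> 'w \<Rightarrow> 'w"

definition diag_index :: "int \<Rightarrow> (int \<times> int) set" where
  "diag_index n = {(p, q). q - p = n}"

definition diagonal :: "('r, 'w) bicomplex \<Rightarrow> ('r, int \<times> int \<Rightarrow> 'w) complex" where
  "diagonal W =
    \<lparr>chain_module = (\<lambda>n. prod_module (diag_index n) (\<lambda>(p, q). bi_module W p q)),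
     differential = (\<lambda>n w. \<lambda>(p, q)\<in>diag_index (n - 1).
       vdiff W p (q + 1) (w (p, q + 1))
         \<ominus>\<^bsub>bi_module W p q\<^esub> alt_sign (bi_module W p q) n (hdiff W p q (w (p - 1, q))))\<rparr>"

section \<open>Reduced chains\<close>

text \<open>
  For a set \<open>A\<close> pointed by \<open>a\<close>, the quotient \<open>R[A]/R[a]\<close> is the free module on \<open>A - {a}\<close>,
  and \<open>pt_class R a z\<close> is the class \<open>[z]\<close>, which is zero for \<open>z = a\<close>.
\<close>

definition pt_class :: "('r, 'x) ring_scheme \<Rightarrow> 'a \<Rightarrow> 'a \<Rightarrow> ('a \<Rightarrow> 'r)" where
  "pt_class R a z = (\<lambda>z'. if z' = z \<and> z \<noteq> a then \<one>\<^bsub>R\<^esub> else \<zero>\<^bsub>R\<^esub>)"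

definition chains :: "('r, 'x) ring_scheme \<Rightarrow> 'a sspace \<Rightarrow> int \<Rightarrow> ('r, 'a \<Rightarrow> 'r) module" where
  "chains R Z n = free_module R (if n < 0 then {} else simplices Z (nat n) - {base Z (nat n)})"

definition simplex_class :: "('r, 'x) ring_scheme \<Rightarrow> 'a sspace \<Rightarrow> int \<Rightarrow> 'a \<Rightarrow> ('a \<Rightarrow> 'r)" where
  "simplex_class R Z n z = pt_class R (base Z (nat n)) z"

text \<open>
  \<open>chains_map R W n g\<close> sends \<open>[z]\<close> to \<open>[g z]\<close>, a chain of degree \<open>n\<close> on \<open>W\<close>. The source
  degree is left free, so that this covers both the maps induced by a map of spaces and those
  induced by the face operators.
\<close>

definition chains_map ::
  "('r, 'x) ring_scheme \<Rightarrow> 'b sspace \<Rightarrow> int \<Rightarrow> ('a \<Rightarrow> 'b) \<Rightarrow> ('a \<Rightarrow> 'r) \<Rightarrow> ('b \<Rightarrow> 'r)" where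
  "chains_map R W n g = lin_ext R (chains R W n) (\<lambda>z. simplex_class R W n (g z))"

definition boundary :: "('r, 'x) ring_scheme \<Rightarrow> 'a sspace \<Rightarrow> int \<Rightarrow> ('a \<Rightarrow> 'r) \<Rightarrow> ('a \<Rightarrow> 'r)" where
  "boundary R Z n c =
    (if n \<le> 0 then \<zero>\<^bsub>chains R Z (n - 1)\<^esub>
     else \<Oplus>\<^bsub>chains R Z (n - 1)\<^esub> i\<in>{0..nat n}.
       alt_sign (chains R Z (n - 1)) (int i) (chains_map R Z (n - 1) (face Z (nat n) i) c))"

section \<open>The complex \<open>D\<^sub>*(X, Y)\<close>\<close>

definition D_bicomplex ::
  "('r, 'x) ring_scheme \<Rightarrow> 'a sspace \<Rightarrow> 'b sspace \<Rightarrow> ('r, ('a \<Rightarrow> 'b) \<Rightarrow> 'r) bicomplex" where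
  "D_bicomplex R X Y =
    \<lparr>bi_module = (\<lambda>p q. if p < 0 then free_module R {} else chains R (level_power X Y (nat p)) q),
     hdiff = (\<lambda>p q c.
       if p \<le> 0 then (\<lambda>v. \<zero>\<^bsub>R\<^esub>)
       else \<Oplus>\<^bsub>chains R (level_power X Y (nat p)) q\<^esub> i\<in>{0..nat p}.
         alt_sign (chains R (level_power X Y (nat p)) q) (int i)
           (chains_map R (level_power X Y (nat p)) q (coface X (nat p) i) c)),
     vdiff = (\<lambda>p q c.
       if p < 0 then (\<lambda>v. \<zero>\<^bsub>R\<^esub>) else boundary R (level_power X Y (nat p)) q c)\<rparr>"

definition D_complex ::
  "('r, 'x) ring_scheme \<Rightarrow> 'a sspace \<Rightarrow> 'b sspace
    \<Rightarrow> ('r, int \<times> int \<Rightarrow> ('a \<Rightarrow> 'b) \<Rightarrow> 'r) complex" where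
  "D_complex R X Y = diagonal (D_bicomplex R X Y)"

section \<open>The complex \<open>G\<^sub>*(X, Y)\<close>\<close>

definition surjections :: "nat \<Rightarrow> nat \<Rightarrow> (nat \<Rightarrow> nat) set" where
  "surjections t s = {h \<in> {1..t} \<rightarrow>\<^sub>E {1..s}. h ` {1..t} = {1..s}}"

text \<open>
  Contravariant functors from \<open>\<Omega>\<close> to \<open>R\<close>-modules: \<open>fun_mor F t s h\<close> maps \<open>fun_obj F s\<close> to
  \<open>fun_obj F t\<close> for \<open>h \<in> surjections t s\<close>. Only objects \<open>s > 0\<close> are relevant.
\<close>

record ('r, 'm) omega_functor =
  fun_obj :: "nat \<Rightarrow> ('r, 'm) module"
  fun_mor :: "nat \<Rightarrow> nat \<Rightarrow> (nat \<Rightarrow> nat) \<Rightarrow> 'm \<Rightarrow> 'm"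

definition nat_trans ::
  "('r, 'x) ring_scheme \<Rightarrow> ('r, 'm) omega_functor \<Rightarrow> ('r, 'n) omega_functor
    \<Rightarrow> (nat \<Rightarrow> 'm \<Rightarrow> 'n) set" where
  "nat_trans R F G =
    {\<phi> \<in> (\<Pi>\<^sub>E s\<in>{1..}. linear_maps R (fun_obj F s) (fun_obj G s) \<inter> extensional (carrier (fun_obj F s))).
      \<forall>s\<ge>1. \<forall>t\<ge>1. \<forall>h\<in>surjections t s. \<forall>c\<in>carrier (fun_obj F s).
        \<phi> t (fun_mor F t s h c) = fun_mor G t s h (\<phi> s c)}"

definition Hom_module ::
  "('r, 'x) ring_scheme \<Rightarrow> ('r, 'm) omega_functor \<Rightarrow> ('r, 'n) omega_functor
    \<Rightarrow> ('r, nat \<Rightarrow> 'm \<Rightarrow> 'n) module" where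
  "Hom_module R F G =
    \<lparr>carrier = nat_trans R F G,
     mult = undefined, one = undefined,
     zero = (\<lambda>s\<in>{1..}. \<lambda>c\<in>carrier (fun_obj F s). \<zero>\<^bsub>fun_obj G s\<^esub>),
     add = (\<lambda>\<phi> \<psi>. \<lambda>s\<in>{1..}. \<lambda>c\<in>carrier (fun_obj F s). \<phi> s c \<oplus>\<^bsub>fun_obj G s\<^esub> \<psi> s c),
     smult = (\<lambda>r \<phi>. \<lambda>s\<in>{1..}. \<lambda>c\<in>carrier (fun_obj F s). r \<odot>\<^bsub>fun_obj G s\<^esub> \<phi> s c)\<rparr>"

text \<open>\<open>sharp t h\<close> is \<open>h\<^sup>\<sharp>\<close>; since \<open>h\<close> is onto, it preserves canonical representatives.\<close>

definition sharp :: "nat \<Rightarrow> (nat \<Rightarrow> nat) \<Rightarrow> (nat \<Rightarrow> 'a) \<Rightarrow> (nat \<Rightarrow> 'a)" where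
  "sharp t h x = (\<lambda>k\<in>{1..t}. x (h k))"

definition M_functor ::
  "('r, 'x) ring_scheme \<Rightarrow> 'a sspace \<Rightarrow> int \<Rightarrow> ('r, (nat \<Rightarrow> 'a) \<Rightarrow> 'r) omega_functor" where
  "M_functor R Z n =
    \<lparr>fun_obj = (\<lambda>s. chains R (smash_power Z s) n),
     fun_mor = (\<lambda>t s h. chains_map R (smash_power Z t) n (sharp t h))\<rparr>"

definition G_bicomplex ::
  "('r, 'x) ring_scheme \<Rightarrow> 'a sspace \<Rightarrow> 'b sspace
    \<Rightarrow> ('r, nat \<Rightarrow> ((nat \<Rightarrow> 'a) \<Rightarrow> 'r) \<Rightarrow> ((nat \<Rightarrow> 'b) \<Rightarrow> 'r)) bicomplex" where
  "G_bicomplex R X Y =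
    \<lparr>bi_module = (\<lambda>p q. Hom_module R (M_functor R X p) (M_functor R Y q)),
     hdiff = (\<lambda>p q \<phi>. \<lambda>s\<in>{1..}. \<lambda>c\<in>carrier (chains R (smash_power X s) p).
       \<phi> s (boundary R (smash_power X s) p c)),
     vdiff = (\<lambda>p q \<phi>. \<lambda>s\<in>{1..}. \<lambda>c\<in>carrier (chains R (smash_power X s) p).
       boundary R (smash_power Y s) q (\<phi> s c))\<rparr>"

definition G_complex ::
  "('r, 'x) ring_scheme \<Rightarrow> 'a sspace \<Rightarrow> 'b sspace
    \<Rightarrow> ('r, int \<times> int \<Rightarrow> nat \<Rightarrow> ((nat \<Rightarrow> 'a) \<Rightarrow> 'r) \<Rightarrow> ((nat \<Rightarrow> 'b) \<Rightarrow> 'r)) complex" where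
  "G_complex R X Y = diagonal (G_bicomplex R X Y)"

section \<open>The homomorphism \<open>\<epsilon>\<^sub>*(X, Y)\<close>\<close>

text \<open>The value of \<open>\<epsilon>\<close> at \<open>[v]\<close>, whose \<open>s\<close>-th component sends \<open>[x\<^sub>1\<cdots>x\<^sub>s]\<close> to
  \<open>[v(x\<^sub>1)\<cdots>v(x\<^sub>s)]\<close>.\<close>

definition eps_class ::
  "('r, 'x) ring_scheme \<Rightarrow> 'a sspace \<Rightarrow> 'b sspace \<Rightarrow> int \<Rightarrow> int \<Rightarrow> ('a \<Rightarrow> 'b)
    \<Rightarrow> nat \<Rightarrow> ((nat \<Rightarrow> 'a) \<Rightarrow> 'r) \<Rightarrow> ((nat \<Rightarrow> 'b) \<Rightarrow> 'r)" where
  "eps_class R X Y p q v = (\<lambda>s\<in>{1..}. \<lambda>c\<in>carrier (chains R (smash_power X s) p).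
     chains_map R (smash_power Y s) q
       (\<lambda>x. smash_proj Y s (nat q) (\<lambda>k\<in>{1..s}. v (x k))) c)"

text \<open>If \<open>p < 0\<close> or \<open>q < 0\<close>, the source is the zero module and \<open>lin_ext\<close> yields the empty sum.\<close>

definition eps_bi ::
  "('r, 'x) ring_scheme \<Rightarrow> 'a sspace \<Rightarrow> 'b sspace \<Rightarrow> int \<Rightarrow> int \<Rightarrow> (('a \<Rightarrow> 'b) \<Rightarrow> 'r)
    \<Rightarrow> nat \<Rightarrow> ((nat \<Rightarrow> 'a) \<Rightarrow> 'r) \<Rightarrow> ((nat \<Rightarrow> 'b) \<Rightarrow> 'r)" where
  "eps_bi R X Y p q =
    lin_ext R (Hom_module R (M_functor R X p) (M_functor R Y q)) (eps_class R X Y p q)"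

definition epsilon ::
  "('r, 'x) ring_scheme \<Rightarrow> 'a sspace \<Rightarrow> 'b sspace \<Rightarrow> int
    \<Rightarrow> (int \<times> int \<Rightarrow> ('a \<Rightarrow> 'b) \<Rightarrow> 'r)
    \<Rightarrow> (int \<times> int \<Rightarrow> nat \<Rightarrow> ((nat \<Rightarrow> 'a) \<Rightarrow> 'r) \<Rightarrow> ((nat \<Rightarrow> 'b) \<Rightarrow> 'r))" where
  "epsilon R X Y n w = (\<lambda>(p, q)\<in>diag_index n. eps_bi R X Y p q (w (p, q)))"

end

theory Submission
  imports Defs
begin

text \<open>
  Both complexes are diagonals of bicomplexes, that is, products over the positions \<open>(p, q)\<close> of an
  antidiagonal, and \<open>\<epsilon>\<close> acts position by position. So it suffices that \<open>\<epsilon>\<close> is a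
  morphism of bicomplexes which is bijective in each position (\<open>diagonal_chain_iso\<close>).

  Bijectivity. Fix \<open>p, q \<ge> 0\<close>. A basis element of \<open>M\<^sub>p(X)(\<langle>s\<rangle>)\<close> is a tuple of \<open>s\<close>
  simplices in \<open>X\<^sub>p - {*}\<close>. If \<open>A\<close> is the set of its entries, the tuple is the pullback of an
  injective enumeration of \<open>A\<close> along a surjection \<open>\<langle>s\<rangle> \<rightarrow> \<langle>|A|\<rangle>\<close>. A natural transformation
  \<open>\<phi>\<close> is therefore determined by its values on one enumeration of each nonempty subset \<open>A\<close>, and
  such a value is a linear combination of functions \<open>A \<rightarrow> Y\<^sub>q - {*}\<close>. Now a subset \<open>A\<close> together
  with a function \<open>A \<rightarrow> Y\<^sub>q - {*}\<close> is the same thing as a pointed function \<open>X\<^sub>p \<rightarrow> Y\<^sub>q\<close> with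
  support \<open>A\<close>. Reading off these coefficients embeds \<open>Hom(M\<^sub>p(X), M\<^sub>q(Y))\<close> into the free module
  on the pointed functions other than the constant one (\<open>top_coeff\<close>, \<open>inj_top_coeff\<close>), and this
  free module is the source of \<open>\<epsilon>\<close>, the module of \<open>q\<close>-chains of the function space.

  The composite of \<open>\<epsilon>\<close> with this embedding sends \<open>[v]\<close> to the sum of the \<open>[u]\<close> over all
  \<open>u\<close> obtained from \<open>v\<close> by shrinking its support (\<open>top_coeff_eps_delta\<close>). It is unitriangular for
  the number of points of the support, hence bijective (\<open>unitriangular_bij\<close>); this is Moebius inversion
  over the subsets of \<open>X\<^sub>p\<close>. An injection whose composite with \<open>\<epsilon>\<close> is bijective is itself
  bijective, and so is \<open>\<epsilon>\<close>. Finiteness of \<open>X\<^sub>p\<close> bounds the supports and makes the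
  coefficients of a natural transformation finitely many.

  Compatibility with the differentials. Every differential in sight is an alternating sum of maps
  induced by pointed maps (\<open>alternating_map\<close>), so that the identities between them reduce to
  identities between simplices. For a fixed basis element \<open>[x\<^sub>1\<cdots>x\<^sub>s]\<close> the map
  \<open>c \<mapsto> \<epsilon>(c)([x\<^sub>1\<cdots>x\<^sub>s])\<close> is induced by the map of spaces
  \<open>v \<mapsto> v(x\<^sub>1)\<cdots>v(x\<^sub>s)\<close> (\<open>eps_eval\<close>), and naturality of the alternating sums does the rest.
\<close>

section \<open>Linear maps\<close>

locale linear_map = dom: module R M + cod: module R N
  for R :: "('r, 'x) ring_scheme" (structure)
    and M :: "('r, 'm) module" and N :: "('r, 'n) module" +
  fixes f :: "'m \<Rightarrow> 'n"
  assumes linear: "f \<in> linear_maps R M N"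
begin

lemma closed [simp, intro]: "x \<in> carrier M \<Longrightarrow> f x \<in> carrier N"
  using linear by (auto simp: linear_maps_def)

lemma add: "x \<in> carrier M \<Longrightarrow> y \<in> carrier M \<Longrightarrow> f (x \<oplus>\<^bsub>M\<^esub> y) = f x \<oplus>\<^bsub>N\<^esub> f y"
  using linear by (auto simp: linear_maps_def)

lemma smult: "r \<in> carrier R \<Longrightarrow> x \<in> carrier M \<Longrightarrow> f (r \<odot>\<^bsub>M\<^esub> x) = r \<odot>\<^bsub>N\<^esub> f x"
  using linear by (auto simp: linear_maps_def)

lemma zero: "f \<zero>\<^bsub>M\<^esub> = \<zero>\<^bsub>N\<^esub>"
proof -
  have "f (\<zero> \<odot>\<^bsub>M\<^esub> \<zero>\<^bsub>M\<^esub>) = \<zero> \<odot>\<^bsub>N\<^esub> f \<zero>\<^bsub>M\<^esub>" by (rule smult) auto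
  then show ?thesis by simp
qed

lemma minus: "x \<in> carrier M \<Longrightarrow> f (\<ominus>\<^bsub>M\<^esub> x) = \<ominus>\<^bsub>N\<^esub> f x"
  by (metis add cod.M.minus_equality closed dom.M.a_inv_closed dom.M.l_neg zero)

lemma diff: "x \<in> carrier M \<Longrightarrow> y \<in> carrier M \<Longrightarrow> f (x \<ominus>\<^bsub>M\<^esub> y) = f x \<ominus>\<^bsub>N\<^esub> f y"
  by (simp add: a_minus_def add minus)

lemma alt_sign: "x \<in> carrier M \<Longrightarrow> f (alt_sign M n x) = alt_sign N n (f x)"
  by (simp add: alt_sign_def minus)

lemma finsum:
  assumes "g \<in> I \<rightarrow> carrier M"
  shows "f (finsum M g I) = finsum N (\<lambda>i. f (g i)) I"
proof (cases "finite I")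
  case True
  then show ?thesis using assms
    by (induction I) (auto simp: zero add Pi_def dom.M.finsum_insert cod.M.finsum_insert)
next
  case False
  then show ?thesis by (simp add: zero)
qed

end

lemma linear_mapI:
  assumes "module R M" "module R N"
    and "\<And>x. x \<in> carrier M \<Longrightarrow> f x \<in> carrier N"
    and "\<And>x y. x \<in> carrier M \<Longrightarrow> y \<in> carrier M \<Longrightarrow> f (x \<oplus>\<^bsub>M\<^esub> y) = f x \<oplus>\<^bsub>N\<^esub> f y"
    and "\<And>r x. r \<in> carrier R \<Longrightarrow> x \<in> carrier M \<Longrightarrow> f (r \<odot>\<^bsub>M\<^esub> x) = r \<odot>\<^bsub>N\<^esub> f x"
  shows "linear_map R M N f"
  using assms by (auto simp: linear_map_def linear_map_axioms_def linear_maps_def)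

lemma linear_mapI_maps:
  "module R M \<Longrightarrow> module R N \<Longrightarrow> f \<in> linear_maps R M N \<Longrightarrow> linear_map R M N f"
  by (auto simp: linear_map_def linear_map_axioms_def)

lemma linear_map_modules:
  assumes "linear_map R M N f"
  shows "module R M" "module R N"
  using assms by (auto simp: linear_map_def)

lemma linear_map_cong:
  assumes "linear_map R M N f" "\<And>x. x \<in> carrier M \<Longrightarrow> g x = f x"
  shows "linear_map R M N g"
proof -
  interpret linear_map R M N f by fact
  show ?thesis
    by (rule linear_mapI) (auto simp: assms(2) add smult linear_map_modules[OF assms(1)])
qed

lemma linear_map_comp:
  assumes "linear_map R M N f" "linear_map R N P g"
  shows "linear_map R M P (\<lambda>x. g (f x))"
proof -
  interpret f: linear_map R M N f by fact
  interpret g: linear_map R N P g by fact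
  show ?thesis
    by (rule linear_mapI)
      (auto simp: f.add g.add f.smult g.smult linear_map_modules[OF assms(1)] linear_map_modules[OF assms(2)])
qed

lemma linear_map_zero:
  assumes "module R M" "module R N"
  shows "linear_map R M N (\<lambda>x. \<zero>\<^bsub>N\<^esub>)"
proof -
  interpret N: module R N by fact
  show ?thesis using assms by (intro linear_mapI) auto
qed

lemma alt_sign_closed: "module R M \<Longrightarrow> x \<in> carrier M \<Longrightarrow> alt_sign M n x \<in> carrier M"
  by (auto simp: alt_sign_def module_def intro: abelian_group.a_inv_closed)

lemma linear_map_alt_sign:
  assumes "linear_map R M N f"
  shows "linear_map R M N (\<lambda>x. alt_sign N n (f x))"
proof -
  interpret f: linear_map R M N f by fact
  show ?thesis
    by (rule linear_mapI)
      (auto simp: f.add f.smult linear_map_modules[OF assms] alt_sign_def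
        f.cod.smult_r_minus f.cod.M.minus_add)
qed

lemma linear_map_finsum:
  assumes "module R M" "module R N" "\<And>i. i \<in> I \<Longrightarrow> linear_map R M N (F i)"
  shows "linear_map R M N (\<lambda>x. finsum N (\<lambda>i. F i x) I)"
proof (cases "finite I")
  case True
  interpret N: module R N by fact
  have cl: "(\<lambda>i. F i x) \<in> I \<rightarrow> carrier N" if "x \<in> carrier M" for x
    using assms(3) that by (auto intro: linear_map.closed)
  show ?thesis
  proof (rule linear_mapI)
    fix x y assume xy: "x \<in> carrier M" "y \<in> carrier M"
    have "finsum N (\<lambda>i. F i (x \<oplus>\<^bsub>M\<^esub> y)) I = finsum N (\<lambda>i. F i x \<oplus>\<^bsub>N\<^esub> F i y) I"
      using cl[OF xy(1)] cl[OF xy(2)] xy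
      by (intro N.M.finsum_cong') (auto simp: linear_map.add[OF assms(3)] Pi_def)
    also have "\<dots> = finsum N (\<lambda>i. F i x) I \<oplus>\<^bsub>N\<^esub> finsum N (\<lambda>i. F i y) I"
      by (rule N.M.finsum_addf) (use cl xy in auto)
    finally show "finsum N (\<lambda>i. F i (x \<oplus>\<^bsub>M\<^esub> y)) I = finsum N (\<lambda>i. F i x) I \<oplus>\<^bsub>N\<^esub> finsum N (\<lambda>i. F i y) I" .
  next
    fix r x assume rx: "r \<in> carrier R" "x \<in> carrier M"
    have "finsum N (\<lambda>i. F i (r \<odot>\<^bsub>M\<^esub> x)) I = finsum N (\<lambda>i. r \<odot>\<^bsub>N\<^esub> F i x) I"
      using cl[OF rx(2)] rx
      by (intro N.M.finsum_cong') (auto simp: linear_map.smult[OF assms(3)] Pi_def)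
    also have "\<dots> = r \<odot>\<^bsub>N\<^esub> finsum N (\<lambda>i. F i x) I"
      by (rule N.finsum_smult_ldistr[symmetric]) (use cl rx True in auto)
    finally show "finsum N (\<lambda>i. F i (r \<odot>\<^bsub>M\<^esub> x)) I = r \<odot>\<^bsub>N\<^esub> finsum N (\<lambda>i. F i x) I" .
  qed (use assms(1,2) cl in auto)
next
  case False
  interpret N: module R N by fact
  show ?thesis using False linear_map_zero[OF assms(1,2)] by simp
qed

section \<open>Free modules\<close>

definition delta :: "('r, 'x) ring_scheme \<Rightarrow> 'a \<Rightarrow> 'a \<Rightarrow> 'r" where
  "delta R z = (\<lambda>z'. if z' = z then \<one>\<^bsub>R\<^esub> else \<zero>\<^bsub>R\<^esub>)"

context cring
begin

lemma free_module_sel [simp]: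
  "zero (free_module R A) = (\<lambda>z. \<zero>)"
  "c \<oplus>\<^bsub>free_module R A\<^esub> d = (\<lambda>z. c z \<oplus> d z)"
  "r \<odot>\<^bsub>free_module R A\<^esub> c = (\<lambda>z. r \<otimes> c z)"
  by (simp_all add: free_module_def)

lemma free_moduleI:
  assumes "\<And>z. c z \<in> carrier R" "finite {z. c z \<noteq> \<zero>}" "\<And>z. z \<notin> A \<Longrightarrow> c z = \<zero>"
  shows "c \<in> carrier (free_module R A)"
  using assms by (simp add: free_module_def)

lemma free_moduleD:
  assumes "c \<in> carrier (free_module R A)"
  shows "c z \<in> carrier R" "finite {z. c z \<noteq> \<zero>}" "z \<notin> A \<Longrightarrow> c z = \<zero>" "{z. c z \<noteq> \<zero>} \<subseteq> A"
  using assms by (auto simp: free_module_def)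

lemma finite_support_add:
  "finite {z. c z \<noteq> \<zero>} \<Longrightarrow> finite {z. d z \<noteq> \<zero>} \<Longrightarrow> finite {z. c z \<oplus> d z \<noteq> \<zero>}"
  by (rule finite_subset[of _ "{z. c z \<noteq> \<zero>} \<union> {z. d z \<noteq> \<zero>}"]) auto

lemma finite_support_smult:
  "r \<in> carrier R \<Longrightarrow> finite {z. c z \<noteq> \<zero>} \<Longrightarrow> finite {z. r \<otimes> c z \<noteq> \<zero>}"
  by (rule finite_subset[of _ "{z. c z \<noteq> \<zero>}"]) auto

lemma module_free_module: "module R (free_module R A)"
proof (rule moduleI)
  show "abelian_group (free_module R A)"
  proof (rule abelian_groupI)
    fix x assume x: "x \<in> carrier (free_module R A)"
    show "\<exists>y\<in>carrier (free_module R A).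
      y \<oplus>\<^bsub>free_module R A\<^esub> x = \<zero>\<^bsub>free_module R A\<^esub>"
    proof (rule bexI)
      show "(\<lambda>z. \<ominus> x z) \<oplus>\<^bsub>free_module R A\<^esub> x = \<zero>\<^bsub>free_module R A\<^esub>"
        by (auto simp: l_neg free_moduleD[OF x])
      have "finite {z. \<ominus> x z \<noteq> \<zero>}"
        by (rule finite_subset[OF _ free_moduleD(2)[OF x]]) auto
      then show "(\<lambda>z. \<ominus> x z) \<in> carrier (free_module R A)"
        by (intro free_moduleI) (auto simp: free_moduleD[OF x])
    qed
  qed (auto intro!: free_moduleI finite_support_add simp: free_moduleD a_ac)
qed (auto intro!: free_moduleI finite_support_smult
      simp: free_moduleD l_distr r_distr m_assoc is_cring)

lemma delta_closed: "z \<in> A \<Longrightarrow> delta R z \<in> carrier (free_module R A)"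
  by (auto intro!: free_moduleI simp: delta_def)

lemma free_module_minus:
  assumes "c \<in> carrier (free_module R A)"
  shows "(\<ominus>\<^bsub>free_module R A\<^esub> c) z = \<ominus> c z"
proof -
  interpret F: module R "free_module R A" by (rule module_free_module)
  have "c \<oplus>\<^bsub>free_module R A\<^esub> \<ominus>\<^bsub>free_module R A\<^esub> c = \<zero>\<^bsub>free_module R A\<^esub>"
    using assms by (rule F.M.r_neg)
  then have "c z \<oplus> (\<ominus>\<^bsub>free_module R A\<^esub> c) z = \<zero>" by (metis free_module_sel(1,2))
  then show ?thesis
    using assms F.M.a_inv_closed[OF assms] by (metis free_moduleD(1) a_comm minus_equality)
qed

lemma finsum_free_module:
  assumes "g \<in> I \<rightarrow> carrier (free_module R A)"
  shows "finsum (free_module R A) g I z = (\<Oplus>i\<in>I. g i z)"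
proof -
  interpret F: module R "free_module R A" by (rule module_free_module)
  show ?thesis
  proof (cases "finite I")
    case True
    then show ?thesis using assms
    proof (induction I)
      case (insert i I)
      moreover have "(\<lambda>i. g i z) \<in> I \<rightarrow> carrier R" "g i z \<in> carrier R"
        using insert.prems by (auto simp: Pi_def free_moduleD)
      ultimately show ?case
        using F.M.finsum_insert[of I i g] by (simp add: finsum_insert Pi_def)
    qed simp
  qed simp
qed

text \<open>
  The sum defining \<open>lin_ext\<close> runs over the support of its argument. To compare the values at
  several arguments, all the sums must be taken over one common finite set.
\<close>

lemma lin_ext_superset:
  assumes "module R M" "f \<in> A \<rightarrow> carrier M" "c \<in> carrier (free_module R A)"
    and "finite S" "{z. c z \<noteq> \<zero>} \<subseteq> S" "S \<subseteq> A"
  shows "lin_ext R M f c = (\<Oplus>\<^bsub>M\<^esub>z\<in>S. c z \<odot>\<^bsub>M\<^esub> f z)"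
proof -
  interpret M: module R M by fact
  show ?thesis unfolding lin_ext_def
    by (rule M.M.add.finprod_mono_neutral_cong_left)
      (use assms in \<open>auto simp: Pi_def free_moduleD subset_iff\<close>)
qed

lemma linear_map_lin_ext:
  assumes M: "module R M" and f: "f \<in> A \<rightarrow> carrier M"
  shows "linear_map R (free_module R A) M (lin_ext R M f)"
proof (rule linear_mapI)
  interpret M: module R M by fact
  interpret F: module R "free_module R A" by (rule module_free_module)
  fix x assume x: "x \<in> carrier (free_module R A)"
  have cl: "(\<lambda>z. c z \<odot>\<^bsub>M\<^esub> f z) \<in> S \<rightarrow> carrier M"
    if "c \<in> carrier (free_module R A)" "S \<subseteq> A" for c S
    using that f by (auto simp: Pi_def subset_iff free_moduleD(1)[OF that(1)])
  show "lin_ext R M f x \<in> carrier M"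
    unfolding lin_ext_def by (rule M.M.finsum_closed[OF cl[OF x free_moduleD(4)[OF x]]])
  {
    fix y assume y: "y \<in> carrier (free_module R A)"
    let ?S = "{z. x z \<noteq> \<zero>} \<union> {z. y z \<noteq> \<zero>}"
    have S: "finite ?S" "?S \<subseteq> A" using free_moduleD[OF x] free_moduleD[OF y] by auto
    have xy: "x \<oplus>\<^bsub>free_module R A\<^esub> y \<in> carrier (free_module R A)"
      using x y by (simp del: free_module_sel)
    have "lin_ext R M f (x \<oplus>\<^bsub>free_module R A\<^esub> y)
        = (\<Oplus>\<^bsub>M\<^esub>z\<in>?S. (x z \<oplus> y z) \<odot>\<^bsub>M\<^esub> f z)"
      by (subst lin_ext_superset[OF M f xy S(1) _ S(2)]) auto
    also have "\<dots> = (\<Oplus>\<^bsub>M\<^esub>z\<in>?S. x z \<odot>\<^bsub>M\<^esub> f z \<oplus>\<^bsub>M\<^esub> y z \<odot>\<^bsub>M\<^esub> f z)"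
    proof (rule M.M.finsum_cong')
      show "(x z \<oplus> y z) \<odot>\<^bsub>M\<^esub> f z = x z \<odot>\<^bsub>M\<^esub> f z \<oplus>\<^bsub>M\<^esub> y z \<odot>\<^bsub>M\<^esub> f z" if "z \<in> ?S" for z
        by (rule M.smult_l_distr[OF free_moduleD(1)[OF x] free_moduleD(1)[OF y] funcset_mem[OF f subsetD[OF S(2) that]]])
      show "(\<lambda>z. x z \<odot>\<^bsub>M\<^esub> f z \<oplus>\<^bsub>M\<^esub> y z \<odot>\<^bsub>M\<^esub> f z) \<in> ?S \<rightarrow> carrier M"
        using cl[OF x S(2)] cl[OF y S(2)] by (auto simp: Pi_def)
    qed simp
    also have "\<dots> = (\<Oplus>\<^bsub>M\<^esub>z\<in>?S. x z \<odot>\<^bsub>M\<^esub> f z) \<oplus>\<^bsub>M\<^esub> (\<Oplus>\<^bsub>M\<^esub>z\<in>?S. y z \<odot>\<^bsub>M\<^esub> f z)"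
      by (rule M.M.finsum_addf) (rule cl[OF x S(2)] cl[OF y S(2)])+
    also have "(\<Oplus>\<^bsub>M\<^esub>z\<in>?S. x z \<odot>\<^bsub>M\<^esub> f z) = lin_ext R M f x"
      by (rule lin_ext_superset[symmetric, OF M f x S(1) _ S(2)]) auto
    also have "(\<Oplus>\<^bsub>M\<^esub>z\<in>?S. y z \<odot>\<^bsub>M\<^esub> f z) = lin_ext R M f y"
      by (rule lin_ext_superset[symmetric, OF M f y S(1) _ S(2)]) auto
    finally show "lin_ext R M f (x \<oplus>\<^bsub>free_module R A\<^esub> y) = lin_ext R M f x \<oplus>\<^bsub>M\<^esub> lin_ext R M f y" .
  }
  {
    fix r assume r: "r \<in> carrier R"
    let ?S = "{z. x z \<noteq> \<zero>}"
    have S: "finite ?S" "?S \<subseteq> A" using free_moduleD[OF x] by auto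
    have rx: "r \<odot>\<^bsub>free_module R A\<^esub> x \<in> carrier (free_module R A)"
      using x r by (simp del: free_module_sel)
    have "lin_ext R M f (r \<odot>\<^bsub>free_module R A\<^esub> x) = (\<Oplus>\<^bsub>M\<^esub>z\<in>?S. (r \<otimes> x z) \<odot>\<^bsub>M\<^esub> f z)"
      by (subst lin_ext_superset[OF M f rx S(1) _ S(2)]) (auto simp: r)
    also have "\<dots> = (\<Oplus>\<^bsub>M\<^esub>z\<in>?S. r \<odot>\<^bsub>M\<^esub> (x z \<odot>\<^bsub>M\<^esub> f z))"
    proof (rule M.M.finsum_cong')
      show "(r \<otimes> x z) \<odot>\<^bsub>M\<^esub> f z = r \<odot>\<^bsub>M\<^esub> (x z \<odot>\<^bsub>M\<^esub> f z)" if "z \<in> ?S" for z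
        by (rule M.smult_assoc1[OF r free_moduleD(1)[OF x] funcset_mem[OF f subsetD[OF S(2) that]]])
      show "(\<lambda>z. r \<odot>\<^bsub>M\<^esub> (x z \<odot>\<^bsub>M\<^esub> f z)) \<in> ?S \<rightarrow> carrier M"
        using cl[OF x S(2)] r by (auto simp: Pi_def)
    qed simp
    also have "\<dots> = r \<odot>\<^bsub>M\<^esub> lin_ext R M f x"
      unfolding lin_ext_def
      by (rule M.finsum_smult_ldistr[symmetric, OF S(1) r cl[OF x S(2)]])
    finally show "lin_ext R M f (r \<odot>\<^bsub>free_module R A\<^esub> x) = r \<odot>\<^bsub>M\<^esub> lin_ext R M f x" .
  }
qed (rule module_free_module M)+

lemma lin_ext_delta:
  assumes M: "module R M" and f: "f \<in> A \<rightarrow> carrier M" and z: "z \<in> A"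
  shows "lin_ext R M f (delta R z) = f z"
proof -
  interpret M: module R M by fact
  have "lin_ext R M f (delta R z) = (\<Oplus>\<^bsub>M\<^esub>z'\<in>{z}. delta R z z' \<odot>\<^bsub>M\<^esub> f z')"
    by (rule lin_ext_superset[OF M f delta_closed[OF z]]) (use z in \<open>auto simp: delta_def\<close>)
  then show ?thesis using z f by (auto simp: delta_def M.M.finsum_insert Pi_def)
qed

lemma lin_ext_delta_id:
  assumes c: "c \<in> carrier (free_module R A)"
  shows "lin_ext R (free_module R A) (delta R) c = c"
proof
  fix z
  have S: "finite {z. c z \<noteq> \<zero>}" by (rule free_moduleD[OF c])
  have *: "(\<lambda>w. c w \<odot>\<^bsub>free_module R A\<^esub> delta R w) \<in> {w. c w \<noteq> \<zero>} \<rightarrow> carrier (free_module R A)"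
    by (auto intro!: module.smult_closed[OF module_free_module] delta_closed free_moduleD(1)[OF c]
      subsetD[OF free_moduleD(4)[OF c]] simp del: free_module_sel)
  have "lin_ext R (free_module R A) (delta R) c z
      = (\<Oplus>w\<in>{w. c w \<noteq> \<zero>}. c w \<otimes> delta R w z)"
    unfolding lin_ext_def by (subst finsum_free_module[OF *]) simp
  also have "\<dots> = (\<Oplus>w\<in>{w. c w \<noteq> \<zero>}. if z = w then c w else \<zero>)"
    by (rule finsum_cong') (auto simp: delta_def free_moduleD(1)[OF c])
  also have "\<dots> = c z"
  proof (cases "c z = \<zero>")
    case True
    then have "(\<Oplus>w\<in>{w. c w \<noteq> \<zero>}. if z = w then c w else \<zero>) = (\<Oplus>w\<in>{w. c w \<noteq> \<zero>}. \<zero>)"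
      by (intro finsum_cong') auto
    then show ?thesis using True by simp
  next
    case False
    then show ?thesis
      using add.finprod_singleton[of z "{w. c w \<noteq> \<zero>}" c] S free_moduleD(1)[OF c] by auto
  qed
  finally show "lin_ext R (free_module R A) (delta R) c z = c z" .
qed

lemma linear_map_free_expand:
  assumes f: "linear_map R (free_module R A) M f" and c: "c \<in> carrier (free_module R A)"
  shows "f c = lin_ext R M (\<lambda>z. f (delta R z)) c"
proof -
  interpret f: linear_map R "free_module R A" M f by fact
  have S: "{z. c z \<noteq> \<zero>} \<subseteq> A" by (rule free_moduleD[OF c])
  have cl: "c z \<in> carrier R" "delta R z \<in> carrier (free_module R A)" if "c z \<noteq> \<zero>" for z
    using that S free_moduleD(1)[OF c] by (auto intro: delta_closed)
  have "f c = f (lin_ext R (free_module R A) (delta R) c)" by (simp add: lin_ext_delta_id c)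
  also have "\<dots> = (\<Oplus>\<^bsub>M\<^esub>z\<in>{z. c z \<noteq> \<zero>}. f (c z \<odot>\<^bsub>free_module R A\<^esub> delta R z))"
    unfolding lin_ext_def by (rule f.finsum) (auto simp: cl simp del: free_module_sel)
  also have "\<dots> = lin_ext R M (\<lambda>z. f (delta R z)) c"
    unfolding lin_ext_def
    by (rule f.cod.M.finsum_cong') (auto simp: cl f.smult simp del: free_module_sel)
  finally show ?thesis .
qed

text \<open>
  The uniqueness half of the universal property. Nearly every identity between linear maps below is
  checked on basis elements through this lemma.
\<close>

lemma linear_map_free_eqI:
  assumes "linear_map R (free_module R A) M f" "linear_map R (free_module R A) M g"
    and "\<And>z. z \<in> A \<Longrightarrow> f (delta R z) = g (delta R z)" "c \<in> carrier (free_module R A)"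
  shows "f c = g c"
proof -
  interpret g: linear_map R "free_module R A" M g by fact
  have S: "{z. c z \<noteq> \<zero>} \<subseteq> A" by (rule free_moduleD[OF assms(4)])
  have "lin_ext R M (\<lambda>z. f (delta R z)) c = lin_ext R M (\<lambda>z. g (delta R z)) c"
    unfolding lin_ext_def using S
    by (intro g.cod.M.finsum_cong')
      (auto intro!: g.cod.smult_closed g.closed delta_closed free_moduleD(1)[OF assms(4)] simp: assms(3) subset_iff)
  then show ?thesis
    using linear_map_free_expand[OF assms(1,4)] linear_map_free_expand[OF assms(2,4)] by simp
qed

text \<open>
  Injectivity: in a nonzero \<open>c\<close>, a basis element of maximal rank among those that occur keeps its
  coefficient in \<open>f c\<close>, as no other term can contribute to it. Surjectivity: by induction on the rank
  of \<open>v\<close>, the error \<open>delta v - f (delta v)\<close> only involves basis elements of smaller rank, which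
  are already known to be values of \<open>f\<close>.
\<close>

lemma unitriangular_bij:
  fixes rank :: "'k \<Rightarrow> nat"
  assumes f: "linear_map R (free_module R P) (free_module R P) f"
    and diag: "\<And>v. v \<in> P \<Longrightarrow> f (delta R v) v = \<one>"
    and lower: "\<And>u v. v \<in> P \<Longrightarrow> f (delta R v) u \<noteq> \<zero> \<Longrightarrow> u = v \<or> rank u < rank v"
  shows "bij_betw f (carrier (free_module R P)) (carrier (free_module R P))"
proof -
  interpret f: linear_map R "free_module R P" "free_module R P" f by fact
  let ?F = "free_module R P"
  have fd: "f (delta R v) \<in> carrier ?F" if "v \<in> P" for v
    by (rule f.closed[OF delta_closed[OF that]])
  have ker: "c = \<zero>\<^bsub>?F\<^esub>" if c: "c \<in> carrier ?F" and fc: "f c = \<zero>\<^bsub>?F\<^esub>" for c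
  proof (rule ccontr)
    let ?S = "{z. c z \<noteq> \<zero>}"
    assume "c \<noteq> \<zero>\<^bsub>?F\<^esub>"
    then have "?S \<noteq> {}" by (auto simp: fun_eq_iff)
    have S: "finite ?S" "?S \<subseteq> P" by (rule free_moduleD[OF c])+
    obtain v where v: "v \<in> ?S" "\<And>w. w \<in> ?S \<Longrightarrow> rank w \<le> rank v"
    proof -
      have "Max (rank ` ?S) \<in> rank ` ?S" using \<open>?S \<noteq> {}\<close> S(1) by (intro Max_in finite_imageI) (simp_all only: image_is_empty not_False_eq_True)
      then obtain v where v: "Max (rank ` ?S) = rank v" "v \<in> ?S" by (rule imageE)
      have "rank w \<le> rank v" if "w \<in> ?S" for w
        unfolding v(1)[symmetric] using S(1) that by (intro Max_ge finite_imageI imageI)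
      then show thesis using v(2) by (rule that[rotated])
    qed
    have *: "(\<lambda>w. c w \<odot>\<^bsub>?F\<^esub> f (delta R w)) \<in> ?S \<rightarrow> carrier ?F"
      using S(2) by (auto simp: subset_iff free_moduleD(1)[OF c] fd simp del: free_module_sel)
    have "f c v = (\<Oplus>w\<in>?S. c w \<otimes> f (delta R w) v)"
      unfolding linear_map_free_expand[OF f c] lin_ext_def
      by (subst finsum_free_module[OF *]) simp
    also have "\<dots> = (\<Oplus>w\<in>?S. if v = w then c w else \<zero>)"
    proof (rule finsum_cong')
      fix w assume w: "w \<in> ?S"
      have "f (delta R w) v = \<zero>" if "w \<noteq> v"
      proof (rule ccontr)
      assume "f (delta R w) v \<noteq> \<zero>"
      then have "rank w > rank v" using lower[of w v] that w S(2) by auto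
      then show False using v(2)[OF w] by simp
    qed
      then show "c w \<otimes> f (delta R w) v = (if v = w then c w else \<zero>)"
        using diag[of v] v(1) S(2) by (auto simp: free_moduleD(1)[OF c])
    qed (auto simp: free_moduleD(1)[OF c])
    also have "\<dots> = c v"
      using add.finprod_singleton[of v ?S c] S v(1) free_moduleD(1)[OF c] by auto
    finally show False using v(1) fc by simp
  qed
  have inj: "inj_on f (carrier ?F)"
  proof (rule inj_onI)
    fix c d assume cd: "c \<in> carrier ?F" "d \<in> carrier ?F" "f c = f d"
    have "f (c \<ominus>\<^bsub>?F\<^esub> d) = f d \<ominus>\<^bsub>?F\<^esub> f d"
      using cd by (simp only: f.diff)
    also have "\<dots> = \<zero>\<^bsub>?F\<^esub>"
      using f.closed[OF cd(2)] by (simp only: a_minus_def f.dom.M.r_neg)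
    finally have "f (c \<ominus>\<^bsub>?F\<^esub> d) = \<zero>\<^bsub>?F\<^esub>" .
    then have "c \<ominus>\<^bsub>?F\<^esub> d = \<zero>\<^bsub>?F\<^esub>" 
      by (rule ker[OF f.dom.M.minus_closed[OF cd(1,2)]])

    moreover have "c = (c \<ominus>\<^bsub>?F\<^esub> d) \<oplus>\<^bsub>?F\<^esub> d"
      unfolding a_minus_def f.dom.M.a_assoc[OF cd(1) f.dom.M.a_inv_closed[OF cd(2)] cd(2)]
      by (simp only: f.dom.M.l_neg[OF cd(2)] f.dom.M.r_zero[OF cd(1)])
    ultimately show "c = d" by (simp only: f.dom.M.l_zero[OF cd(2)])
  qed
  \<comment> \<open>The image of a linear map contains every combination of basis elements that it contains.\<close>
  have lift: "\<exists>c\<in>carrier ?F. f c = d"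
    if d: "d \<in> carrier ?F" and "\<And>u. d u \<noteq> \<zero> \<Longrightarrow> \<exists>c\<in>carrier ?F. f c = delta R u" for d
  proof -
    from that(2) obtain g where g: "\<And>u. d u \<noteq> \<zero> \<Longrightarrow> g u \<in> carrier ?F \<and> f (g u) = delta R u" by metis
    have cl: "(\<lambda>u. d u \<odot>\<^bsub>?F\<^esub> g u) \<in> {u. d u \<noteq> \<zero>} \<rightarrow> carrier ?F"
      using g by (auto simp: free_moduleD(1)[OF d] simp del: free_module_sel)
    have "f (lin_ext R ?F g d) = (\<Oplus>\<^bsub>?F\<^esub>u\<in>{u. d u \<noteq> \<zero>}. f (d u \<odot>\<^bsub>?F\<^esub> g u))"
      unfolding lin_ext_def by (rule f.finsum[OF cl])
    also have "\<dots> = lin_ext R ?F (delta R) d"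
      unfolding lin_ext_def using g free_moduleD(4)[OF d]
      by (intro f.dom.M.finsum_cong')
        (auto simp: f.smult free_moduleD(1)[OF d] delta_closed subset_iff simp del: free_module_sel)
    finally have "f (lin_ext R ?F g d) = d" by (simp add: lin_ext_delta_id[OF d])
    moreover have "lin_ext R ?F g d \<in> carrier ?F"
      unfolding lin_ext_def by (rule f.dom.M.finsum_closed[OF cl])
    ultimately show ?thesis by blast
  qed
  have deltas: "\<exists>c\<in>carrier ?F. f c = delta R v" if "v \<in> P" for v
    using that
  proof (induction "rank v" arbitrary: v rule: less_induct)
    case less
    let ?d = "delta R v \<ominus>\<^bsub>?F\<^esub> f (delta R v)"
    have dv: "delta R v \<in> carrier ?F" using less.prems by (rule delta_closed)
    have d: "?d \<in> carrier ?F" by (rule f.dom.M.minus_closed[OF dv fd[OF less.prems]])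
    have "rank u < rank v" if "?d u \<noteq> \<zero>" for u
    proof -
      have eq: "?d u = delta R v u \<ominus> f (delta R v) u"
        by (simp add: a_minus_def free_module_minus[OF fd[OF less.prems]])
      have "u \<noteq> v" using that eq diag[OF less.prems] by (auto simp: delta_def r_neg a_minus_def)
      then have "f (delta R v) u \<noteq> \<zero>"
        using that eq by (auto simp: delta_def a_minus_def)
      then show ?thesis using lower[OF less.prems] \<open>u \<noteq> v\<close> by blast
    qed
    moreover have "u \<in> P" if "?d u \<noteq> \<zero>" for u
      using free_moduleD(3)[OF d, of u] that by (rule contrapos_np[rotated])
    ultimately have "\<exists>c\<in>carrier ?F. f c = delta R u" if "?d u \<noteq> \<zero>" for u
      using that by (intro less.hyps)
    then obtain c where c: "c \<in> carrier ?F" "f c = ?d"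
      using lift[OF d] by blast
    have "f (c \<oplus>\<^bsub>?F\<^esub> delta R v) = ?d \<oplus>\<^bsub>?F\<^esub> f (delta R v)"
      by (simp only: f.add[OF c(1) dv] c(2))
    also have "\<dots> = delta R v"
      unfolding a_minus_def
        f.dom.M.a_assoc[OF dv f.dom.M.a_inv_closed[OF fd[OF less.prems]] fd[OF less.prems]]
      by (simp only: f.dom.M.l_neg[OF fd[OF less.prems]] f.dom.M.r_zero[OF dv])
    finally show ?case using f.dom.M.a_closed[OF c(1) dv] by (rule bexI)
  qed
  have "f ` carrier ?F = carrier ?F"
  proof
    show "f ` carrier ?F \<subseteq> carrier ?F" using f.closed by (rule image_subsetI)
    show "carrier ?F \<subseteq> f ` carrier ?F"
    proof
      fix d assume d: "d \<in> carrier ?F"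
      have "u \<in> P" if "d u \<noteq> \<zero>" for u
        using free_moduleD(3)[OF d, of u] that by (rule contrapos_np[rotated])
      then obtain c where c: "c \<in> carrier ?F" "f c = d"
        using lift[OF d deltas] by blast
      show "d \<in> f ` carrier ?F" using imageI[OF c(1), of f] by (simp only: c(2))
    qed
  qed
  with inj show ?thesis by (rule bij_betw_imageI)
qed

end

section \<open>Double sums in abelian groups\<close>

context abelian_monoid
begin

lemma finsum_swap:
  assumes "finite I" "\<And>i j. i \<in> I \<Longrightarrow> j \<in> J \<Longrightarrow> g i j \<in> carrier G"
  shows "(\<Oplus>i\<in>I. \<Oplus>j\<in>J. g i j) = (\<Oplus>j\<in>J. \<Oplus>i\<in>I. g i j)"
  using assms
proof (induction I rule: finite_induct)
  case (insert k I)
  have cl: "(\<lambda>i. \<Oplus>j\<in>J. g i j) \<in> I \<rightarrow> carrier G" "(\<lambda>j. \<Oplus>i\<in>I. g i j) \<in> J \<rightarrow> carrier G"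
    "g k \<in> J \<rightarrow> carrier G"
    using insert.prems by (auto intro!: finsum_closed)
  have "(\<Oplus>i\<in>insert k I. \<Oplus>j\<in>J. g i j) = (\<Oplus>j\<in>J. g k j) \<oplus> (\<Oplus>j\<in>J. \<Oplus>i\<in>I. g i j)"
    using insert cl by (subst finsum_insert) (auto intro!: finsum_closed)
  also have "\<dots> = (\<Oplus>j\<in>J. g k j \<oplus> (\<Oplus>i\<in>I. g i j))"
    using cl by (subst finsum_addf) auto
  also have "\<dots> = (\<Oplus>j\<in>J. \<Oplus>i\<in>insert k I. g i j)"
  proof (rule finsum_cong')
    show "g k j \<oplus> (\<Oplus>i\<in>I. g i j) = (\<Oplus>i\<in>insert k I. g i j)" if "j \<in> J" for j
      using insert that by (subst finsum_insert) auto
    show "(\<lambda>j. \<Oplus>i\<in>insert k I. g i j) \<in> J \<rightarrow> carrier G"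
      using insert.prems by (auto intro!: finsum_closed)
  qed simp
  finally show ?case .
qed simp

text \<open>
  The cancellation behind \<open>\<partial>\<partial> = 0\<close>, by induction on \<open>n\<close>: the step adds one row (first index
  \<open>n + 2\<close>) and one column (second index \<open>n + 1\<close>), whose entries cancel in pairs.
\<close>

lemma double_sum_cancel:
  fixes h :: "nat \<Rightarrow> nat \<Rightarrow> 'a"
  assumes "\<And>i j. h i j \<in> carrier G"
    and "\<And>i j. i < j \<Longrightarrow> j \<le> Suc n \<Longrightarrow> h j i \<oplus> h i (j - 1) = \<zero>"
  shows "(\<Oplus>j\<in>{..Suc n}. \<Oplus>i\<in>{..n}. h j i) = \<zero>"
  using assms(2)
proof (induction n)
  case 0
  have "(\<Oplus>j\<in>{..Suc 0}. \<Oplus>i\<in>{..0}. h j i) = h 1 0 \<oplus> h 0 0"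
    using assms(1) by (simp add: finsum_Suc Pi_def)
  then show ?case using 0[of 0 1] by simp
next
  case (Suc n)
  have cl: "(\<lambda>i. h j i) \<in> A \<rightarrow> carrier G" "(\<lambda>i. h i j) \<in> A \<rightarrow> carrier G"
    "(\<Oplus>i\<in>A. h j i) \<in> carrier G" "(\<Oplus>i\<in>A. h i j) \<in> carrier G"
    "(\<lambda>j. \<Oplus>i\<in>A. h j i) \<in> B \<rightarrow> carrier G" for j A B
    using assms(1) by (auto intro!: finsum_closed)
  have "(\<Oplus>j\<in>{..Suc (Suc n)}. \<Oplus>i\<in>{..Suc n}. h j i)
      = (\<Oplus>i\<in>{..Suc n}. h (Suc (Suc n)) i) \<oplus> (\<Oplus>j\<in>{..Suc n}. \<Oplus>i\<in>{..Suc n}. h j i)"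
    by (rule finsum_Suc[OF cl(5)])
  also have "(\<Oplus>j\<in>{..Suc n}. \<Oplus>i\<in>{..Suc n}. h j i)
      = (\<Oplus>j\<in>{..Suc n}. h j (Suc n) \<oplus> (\<Oplus>i\<in>{..n}. h j i))"
    using assms(1) cl by (intro finsum_cong' finsum_Suc) auto
  also have "\<dots> = (\<Oplus>j\<in>{..Suc n}. h j (Suc n)) \<oplus> (\<Oplus>j\<in>{..Suc n}. \<Oplus>i\<in>{..n}. h j i)"
    by (rule finsum_addf[OF cl(2,5)])
  also have "(\<Oplus>j\<in>{..Suc n}. \<Oplus>i\<in>{..n}. h j i) = \<zero>"
    by (rule Suc.IH) (rule Suc.prems, auto)
  also have "(\<Oplus>i\<in>{..Suc n}. h (Suc (Suc n)) i) \<oplus> ((\<Oplus>j\<in>{..Suc n}. h j (Suc n)) \<oplus> \<zero>)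
      = (\<Oplus>i\<in>{..Suc n}. h (Suc (Suc n)) i \<oplus> h i (Suc n))"
    by (simp only: r_zero[OF cl(4)] finsum_addf[OF cl(1,2)])
  also have "\<dots> = (\<Oplus>i\<in>{..Suc n}. \<zero>)"
  proof (rule finsum_cong')
    show "h (Suc (Suc n)) i \<oplus> h i (Suc n) = \<zero>" if "i \<in> {..Suc n}" for i
      using Suc.prems[of i "Suc (Suc n)"] that by simp
  qed auto
  finally show ?case by simp
qed

end

section \<open>Diagonal complexes\<close>

lemma prod_module_sel [simp]:
  "carrier (prod_module I M) = (\<Pi>\<^sub>E i\<in>I. carrier (M i))"
  "zero (prod_module I M) = (\<lambda>i\<in>I. \<zero>\<^bsub>M i\<^esub>)"
  "v \<oplus>\<^bsub>prod_module I M\<^esub> w = (\<lambda>i\<in>I. v i \<oplus>\<^bsub>M i\<^esub> w i)"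
  "r \<odot>\<^bsub>prod_module I M\<^esub> v = (\<lambda>i\<in>I. r \<odot>\<^bsub>M i\<^esub> v i)"
  by (simp_all add: prod_module_def)

lemma module_prod_module:
  assumes "cring R" and "\<And>i. i \<in> I \<Longrightarrow> module R (M i)"
  shows "module R (prod_module I M)"
proof -
  interpret cring R by fact
  have ab: "abelian_group (M i)" if "i \<in> I" for i
    using assms(2)[OF that] by (simp add: module_def)
  show ?thesis
  proof (rule moduleI)
    show "abelian_group (prod_module I M)"
    proof (rule abelian_groupI)
      fix x assume x: "x \<in> carrier (prod_module I M)"
      show "\<exists>y\<in>carrier (prod_module I M).
        y \<oplus>\<^bsub>prod_module I M\<^esub> x = \<zero>\<^bsub>prod_module I M\<^esub>"
        by (rule bexI[of _ "\<lambda>i\<in>I. \<ominus>\<^bsub>M i\<^esub> x i"])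
          (auto intro!: restrict_ext abelian_group.l_neg[OF ab] abelian_group.a_inv_closed[OF ab] PiE_mem[OF x[simplified]])
    qed (auto simp: PiE_iff extensional_def fun_eq_iff intro: abelian_groupE[OF ab])
  qed (auto simp: PiE_iff extensional_def fun_eq_iff module.smult_closed[OF assms(2)] module.smult_l_distr[OF assms(2)]
      module.smult_r_distr[OF assms(2)] module.smult_assoc1[OF assms(2)] module.smult_one[OF assms(2)]
      is_cring)
qed

lemma linear_map_proj:
  assumes "cring R" "\<And>i. i \<in> I \<Longrightarrow> module R (M i)" "k \<in> I"
  shows "linear_map R (prod_module I M) (M k) (\<lambda>w. w k)"
  using assms by (intro linear_mapI module_prod_module) auto

lemma linear_map_restrict:
  assumes "cring R" "module R L" "\<And>i. i \<in> I \<Longrightarrow> linear_map R L (M i) (f i)"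
  shows "linear_map R L (prod_module I M) (\<lambda>x. \<lambda>i\<in>I. f i x)"
  using assms
  by (intro linear_mapI module_prod_module)
    (auto intro!: restrict_ext intro: linear_map.closed linear_map_modules(2)
      linear_map.add[OF assms(3)] linear_map.smult[OF assms(3)])

lemma linear_map_diff:
  assumes "linear_map R M N f" "linear_map R M N g"
  shows "linear_map R M N (\<lambda>x. f x \<ominus>\<^bsub>N\<^esub> g x)"
proof -
  interpret f: linear_map R M N f by fact
  interpret g: linear_map R M N g by fact
  show ?thesis
    by (rule linear_mapI)
      (auto simp: f.add f.smult g.add g.smult linear_map_modules[OF assms(1)] a_minus_def
        f.cod.smult_r_minus f.cod.M.minus_add f.cod.smult_r_distr f.cod.M.a_ac)
qed

lemma alt_sign_zero:
  assumes "module R M"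
  shows "alt_sign M n \<zero>\<^bsub>M\<^esub> = \<zero>\<^bsub>M\<^esub>"
proof -
  interpret M: module R M by fact
  have "\<ominus>\<^bsub>M\<^esub> \<zero>\<^bsub>M\<^esub> = \<zero>\<^bsub>M\<^esub>" by (rule M.M.minus_equality) auto
  then show ?thesis by (simp add: alt_sign_def)
qed

text \<open>
  The differentials commute rather than anticommute; the signs are in the diagonal differential.
\<close>

locale commuting_bicomplex =
  fixes R :: "('r, 'x) ring_scheme" and W :: "('r, 'w) bicomplex"
  assumes R: "cring R"
    and module_bi: "\<And>p q. module R (bi_module W p q)"
    and hdiff: "\<And>p q. linear_map R (bi_module W (p - 1) q) (bi_module W p q) (hdiff W p q)"
    and vdiff: "\<And>p q. linear_map R (bi_module W p q) (bi_module W p (q - 1)) (vdiff W p q)"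
    and hdiff_hdiff: "\<And>p q x. x \<in> carrier (bi_module W (p - 2) q) \<Longrightarrow>
      hdiff W p q (hdiff W (p - 1) q x) = \<zero>\<^bsub>bi_module W p q\<^esub>"
    and vdiff_vdiff: "\<And>p q x. x \<in> carrier (bi_module W p q) \<Longrightarrow>
      vdiff W p (q - 1) (vdiff W p q x) = \<zero>\<^bsub>bi_module W p (q - 2)\<^esub>"
    and vdiff_hdiff: "\<And>p q x. x \<in> carrier (bi_module W (p - 1) q) \<Longrightarrow>
      vdiff W p q (hdiff W p q x) = hdiff W p (q - 1) (vdiff W (p - 1) q x)"
begin

lemma chain_module_diagonal:
  "chain_module (diagonal W) n = prod_module (diag_index n) (\<lambda>i. bi_module W (fst i) (snd i))"
  by (simp add: diagonal_def case_prod_unfold)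

lemma module_diagonal: "module R (chain_module (diagonal W) n)"
  unfolding chain_module_diagonal by (intro module_prod_module R module_bi)

lemma diagonal_proj:
  "q - p = n \<Longrightarrow> linear_map R (chain_module (diagonal W) n) (bi_module W p q) (\<lambda>w. w (p, q))"
  unfolding chain_module_diagonal
  using linear_map_proj[of R "diag_index n" "\<lambda>i. bi_module W (fst i) (snd i)" "(p, q)"]
  by (simp add: R module_bi diag_index_def)

lemma differential_diagonal:
  "q - p = n - 1 \<Longrightarrow> differential (diagonal W) n w (p, q) =
    vdiff W p (q + 1) (w (p, q + 1))
      \<ominus>\<^bsub>bi_module W p q\<^esub> alt_sign (bi_module W p q) n (hdiff W p q (w (p - 1, q)))"
  by (simp add: diagonal_def diag_index_def)

lemma linear_differential:
  "linear_map R (chain_module (diagonal W) n) (chain_module (diagonal W) (n - 1))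
    (differential (diagonal W) n)"
proof -
  have "linear_map R (chain_module (diagonal W) n) (bi_module W p q)
      (\<lambda>w. vdiff W p (q + 1) (w (p, q + 1))
      \<ominus>\<^bsub>bi_module W p q\<^esub> alt_sign (bi_module W p q) n (hdiff W p q (w (p - 1, q))))"
    if "q - p = n - 1" for p q
    using that
    by (intro linear_map_diff linear_map_alt_sign linear_map_comp[OF diagonal_proj vdiff[of p "q + 1", simplified]]
        linear_map_comp[OF diagonal_proj hdiff]) auto
  then show ?thesis
    unfolding chain_module_diagonal[of "n - 1"]
    by (subst diagonal_def) (auto simp: diag_index_def case_prod_unfold intro!: linear_map_restrict R module_diagonal)
qed

lemma diagonal_eqI:
  assumes "v \<in> carrier (chain_module (diagonal W) n)" "w \<in> carrier (chain_module (diagonal W) n)"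
    and "\<And>p q. q - p = n \<Longrightarrow> v (p, q) = w (p, q)"
  shows "v = w"
  using assms(1,2) unfolding chain_module_diagonal prod_module_sel
  by (rule PiE_ext) (auto simp: diag_index_def assms(3))

text \<open>
  At \<open>(p, q)\<close> the terms with \<open>d''d''\<close> and \<open>d'd'\<close> vanish. The two mixed terms carry the signs
  \<open>(-1)\<^sup>n\<close> and \<open>(-1)\<^sup>n\<^sup>-\<^sup>1\<close>, because the degree drops by one between the two applications.
\<close>

lemma differential_differential:
  assumes w: "w \<in> carrier (chain_module (diagonal W) n)"
  shows "differential (diagonal W) (n - 1) (differential (diagonal W) n w)
    = \<zero>\<^bsub>chain_module (diagonal W) (n - 2)\<^esub>"
proof (rule diagonal_eqI[where n = "n - 2"])
  interpret d: linear_map R "chain_module (diagonal W) n" "chain_module (diagonal W) (n - 1)" "differential (diagonal W) n"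
    by (rule linear_differential)
  interpret d': linear_map R "chain_module (diagonal W) (n - 1)" "chain_module (diagonal W) (n - 2)" "differential (diagonal W) (n - 1)"
    using linear_differential[of "n - 1"] by simp
  show "differential (diagonal W) (n - 1) (differential (diagonal W) n w) \<in> carrier (chain_module (diagonal W) (n - 2))"
    using w by (intro d'.closed d.closed)
  show "\<zero>\<^bsub>chain_module (diagonal W) (n - 2)\<^esub> \<in> carrier (chain_module (diagonal W) (n - 2))"
    by (rule d'.cod.M.zero_closed)
  fix p q assume pq: "q - p = n - 2"
  interpret B: module R "bi_module W p q" by (rule module_bi)
  interpret v: linear_map R "bi_module W p (q + 1)" "bi_module W p q" "vdiff W p (q + 1)"
    using vdiff[of p "q + 1"] by simp
  interpret v2: linear_map R "bi_module W p (q + 2)" "bi_module W p (q + 1)" "vdiff W p (q + 2)"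
    using vdiff[of p "q + 2"] by (simp add: add.commute)
  interpret h: linear_map R "bi_module W (p - 1) q" "bi_module W p q" "hdiff W p q"
    using hdiff[of p q] by simp
  interpret h2: linear_map R "bi_module W (p - 2) q" "bi_module W (p - 1) q" "hdiff W (p - 1) q"
    using hdiff[of "p - 1" q] by simp
  interpret h1: linear_map R "bi_module W (p - 1) (q + 1)" "bi_module W p (q + 1)" "hdiff W p (q + 1)"
    by (rule hdiff)
  interpret v1: linear_map R "bi_module W (p - 1) (q + 1)" "bi_module W (p - 1) q" "vdiff W (p - 1) (q + 1)"
    using vdiff[of "p - 1" "q + 1"] by simp
  let ?a = "w (p, q + 2)" and ?b = "w (p - 1, q + 1)" and ?c = "w (p - 2, q)"
  have a: "?a \<in> carrier (bi_module W p (q + 2))"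
    and b: "?b \<in> carrier (bi_module W (p - 1) (q + 1))"
    and c: "?c \<in> carrier (bi_module W (p - 2) q)"
    using pq by (auto intro!: linear_map.closed[OF diagonal_proj w])
  have 1: "differential (diagonal W) n w (p, q + 1) = vdiff W p (q + 2) ?a
      \<ominus>\<^bsub>bi_module W p (q + 1)\<^esub> alt_sign (bi_module W p (q + 1)) n (hdiff W p (q + 1) ?b)"
    using pq by (subst differential_diagonal) (auto simp: add.assoc)
  have 2: "differential (diagonal W) n w (p - 1, q) = vdiff W (p - 1) (q + 1) ?b
      \<ominus>\<^bsub>bi_module W (p - 1) q\<^esub> alt_sign (bi_module W (p - 1) q) n (hdiff W (p - 1) q ?c)"
    using pq by (subst differential_diagonal) auto
  let ?e = "hdiff W p q (vdiff W (p - 1) (q + 1) ?b)"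
  have e: "?e \<in> carrier (bi_module W p q)" using b by blast
  have neg0: "\<ominus>\<^bsub>bi_module W p q\<^esub> \<zero>\<^bsub>bi_module W p q\<^esub> = \<zero>\<^bsub>bi_module W p q\<^esub>"
    by (rule B.M.minus_equality) auto
  have "differential (diagonal W) (n - 1) (differential (diagonal W) n w) (p, q) =
      vdiff W p (q + 1) (differential (diagonal W) n w (p, q + 1))
      \<ominus>\<^bsub>bi_module W p q\<^esub> alt_sign (bi_module W p q) (n - 1) (hdiff W p q (differential (diagonal W) n w (p - 1, q)))"
    using pq by (subst differential_diagonal) auto
  also have "vdiff W p (q + 1) (differential (diagonal W) n w (p, q + 1)) =
      \<zero>\<^bsub>bi_module W p q\<^esub> \<ominus>\<^bsub>bi_module W p q\<^esub> alt_sign (bi_module W p q) n ?e"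
    unfolding 1 using a b vdiff_vdiff[of ?a p "q + 2"] add.commute[of 1 q] vdiff_hdiff[of ?b p "q + 1"]
    by (simp add: v.diff v.alt_sign alt_sign_closed[OF module_bi])
  also have "hdiff W p q (differential (diagonal W) n w (p - 1, q)) =
      ?e \<ominus>\<^bsub>bi_module W p q\<^esub> alt_sign (bi_module W p q) n \<zero>\<^bsub>bi_module W p q\<^esub>"
    unfolding 2 using b c hdiff_hdiff[of ?c p q]
    by (simp add: h.diff h.alt_sign alt_sign_closed[OF module_bi])
  also have "\<zero>\<^bsub>bi_module W p q\<^esub> \<ominus>\<^bsub>bi_module W p q\<^esub> alt_sign (bi_module W p q) n ?e
      \<ominus>\<^bsub>bi_module W p q\<^esub> alt_sign (bi_module W p q) (n - 1)
        (?e \<ominus>\<^bsub>bi_module W p q\<^esub> alt_sign (bi_module W p q) n \<zero>\<^bsub>bi_module W p q\<^esub>)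
      = \<zero>\<^bsub>bi_module W p q\<^esub>"
    unfolding alt_sign_zero[OF module_bi] using e
    by (cases "even n") (auto simp: alt_sign_def a_minus_def B.M.l_neg B.M.r_neg neg0)
  also have "\<dots> = \<zero>\<^bsub>chain_module (diagonal W) (n - 2)\<^esub> (p, q)"
    using pq by (simp add: chain_module_diagonal diag_index_def)
  finally show "differential (diagonal W) (n - 1) (differential (diagonal W) n w) (p, q)
      = \<zero>\<^bsub>chain_module (diagonal W) (n - 2)\<^esub> (p, q)" .
qed

lemma chain_complex_diagonal: "chain_complex R (diagonal W)"
  using linear_map.linear[OF linear_differential] differential_differential module_diagonal
  by (simp add: chain_complex_def)

end

lemma diagonal_chain_iso:
  assumes V: "commuting_bicomplex R V" and W: "commuting_bicomplex R W"
    and lin: "\<And>p q. linear_map R (bi_module V p q) (bi_module W p q) (e p q)"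
    and bij: "\<And>p q. bij_betw (e p q) (carrier (bi_module V p q)) (carrier (bi_module W p q))"
    and hdiff: "\<And>p q x. x \<in> carrier (bi_module V (p - 1) q) \<Longrightarrow>
      e p q (hdiff V p q x) = hdiff W p q (e (p - 1) q x)"
    and vdiff: "\<And>p q x. x \<in> carrier (bi_module V p q) \<Longrightarrow>
      e p (q - 1) (vdiff V p q x) = vdiff W p q (e p q x)"
  shows "chain_iso R (diagonal V) (diagonal W) (\<lambda>n w. \<lambda>(p, q)\<in>diag_index n. e p q (w (p, q)))"
proof -
  interpret V: commuting_bicomplex R V by fact
  interpret W: commuting_bicomplex R W by fact
  let ?f = "\<lambda>n w. \<lambda>(p, q)\<in>diag_index n. e p q (w (p, q))"
  have f: "?f n w (p, q) = e p q (w (p, q))" if "q - p = n" for n w p q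
    using that by (simp add: diag_index_def)
  have lin_f: "linear_map R (chain_module (diagonal V) n) (chain_module (diagonal W) n) (?f n)" for n
    unfolding W.chain_module_diagonal case_prod_unfold
    by (intro linear_map_restrict V.R V.module_diagonal) 
      (auto simp: diag_index_def intro!: linear_map_comp[OF V.diagonal_proj lin])
  have "?f (n - 1) (differential (diagonal V) n c) = differential (diagonal W) n (?f n c)"
    if c: "c \<in> carrier (chain_module (diagonal V) n)" for n c
  proof (rule W.diagonal_eqI[where n = "n - 1"])
    note dc = linear_map.closed[OF V.linear_differential c]
    show "?f (n - 1) (differential (diagonal V) n c) \<in> carrier (chain_module (diagonal W) (n - 1))"
      by (rule linear_map.closed[OF lin_f dc])
    show "differential (diagonal W) n (?f n c) \<in> carrier (chain_module (diagonal W) (n - 1))"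
      by (rule linear_map.closed[OF W.linear_differential linear_map.closed[OF lin_f c]])
    fix p q assume pq: "q - p = n - 1"
    interpret e: linear_map R "bi_module V p q" "bi_module W p q" "e p q" by (rule lin)
    have c1: "c (p, q + 1) \<in> carrier (bi_module V p (q + 1))"
      and c2: "c (p - 1, q) \<in> carrier (bi_module V (p - 1) q)"
      using pq by (auto intro!: linear_map.closed[OF V.diagonal_proj c])
    have d1: "vdiff V p (q + 1) (c (p, q + 1)) \<in> carrier (bi_module V p q)"
      using linear_map.closed[OF V.vdiff c1] by simp
    have d2: "hdiff V p q (c (p - 1, q)) \<in> carrier (bi_module V p q)"
      by (rule linear_map.closed[OF V.hdiff c2])
    have "?f (n - 1) (differential (diagonal V) n c) (p, q) = e p q (vdiff V p (q + 1) (c (p, q + 1))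
      \<ominus>\<^bsub>bi_module V p q\<^esub> alt_sign (bi_module V p q) n (hdiff V p q (c (p - 1, q))))"
      using pq by (simp only: f V.differential_diagonal)
    also have "\<dots> = vdiff W p (q + 1) (e p (q + 1) (c (p, q + 1)))
      \<ominus>\<^bsub>bi_module W p q\<^esub> alt_sign (bi_module W p q) n (hdiff W p q (e (p - 1) q (c (p - 1, q))))"
      using d1 d2 vdiff[OF c1] hdiff[OF c2]
      by (simp add: e.diff e.alt_sign alt_sign_closed[OF V.module_bi])
    also have "\<dots> = differential (diagonal W) n (?f n c) (p, q)"
      using pq by (simp add: W.differential_diagonal diag_index_def)
    finally show "?f (n - 1) (differential (diagonal V) n c) (p, q)
      = differential (diagonal W) n (?f n c) (p, q)" .
  qed
  moreover have "bij_betw (?f n) (carrier (chain_module (diagonal V) n)) (carrier (chain_module (diagonal W) n))" for n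
  proof (rule bij_betw_byWitness[where f' = "\<lambda>w. \<lambda>(p, q)\<in>diag_index n. inv_into (carrier (bi_module V p q)) (e p q) (w (p, q))"])
    let ?g = "\<lambda>w. \<lambda>(p, q)\<in>diag_index n. inv_into (carrier (bi_module V p q)) (e p q) (w (p, q))"
    have surj: "e p q ` carrier (bi_module V p q) = carrier (bi_module W p q)" for p q
      using bij by (rule bij_betw_imp_surj_on)
    have g_closed: "?g w \<in> carrier (chain_module (diagonal V) n)"
      if "w \<in> carrier (chain_module (diagonal W) n)" for w
      using that unfolding V.chain_module_diagonal W.chain_module_diagonal
      by (auto simp: case_prod_unfold PiE_iff surj intro!: inv_into_into)
    show "\<forall>w\<in>carrier (chain_module (diagonal V) n). ?g (?f n w) = w"
    proof
      fix w assume w: "w \<in> carrier (chain_module (diagonal V) n)"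
      show "?g (?f n w) = w"
      proof (rule V.diagonal_eqI[OF g_closed w])
        fix p q assume pq: "q - p = n"
        show "?g (?f n w) (p, q) = w (p, q)"
          using linear_map.closed[OF V.diagonal_proj[OF pq] w] pq
          by (simp add: diag_index_def bij_betw_inv_into_left[OF bij])
      qed (rule linear_map.closed[OF lin_f w])
    qed
    show "\<forall>w\<in>carrier (chain_module (diagonal W) n). ?f n (?g w) = w"
    proof
      fix w assume w: "w \<in> carrier (chain_module (diagonal W) n)"
      show "?f n (?g w) = w"
      proof (rule W.diagonal_eqI[OF _ w])
        fix p q assume pq: "q - p = n"
        show "?f n (?g w) (p, q) = w (p, q)"
          using linear_map.closed[OF W.diagonal_proj[OF pq] w] pq
          by (simp add: diag_index_def bij_betw_inv_into_right[OF bij])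
      qed (rule linear_map.closed[OF lin_f g_closed[OF w]])
    qed
    show "?f n ` carrier (chain_module (diagonal V) n) \<subseteq> carrier (chain_module (diagonal W) n)"
      using linear_map.closed[OF lin_f] by blast
    show "?g ` carrier (chain_module (diagonal W) n) \<subseteq> carrier (chain_module (diagonal V) n)"
      using g_closed by blast
  qed
  ultimately show ?thesis
    using linear_map.linear[OF lin_f] V.chain_complex_diagonal W.chain_complex_diagonal
    unfolding chain_iso_def chain_hom_def by blast
qed

section \<open>Reduced chains of pointed sets\<close>

text \<open>
  Degrees are integers, and chains vanish in negative degrees. The condition is empty when the source
  degree is negative, so that induced maps are linear in all degrees without case distinctions.
\<close>

definition pointed_map :: "'a sspace \<Rightarrow> int \<Rightarrow> 'b sspace \<Rightarrow> int \<Rightarrow> ('a \<Rightarrow> 'b) \<Rightarrow> bool" where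
  "pointed_map Z m W n g \<longleftrightarrow> (0 \<le> m \<longrightarrow> 0 \<le> n \<and> g (base Z (nat m)) = base W (nat n) \<and>
    (\<forall>z\<in>simplices Z (nat m). g z \<in> simplices W (nat n)))"

text \<open>
  The common form of the simplicial boundary (with the face maps as \<open>F\<close>) and of the cosimplicial
  differential (with the coface maps as \<open>F\<close>).
\<close>

definition alternating_map ::
  "('r, 'x) ring_scheme \<Rightarrow> 'b sspace \<Rightarrow> int \<Rightarrow> nat \<Rightarrow> (nat \<Rightarrow> 'a \<Rightarrow> 'b) \<Rightarrow> ('a \<Rightarrow> 'r) \<Rightarrow> ('b \<Rightarrow> 'r)" where
  "alternating_map R W n k F c =
    (\<Oplus>\<^bsub>chains R W n\<^esub> i\<in>{..k}. alt_sign (chains R W n) (int i) (chains_map R W n (F i) c))"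

context cring
begin

lemma module_chains: "module R (chains R Z n)"
  unfolding chains_def by (rule module_free_module)

lemma linear_map_sign: "module R M \<Longrightarrow> linear_map R M M (alt_sign M n)"
  by (rule linear_map_alt_sign[where f = "\<lambda>x. x"], rule linear_mapI) auto

lemma simplex_class_eq:
  "simplex_class R Z n z = (if z = base Z (nat n) then \<zero>\<^bsub>chains R Z n\<^esub> else delta R z)"
  by (auto simp: simplex_class_def pt_class_def delta_def chains_def)

lemma simplex_class_base: "simplex_class R Z n (base Z (nat n)) = \<zero>\<^bsub>chains R Z n\<^esub>"
  by (simp add: simplex_class_eq)

lemma simplex_class_closed:
  assumes "0 \<le> n" "z \<in> simplices Z (nat n)"
  shows "simplex_class R Z n z \<in> carrier (chains R Z n)"
proof -
  interpret C: module R "chains R Z n" by (rule module_chains)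
  show ?thesis
    using assms by (simp add: simplex_class_eq) (simp add: chains_def delta_closed)
qed

lemma chains_neg: "n < 0 \<Longrightarrow> carrier (chains R Z n) = {\<zero>\<^bsub>chains R Z n\<^esub>}"
  by (auto simp: chains_def free_module_def fun_eq_iff)

text \<open>
  A map out of \<open>R[A]/R[*]\<close> is determined by the classes of the simplices other than the basepoint.
\<close>

lemma chains_eqI:
  assumes f: "linear_map R (chains R Z n) M f" and g: "linear_map R (chains R Z n) M g"
    and eq: "\<And>z. 0 \<le> n \<Longrightarrow> z \<in> simplices Z (nat n) \<Longrightarrow> z \<noteq> base Z (nat n) \<Longrightarrow>
      f (simplex_class R Z n z) = g (simplex_class R Z n z)"
    and c: "c \<in> carrier (chains R Z n)"
  shows "f c = g c"
  by (rule linear_map_free_eqI[OF f[unfolded chains_def] g[unfolded chains_def] _ c[unfolded chains_def]])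
    (use eq in \<open>auto simp: simplex_class_eq split: if_splits\<close>)

lemma linear_map_chains_map:
  assumes g: "pointed_map Z m W n g"
  shows "linear_map R (chains R Z m) (chains R W n) (chains_map R W n g)"
  unfolding chains_map_def
  by (subst chains_def, rule linear_map_lin_ext[OF module_chains])
    (use g in \<open>auto simp: pointed_map_def intro: simplex_class_closed\<close>)

lemma chains_map_class:
  assumes g: "pointed_map Z m W n g" and m: "0 \<le> m" and z: "z \<in> simplices Z (nat m)"
  shows "chains_map R W n g (simplex_class R Z m z) = simplex_class R W n (g z)"
proof (cases "z = base Z (nat m)")
  case True
  then have "g z = base W (nat n)" using g m by (simp add: pointed_map_def)
  then show ?thesis
    using True linear_map.zero[OF linear_map_chains_map[OF g]] by (simp add: simplex_class_base)
next
  case False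
  have "chains_map R W n g (delta R z) = simplex_class R W n (g z)"
    unfolding chains_map_def
    by (rule lin_ext_delta[OF module_chains, where A = "simplices Z (nat m)"])
      (use g m z in \<open>auto simp: pointed_map_def intro: simplex_class_closed\<close>)
  then show ?thesis using False by (simp add: simplex_class_eq)
qed

lemma chains_map_cong:
  assumes "pointed_map Z m W n g" "pointed_map Z m W n g'"
    and "\<And>z. 0 \<le> m \<Longrightarrow> z \<in> simplices Z (nat m) \<Longrightarrow> g z = g' z" "c \<in> carrier (chains R Z m)"
  shows "chains_map R W n g c = chains_map R W n g' c"
  by (rule chains_eqI[OF linear_map_chains_map linear_map_chains_map])
    (use assms in \<open>auto simp: chains_map_class\<close>)

lemma chains_map_comp:
  assumes "pointed_map Z l W m f" "pointed_map W m V n g" "c \<in> carrier (chains R Z l)"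
  shows "chains_map R V n g (chains_map R W m f c) = chains_map R V n (\<lambda>z. g (f z)) c"
proof (rule chains_eqI[OF linear_map_comp[OF linear_map_chains_map linear_map_chains_map] linear_map_chains_map])
  show gf: "pointed_map Z l V n (\<lambda>z. g (f z))" using assms by (auto simp: pointed_map_def)
  fix z assume z: "0 \<le> l" "z \<in> simplices Z (nat l)"
  then show "chains_map R V n g (chains_map R W m f (simplex_class R Z l z)) =
    chains_map R V n (\<lambda>z. g (f z)) (simplex_class R Z l z)"
    using assms by (simp add: chains_map_class[OF gf] chains_map_class[OF assms(1)])
      (simp add: pointed_map_def chains_map_class[OF assms(2)])
qed (use assms in auto)

lemma linear_map_alternating_map:
  assumes "\<And>i. i \<le> k \<Longrightarrow> pointed_map Z m W n (F i)"
  shows "linear_map R (chains R Z m) (chains R W n) (alternating_map R W n k F)"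
  unfolding alternating_map_def
  by (intro linear_map_finsum linear_map_alt_sign linear_map_chains_map module_chains) (use assms in auto)

lemma alternating_map_class:
  assumes F: "\<And>i. i \<le> k \<Longrightarrow> pointed_map Z m W n (F i)"
    and m: "0 \<le> m" and z: "z \<in> simplices Z (nat m)"
  shows "alternating_map R W n k F (simplex_class R Z m z) =
    (\<Oplus>\<^bsub>chains R W n\<^esub> i\<in>{..k}. alt_sign (chains R W n) (int i) (simplex_class R W n (F i z)))"
proof -
  interpret W: module R "chains R W n" by (rule module_chains)
  show ?thesis unfolding alternating_map_def
    by (rule W.M.finsum_cong')
      (use F m z in \<open>auto simp: chains_map_class[OF F] pointed_map_def
        intro!: alt_sign_closed module_chains simplex_class_closed\<close>)
qed

text \<open>
  For \<open>g = g'\<close> up to degree and \<open>F\<close>, \<open>F'\<close> the faces, this says that a map of spaces induces a chain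
  map. The form with two pairs of spaces also covers families \<open>F'\<close> that are not face maps.
\<close>

lemma alternating_map_natural:
  assumes F: "\<And>i. i \<le> k \<Longrightarrow> pointed_map Z m Z' m' (F i)"
    and F': "\<And>i. i \<le> k \<Longrightarrow> pointed_map W n W' n' (F' i)"
    and g: "pointed_map Z m W n g" and g': "pointed_map Z' m' W' n' g'"
    and comm: "\<And>i z. 0 \<le> m \<Longrightarrow> i \<le> k \<Longrightarrow> z \<in> simplices Z (nat m) \<Longrightarrow> g' (F i z) = F' i (g z)"
    and c: "c \<in> carrier (chains R Z m)"
  shows "chains_map R W' n' g' (alternating_map R Z' m' k F c) =
    alternating_map R W' n' k F' (chains_map R W n g c)"
proof -
  interpret g': linear_map R "chains R Z' m'" "chains R W' n'" "chains_map R W' n' g'"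
    by (rule linear_map_chains_map[OF g'])
  have cl: "chains_map R Z' m' (F i) c \<in> carrier (chains R Z' m')" if "i \<le> k" for i
    by (rule linear_map.closed[OF linear_map_chains_map[OF F[OF that]] c])
  have "chains_map R W' n' g' (alternating_map R Z' m' k F c) =
      (\<Oplus>\<^bsub>chains R W' n'\<^esub> i\<in>{..k}. chains_map R W' n' g'
        (alt_sign (chains R Z' m') (int i) (chains_map R Z' m' (F i) c)))"
    unfolding alternating_map_def
    by (rule g'.finsum) (auto intro!: alt_sign_closed module_chains cl)
  also have "\<dots> = alternating_map R W' n' k F' (chains_map R W n g c)"
    unfolding alternating_map_def
  proof (rule g'.cod.M.finsum_cong')
    fix i assume "i \<in> {..k}"
    then have i: "i \<le> k" by simp
    have pm: "pointed_map Z m W' n' (\<lambda>z. g' (F i z))" "pointed_map Z m W' n' (\<lambda>z. F' i (g z))"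
      using F[OF i] F'[OF i] g g' by (auto simp: pointed_map_def)
    have "chains_map R W' n' g' (chains_map R Z' m' (F i) c) = chains_map R W' n' (\<lambda>z. g' (F i z)) c"
      by (rule chains_map_comp[OF F[OF i] g' c])
    also have "\<dots> = chains_map R W' n' (\<lambda>z. F' i (g z)) c"
      by (rule chains_map_cong[OF pm _ c]) (rule comm[OF _ i])
    also have "\<dots> = chains_map R W' n' (F' i) (chains_map R W n g c)"
      by (rule chains_map_comp[OF g F'[OF i] c, symmetric])
    finally show "chains_map R W' n' g' (alt_sign (chains R Z' m') (int i) (chains_map R Z' m' (F i) c))
      = alt_sign (chains R W' n') (int i) (chains_map R W' n' (F' i) (chains_map R W n g c))"
      by (simp add: g'.alt_sign[OF cl[OF i]])
  qed (auto intro!: alt_sign_closed module_chains linear_map.closed[OF linear_map_chains_map[OF F']]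
        linear_map.closed[OF linear_map_chains_map[OF g]] c)
  finally show ?thesis .
qed

lemma alternating_map_twice_class:
  assumes F: "\<And>i. i \<le> k \<Longrightarrow> pointed_map Z m W n (F i)"
    and G: "\<And>i. i \<le> l \<Longrightarrow> pointed_map W n V q (G i)"
    and m: "0 \<le> m" and z: "z \<in> simplices Z (nat m)"
  shows "alternating_map R V q l G (alternating_map R W n k F (simplex_class R Z m z)) =
    (\<Oplus>\<^bsub>chains R V q\<^esub> j\<in>{..k}. \<Oplus>\<^bsub>chains R V q\<^esub> i\<in>{..l}.
      alt_sign (chains R V q) (int i + int j) (simplex_class R V q (G i (F j z))))"
proof -
  interpret G: linear_map R "chains R W n" "chains R V q" "alternating_map R V q l G"
    by (rule linear_map_alternating_map[OF G])
  have n: "0 \<le> n" and Fz: "F j z \<in> simplices W (nat n)" if "j \<le> k" for j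
    using F[OF that] m z by (auto simp: pointed_map_def)
  have q: "0 \<le> q" and GFz: "G i (F j z) \<in> simplices V (nat q)" if "j \<le> k" "i \<le> l" for i j
    using G[OF that(2)] Fz[OF that(1)] n[OF that(1)] by (auto simp: pointed_map_def)
  have cl: "simplex_class R V q (G i (F j z)) \<in> carrier (chains R V q)" if "j \<le> k" "i \<le> l" for i j
    by (rule simplex_class_closed[OF q[OF that] GFz[OF that]])
  have "alternating_map R V q l G (alternating_map R W n k F (simplex_class R Z m z)) =
    (\<Oplus>\<^bsub>chains R V q\<^esub> j\<in>{..k}. alternating_map R V q l G
      (alt_sign (chains R W n) (int j) (simplex_class R W n (F j z))))"
    by (subst alternating_map_class[of k Z m W n F z, OF F m z], assumption, rule G.finsum)
      (use n Fz in \<open>auto intro!: alt_sign_closed module_chains simplex_class_closed\<close>)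
  also have "\<dots> = (\<Oplus>\<^bsub>chains R V q\<^esub> j\<in>{..k}. \<Oplus>\<^bsub>chains R V q\<^esub> i\<in>{..l}.
      alt_sign (chains R V q) (int i + int j) (simplex_class R V q (G i (F j z))))"
  proof (rule G.cod.M.finsum_cong')
    show "(\<lambda>j. \<Oplus>\<^bsub>chains R V q\<^esub> i\<in>{..l}.
      alt_sign (chains R V q) (int i + int j) (simplex_class R V q (G i (F j z)))) \<in> {..k} \<rightarrow> carrier (chains R V q)"
      by (auto intro!: G.cod.M.finsum_closed alt_sign_closed module_chains cl)
    fix j assume "j \<in> {..k}"
    then have j: "j \<le> k" by simp
    have "alternating_map R V q l G (alt_sign (chains R W n) (int j) (simplex_class R W n (F j z)))
      = alt_sign (chains R V q) (int j) (alternating_map R V q l G (simplex_class R W n (F j z)))"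
      by (rule G.alt_sign[OF simplex_class_closed[OF n[OF j] Fz[OF j]]])
    also have "alternating_map R V q l G (simplex_class R W n (F j z)) =
      (\<Oplus>\<^bsub>chains R V q\<^esub> i\<in>{..l}. alt_sign (chains R V q) (int i) (simplex_class R V q (G i (F j z))))"
      by (rule alternating_map_class[OF G n[OF j] Fz[OF j]])
    also have "alt_sign (chains R V q) (int j) \<dots> = (\<Oplus>\<^bsub>chains R V q\<^esub> i\<in>{..l}.
      alt_sign (chains R V q) (int j) (alt_sign (chains R V q) (int i) (simplex_class R V q (G i (F j z)))))"
      by (rule linear_map.finsum[OF linear_map_sign[OF module_chains]])
        (auto intro!: alt_sign_closed module_chains cl[OF j])
    also have "\<dots> = (\<Oplus>\<^bsub>chains R V q\<^esub> i\<in>{..l}.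
      alt_sign (chains R V q) (int i + int j) (simplex_class R V q (G i (F j z))))"
      using cl[OF j]
      by (intro G.cod.M.finsum_cong') (auto simp: alt_sign_def)
    finally show "alternating_map R V q l G (alt_sign (chains R W n) (int j) (simplex_class R W n (F j z)))
      = (\<Oplus>\<^bsub>chains R V q\<^esub> i\<in>{..l}.
      alt_sign (chains R V q) (int i + int j) (simplex_class R V q (G i (F j z))))" .
  qed simp
  finally show ?thesis .
qed

text \<open>
  The entries \<open>x j i\<close> and \<open>x i (j - 1)\<close> agree and occur with opposite signs, as
  \<open>i + j\<close> and \<open>i + (j - 1)\<close> have different parities.
\<close>

lemma alternating_double_sum:
  assumes cl: "\<And>i j. i \<le> k \<Longrightarrow> j \<le> Suc k \<Longrightarrow> x j i \<in> carrier M" and M: "module R M"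
    and eq: "\<And>i j. i < j \<Longrightarrow> j \<le> Suc k \<Longrightarrow> x j i = x i (j - 1)"
  shows "(\<Oplus>\<^bsub>M\<^esub> j\<in>{..Suc k}. \<Oplus>\<^bsub>M\<^esub> i\<in>{..k}. alt_sign M (int i + int j) (x j i)) = \<zero>\<^bsub>M\<^esub>"
proof -
  interpret M: module R M by (rule M)
  \<comment> \<open>Outside the range of summation the entries are replaced by zero,
    since \<open>double_sum_cancel\<close> asks for a total matrix.\<close>
  let ?h = "\<lambda>j i. if i \<le> k \<and> j \<le> Suc k then alt_sign M (int i + int j) (x j i) else \<zero>\<^bsub>M\<^esub>"
  have h: "?h j i \<in> carrier M" for i j
    using cl by (auto intro: alt_sign_closed M)
  have "(\<Oplus>\<^bsub>M\<^esub> j\<in>{..Suc k}. \<Oplus>\<^bsub>M\<^esub> i\<in>{..k}. alt_sign M (int i + int j) (x j i))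
    = (\<Oplus>\<^bsub>M\<^esub> j\<in>{..Suc k}. \<Oplus>\<^bsub>M\<^esub> i\<in>{..k}. ?h j i)"
    using h by (intro M.M.finsum_cong' M.M.finsum_closed) (auto intro!: M.M.finsum_closed alt_sign_closed M cl)
  also have "\<dots> = \<zero>\<^bsub>M\<^esub>"
  proof (rule M.M.double_sum_cancel[OF h])
    fix i j assume ij: "i < j" "j \<le> Suc k"
    have "int i + int j = int (j - 1) + int i + 1" using ij by simp
    then show "?h j i \<oplus>\<^bsub>M\<^esub> ?h i (j - 1) = \<zero>\<^bsub>M\<^esub>"
      using ij eq[OF ij] cl[of i j]
      by (cases "even (int i + int j)") (auto simp: alt_sign_def M.M.l_neg M.M.r_neg)
  qed
  finally show ?thesis .
qed

text \<open>
  The simplicial case \<open>d\<^sub>i d\<^sub>j = d\<^sub>j\<^sub>-\<^sub>1 d\<^sub>i\<close>, where the first operator applied has one more term than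
  the second.
\<close>

lemma alternating_map_square_face:
  assumes F: "\<And>i. i \<le> Suc k \<Longrightarrow> pointed_map Z m W n (F i)"
    and G: "\<And>i. i \<le> k \<Longrightarrow> pointed_map W n V q (G i)"
    and eq: "\<And>i j z. 0 \<le> m \<Longrightarrow> i < j \<Longrightarrow> j \<le> Suc k \<Longrightarrow> z \<in> simplices Z (nat m) \<Longrightarrow>
      G i (F j z) = G (j - 1) (F i z)"
    and c: "c \<in> carrier (chains R Z m)"
  shows "alternating_map R V q k G (alternating_map R W n (Suc k) F c) = \<zero>\<^bsub>chains R V q\<^esub>"
proof (rule chains_eqI[OF _ _ _ c])
  show "linear_map R (chains R Z m) (chains R V q)
      (\<lambda>c. alternating_map R V q k G (alternating_map R W n (Suc k) F c))"
    by (rule linear_map_comp[OF linear_map_alternating_map[OF F] linear_map_alternating_map[OF G]])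
  fix z assume z: "0 \<le> m" "z \<in> simplices Z (nat m)"
  show "alternating_map R V q k G (alternating_map R W n (Suc k) F (simplex_class R Z m z)) = \<zero>\<^bsub>chains R V q\<^esub>"
  proof (subst alternating_map_twice_class[of "Suc k" Z m W n F k V q G, OF F G z], assumption, assumption,
      rule alternating_double_sum)
    show "simplex_class R V q (G i (F j z)) \<in> carrier (chains R V q)" if "i \<le> k" "j \<le> Suc k" for i j
      using F[OF that(2)] G[OF that(1)] z by (auto simp: pointed_map_def intro: simplex_class_closed)
  qed (use eq z in \<open>auto intro: module_chains\<close>)
qed (intro linear_map_zero module_chains)

text \<open>
  The cosimplicial case \<open>\<delta>\<^sup>j \<delta>\<^sup>i = \<delta>\<^sup>i \<delta>\<^sup>j\<^sup>-\<^sup>1\<close>. Here the second operator applied has one more term,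
  so that the double sum has to be transposed to reach the same matrix.
\<close>

lemma alternating_map_square_coface:
  assumes F: "\<And>i. i \<le> k \<Longrightarrow> pointed_map Z m W n (F i)"
    and G: "\<And>i. i \<le> Suc k \<Longrightarrow> pointed_map W n V q (G i)"
    and eq: "\<And>i j z. 0 \<le> m \<Longrightarrow> i < j \<Longrightarrow> j \<le> Suc k \<Longrightarrow> z \<in> simplices Z (nat m) \<Longrightarrow>
      G j (F i z) = G i (F (j - 1) z)"
    and c: "c \<in> carrier (chains R Z m)"
  shows "alternating_map R V q (Suc k) G (alternating_map R W n k F c) = \<zero>\<^bsub>chains R V q\<^esub>"
proof (rule chains_eqI[OF _ _ _ c])
  interpret V: module R "chains R V q" by (rule module_chains)
  show "linear_map R (chains R Z m) (chains R V q)
      (\<lambda>c. alternating_map R V q (Suc k) G (alternating_map R W n k F c))"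
    by (rule linear_map_comp[OF linear_map_alternating_map[OF F] linear_map_alternating_map[OF G]])
  fix z assume z: "0 \<le> m" "z \<in> simplices Z (nat m)"
  have cl: "simplex_class R V q (G j (F i z)) \<in> carrier (chains R V q)" if "i \<le> k" "j \<le> Suc k" for i j
    using F[OF that(1)] G[OF that(2)] z by (auto simp: pointed_map_def intro: simplex_class_closed)
  have "alternating_map R V q (Suc k) G (alternating_map R W n k F (simplex_class R Z m z)) =
    (\<Oplus>\<^bsub>chains R V q\<^esub> i\<in>{..k}. \<Oplus>\<^bsub>chains R V q\<^esub> j\<in>{..Suc k}.
      alt_sign (chains R V q) (int i + int j) (simplex_class R V q (G j (F i z))))"
    by (simp only: alternating_map_twice_class[of k Z m W n F "Suc k" V q G, OF F G z] add.commute)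
  also have "\<dots> = (\<Oplus>\<^bsub>chains R V q\<^esub> j\<in>{..Suc k}. \<Oplus>\<^bsub>chains R V q\<^esub> i\<in>{..k}.
      alt_sign (chains R V q) (int i + int j) (simplex_class R V q (G j (F i z))))"
    by (rule V.M.finsum_swap) (auto intro!: alt_sign_closed module_chains cl)
  also have "\<dots> = \<zero>\<^bsub>chains R V q\<^esub>"
    by (rule alternating_double_sum) (use eq z cl in \<open>auto intro: module_chains\<close>)
  finally show "alternating_map R V q (Suc k) G (alternating_map R W n k F (simplex_class R Z m z)) = \<zero>\<^bsub>chains R V q\<^esub>" .
qed (intro linear_map_zero module_chains)

lemma alternating_map_commute:
  assumes F: "\<And>i. i \<le> k \<Longrightarrow> pointed_map Z m W n (F i)"
    and G: "\<And>i. i \<le> l \<Longrightarrow> pointed_map W n V q (G i)"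
    and G': "\<And>i. i \<le> l \<Longrightarrow> pointed_map Z m W' n' (G' i)"
    and F': "\<And>i. i \<le> k \<Longrightarrow> pointed_map W' n' V q (F' i)"
    and eq: "\<And>i j z. 0 \<le> m \<Longrightarrow> i \<le> l \<Longrightarrow> j \<le> k \<Longrightarrow> z \<in> simplices Z (nat m) \<Longrightarrow>
      G i (F j z) = F' j (G' i z)"
    and c: "c \<in> carrier (chains R Z m)"
  shows "alternating_map R V q l G (alternating_map R W n k F c)
    = alternating_map R V q k F' (alternating_map R W' n' l G' c)"
proof (rule chains_eqI[OF _ _ _ c])
  interpret V: module R "chains R V q" by (rule module_chains)
  fix z assume z: "0 \<le> m" "z \<in> simplices Z (nat m)"
  have cl: "simplex_class R V q (F' j (G' i z)) \<in> carrier (chains R V q)" if "i \<le> l" "j \<le> k" for i j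
    using F'[OF that(2)] G'[OF that(1)] z by (auto simp: pointed_map_def intro: simplex_class_closed)
  have "alternating_map R V q l G (alternating_map R W n k F (simplex_class R Z m z)) =
    (\<Oplus>\<^bsub>chains R V q\<^esub> j\<in>{..k}. \<Oplus>\<^bsub>chains R V q\<^esub> i\<in>{..l}.
      alt_sign (chains R V q) (int i + int j) (simplex_class R V q (G i (F j z))))"
    by (rule alternating_map_twice_class[OF F G z])
  also have "\<dots> = (\<Oplus>\<^bsub>chains R V q\<^esub> j\<in>{..k}. \<Oplus>\<^bsub>chains R V q\<^esub> i\<in>{..l}.
      alt_sign (chains R V q) (int j + int i) (simplex_class R V q (F' j (G' i z))))"
    using cl by (intro V.M.finsum_cong' V.M.finsum_closed)
      (auto simp: eq[OF z(1) _ _ z(2)] add.commute intro!: alt_sign_closed module_chains V.M.finsum_closed)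
  also have "\<dots> = (\<Oplus>\<^bsub>chains R V q\<^esub> i\<in>{..l}. \<Oplus>\<^bsub>chains R V q\<^esub> j\<in>{..k}.
      alt_sign (chains R V q) (int j + int i) (simplex_class R V q (F' j (G' i z))))"
    by (rule V.M.finsum_swap) (auto intro!: alt_sign_closed module_chains cl)
  also have "\<dots> = alternating_map R V q k F' (alternating_map R W' n' l G' (simplex_class R Z m z))"
    by (rule alternating_map_twice_class[OF G' F' z, symmetric])
  finally show "alternating_map R V q l G (alternating_map R W n k F (simplex_class R Z m z))
    = alternating_map R V q k F' (alternating_map R W' n' l G' (simplex_class R Z m z))" .
next
  show "linear_map R (chains R Z m) (chains R V q) (\<lambda>c. alternating_map R V q l G (alternating_map R W n k F c))"
    by (rule linear_map_comp[OF linear_map_alternating_map[OF F] linear_map_alternating_map[OF G]])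
  show "linear_map R (chains R Z m) (chains R V q) (\<lambda>c. alternating_map R V q k F' (alternating_map R W' n' l G' c))"
    by (rule linear_map_comp[OF linear_map_alternating_map[OF G'] linear_map_alternating_map[OF F']])
qed

end

section \<open>Boundary operators\<close>

text \<open>
  The part of the simplicial structure that enters the boundary operator. It passes to smash powers
  and function spaces, which is how their chains are seen to form complexes.
\<close>

locale pointed_faces =
  fixes Z :: "'a sspace"
  assumes base_closed: "base Z n \<in> simplices Z n"
    and face_closed: "\<lbrakk>i \<le> Suc n; z \<in> simplices Z (Suc n)\<rbrakk> \<Longrightarrow> face Z (Suc n) i z \<in> simplices Z n"
    and face_base: "i \<le> Suc n \<Longrightarrow> face Z (Suc n) i (base Z (Suc n)) = base Z n"
    and face_face: "\<lbrakk>i < j; j \<le> Suc (Suc n); z \<in> simplices Z (Suc (Suc n))\<rbrakk> \<Longrightarrow>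
      face Z (Suc n) i (face Z (Suc (Suc n)) j z) =
      face Z (Suc n) (j - 1) (face Z (Suc (Suc n)) i z)"
begin

lemma pointed_map_face:
  assumes "0 < n" "i \<le> nat n"
  shows "pointed_map Z n Z (n - 1) (face Z (nat n) i)"
proof -
  obtain m where "n = int (Suc m)" using assms(1) that[of "nat n - 1"] by simp
  then show ?thesis using assms(2) face_base face_closed by (auto simp: pointed_map_def nat_add_distrib)
qed

end

lemma pointed_simplicial_set_faces: "pointed_simplicial_set Z \<Longrightarrow> pointed_faces Z"
  by (simp add: pointed_simplicial_set_def pointed_faces_def)

context cring
begin

lemma boundary_pos:
  "0 < n \<Longrightarrow> boundary R Z n = alternating_map R Z (n - 1) (nat n) (face Z (nat n))"
  by (auto simp: boundary_def alternating_map_def atMost_atLeast0)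

lemma boundary_nonpos: "n \<le> 0 \<Longrightarrow> boundary R Z n c = \<zero>\<^bsub>chains R Z (n - 1)\<^esub>"
  by (simp add: boundary_def)

lemma linear_map_boundary:
  assumes "pointed_faces Z"
  shows "linear_map R (chains R Z n) (chains R Z (n - 1)) (boundary R Z n)"
proof (cases "0 < n")
  case True
  then show ?thesis unfolding boundary_pos[OF True]
    by (intro linear_map_alternating_map pointed_faces.pointed_map_face assms)
next
  case False
  show ?thesis
    by (rule linear_map_cong[OF linear_map_zero[OF module_chains module_chains]])
      (use False in \<open>simp add: boundary_nonpos\<close>)
qed

lemma boundary_boundary:
  assumes Z: "pointed_faces Z" and c: "c \<in> carrier (chains R Z n)"
  shows "boundary R Z (n - 1) (boundary R Z n c) = \<zero>\<^bsub>chains R Z (n - 2)\<^esub>"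
proof (cases "1 < n")
  case True
  then obtain m where m: "n = int (Suc (Suc m))" using that[of "nat n - 2"] by simp
  have "alternating_map R Z (n - 2) (Suc m) (face Z (Suc m))
      (alternating_map R Z (n - 1) (Suc (Suc m)) (face Z (Suc (Suc m))) c) = \<zero>\<^bsub>chains R Z (n - 2)\<^esub>"
  proof (rule alternating_map_square_face[OF _ _ _ c])
    show "pointed_map Z n Z (n - 1) (face Z (Suc (Suc m)) i)" if "i \<le> Suc (Suc m)" for i
      using pointed_faces.pointed_map_face[OF Z, of n i] that by (simp add: m nat_add_distrib)
    show "pointed_map Z (n - 1) Z (n - 2) (face Z (Suc m) i)" if "i \<le> Suc m" for i
      using pointed_faces.pointed_map_face[OF Z, of "n - 1" i] that by (simp add: m nat_add_distrib)
    show "face Z (Suc m) i (face Z (Suc (Suc m)) j z) = face Z (Suc m) (j - 1) (face Z (Suc (Suc m)) i z)"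
      if "i < j" "j \<le> Suc (Suc m)" "z \<in> simplices Z (nat n)" for i j z
      using pointed_faces.face_face[OF Z that(1,2)] that(3) by (simp add: m nat_add_distrib)
  qed
  moreover have "nat n = Suc (Suc m)" "nat (n - 1) = Suc m" "n - 1 - 1 = n - 2" using m by auto
  ultimately show ?thesis using True by (simp add: boundary_pos)
next
  case False
  then show ?thesis using boundary_nonpos[of "n - 1"] by simp
qed

text \<open>
  A family of maps commuting with faces induces a chain map; the family is indexed by the dimension.
\<close>

lemma boundary_natural:
  assumes Z: "pointed_faces Z" and W: "pointed_faces W"
    and g: "\<And>n. pointed_map Z (int n) W (int n) (g n)"
    and comm: "\<And>n i z. i \<le> Suc n \<Longrightarrow> z \<in> simplices Z (Suc n) \<Longrightarrow>
      g n (face Z (Suc n) i z) = face W (Suc n) i (g (Suc n) z)"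
    and c: "c \<in> carrier (chains R Z n)"
  shows "chains_map R W (n - 1) (g (nat (n - 1))) (boundary R Z n c)
    = boundary R W n (chains_map R W n (g (nat n)) c)"
proof -
  have g': "pointed_map Z m W m (g (nat m))" for m
    using g[of "nat m"] by (auto simp: pointed_map_def)
  show ?thesis
  proof (cases "0 < n")
    case True
    then have "nat n = Suc (nat n - 1)" "nat (n - 1) = nat n - 1" by linarith+
    then obtain m where m: "nat n = Suc m" "nat (n - 1) = m" by blast
    show ?thesis unfolding boundary_pos[OF True]
      by (rule alternating_map_natural[OF _ _ g' g' _ c])
        (use True m comm pointed_faces.pointed_map_face[OF Z True] pointed_faces.pointed_map_face[OF W True] in auto)
  next
    case False
    then show ?thesis
      using linear_map.zero[OF linear_map_chains_map[OF g'[of "n - 1"]]] by (simp add: boundary_nonpos)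
  qed
qed

end

section \<open>Smash powers and function spaces\<close>

text \<open>
  A pointed map applied entrywise respects the collapse to the basepoint, so that intermediate
  projections can be dropped. The identities between maps of smash powers thereby reduce to identities
  between their entries.
\<close>

lemma smash_proj_comp:
  assumes "g (base Z m) = base W n"
  shows "smash_proj W s n (\<lambda>k\<in>{1..s}. g (smash_proj Z s m y k)) = smash_proj W s n (\<lambda>k\<in>{1..s}. g (y k))"
proof (cases "\<exists>k\<in>{1..s}. y k = base Z m")
  case True
  then have "smash_proj Z s m y k = base Z m" if "k \<in> {1..s}" for k
    using that by (simp add: smash_proj_def)
  then show ?thesis using True assms by (auto simp: smash_proj_def)
next
  case False
  then show ?thesis by (auto simp: smash_proj_def)
qed

lemma smash_proj_restrict_comp:
  assumes "g (base Z m) = base W n"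
  shows "smash_proj W s n (\<lambda>k\<in>{1..s}. g (smash_proj Z s m (\<lambda>k\<in>{1..s}. f (x k)) k))
    = smash_proj W s n (\<lambda>k\<in>{1..s}. g (f (x k)))"
  by (rule trans[OF smash_proj_comp[where g = g and Z = Z and m = m, OF assms]], rule arg_cong[where f = "smash_proj W s n"])
    (auto intro: restrict_ext)

lemma smash_power_sel [simp]:
  "simplices (smash_power Z s) n = smash_proj Z s n ` ({1..s} \<rightarrow>\<^sub>E simplices Z n)"
  "base (smash_power Z s) n = (\<lambda>k\<in>{1..s}. base Z n)"
  "face (smash_power Z s) n i x = smash_proj Z s (n - 1) (\<lambda>k\<in>{1..s}. face Z n i (x k))"
  by (simp_all add: smash_power_def)

lemma smash_proj_base: "smash_proj Z s n (\<lambda>k\<in>{1..s}. base Z n) = (\<lambda>k\<in>{1..s}. base Z n)"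
  by (auto simp: smash_proj_def)

lemma smash_simplex_PiE:
  assumes "base Z n \<in> simplices Z n" "x \<in> simplices (smash_power Z s) n"
  shows "x \<in> {1..s} \<rightarrow>\<^sub>E simplices Z n"
  using assms by (auto simp: smash_proj_def split: if_splits)

text \<open>
  For \<open>s = 0\<close> the smash power has a single simplex, which is the basepoint, although the empty tuple
  satisfies the right-hand side.
\<close>

lemma smash_nonbase_iff:
  assumes "1 \<le> s" "base Z n \<in> simplices Z n"
  shows "x \<in> simplices (smash_power Z s) n \<and> x \<noteq> base (smash_power Z s) n \<longleftrightarrow>
    x \<in> {1..s} \<rightarrow>\<^sub>E simplices Z n - {base Z n}"
proof
  assume x: "x \<in> {1..s} \<rightarrow>\<^sub>E simplices Z n - {base Z n}"
  then have "smash_proj Z s n x = x" "x \<in> {1..s} \<rightarrow>\<^sub>E simplices Z n"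
    by (auto simp: smash_proj_def PiE_iff)
  moreover have "x 1 \<noteq> base Z n" using x assms(1) by (auto simp: PiE_iff)
  ultimately show "x \<in> simplices (smash_power Z s) n \<and> x \<noteq> base (smash_power Z s) n"
    using assms(1) by (auto intro: rev_image_eqI)
qed (auto simp: smash_proj_def PiE_iff split: if_splits)

lemma pointed_map_smash:
  assumes "f (base Z n) = base W m" "\<And>z. z \<in> simplices Z n \<Longrightarrow> f z \<in> simplices W m"
    and "base Z n \<in> simplices Z n" "x \<in> simplices (smash_power Z s) n"
  shows "smash_proj W s m (\<lambda>k\<in>{1..s}. f (x k)) \<in> simplices (smash_power W s) m"
  using smash_simplex_PiE[OF assms(3,4)] assms(2) by (auto simp: PiE_iff intro!: imageI)

lemma smash_restrict_base:
  assumes "f (base Z n) = base W m"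
  shows "smash_proj W s m (\<lambda>k\<in>{1..s}. f ((\<lambda>k\<in>{1..s}. base Z n) k)) = (\<lambda>k\<in>{1..s}. base W m)"
  using assms by (auto simp: smash_proj_def)

lemma pointed_faces_smash_power:
  assumes "pointed_faces Z"
  shows "pointed_faces (smash_power Z s)"
proof -
  interpret Z: pointed_faces Z by fact
  show ?thesis
  proof
    show "base (smash_power Z s) n \<in> simplices (smash_power Z s) n" for n
      unfolding smash_power_sel using smash_proj_base[of Z s n] Z.base_closed[of n]
      by (intro image_eqI[where x = "\<lambda>k\<in>{1..s}. base Z n"]) auto
    show "face (smash_power Z s) (Suc n) i z \<in> simplices (smash_power Z s) n"
      if "i \<le> Suc n" "z \<in> simplices (smash_power Z s) (Suc n)" for i n z
      unfolding smash_power_sel(3) diff_Suc_1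
      by (rule pointed_map_smash[OF _ _ Z.base_closed that(2)])
        (use that Z.face_closed Z.face_base in auto)
    show "face (smash_power Z s) (Suc n) i (base (smash_power Z s) (Suc n)) = base (smash_power Z s) n"
      if "i \<le> Suc n" for i n
      unfolding smash_power_sel(2,3) diff_Suc_1
      by (rule smash_restrict_base) (rule Z.face_base[OF that])
    fix i j n z assume ij: "i < j" "j \<le> Suc (Suc n)" and "z \<in> simplices (smash_power Z s) (Suc (Suc n))"
    then have "z \<in> {1..s} \<rightarrow>\<^sub>E simplices Z (Suc (Suc n))"
      using smash_simplex_PiE[OF Z.base_closed] by blast
    then have "(\<lambda>k\<in>{1..s}. face Z (Suc n) i (face Z (Suc (Suc n)) j (z k)))
      = (\<lambda>k\<in>{1..s}. face Z (Suc n) (j - 1) (face Z (Suc (Suc n)) i (z k)))"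
      by (intro restrict_ext Z.face_face[OF ij]) auto
    then show "face (smash_power Z s) (Suc n) i (face (smash_power Z s) (Suc (Suc n)) j z) =
      face (smash_power Z s) (Suc n) (j - 1) (face (smash_power Z s) (Suc (Suc n)) i z)"
      using ij unfolding smash_power_sel(3) diff_Suc_1
      by (subst (1 2) smash_proj_restrict_comp) (auto simp: Z.face_base)
  qed
qed

lemma fun_space_sel [simp]:
  "simplices (fun_space S a Y) q = {v \<in> S \<rightarrow>\<^sub>E simplices Y q. v a = base Y q}"
  "base (fun_space S a Y) q = (\<lambda>x\<in>S. base Y q)"
  "face (fun_space S a Y) q i v = (\<lambda>x\<in>S. face Y q i (v x))"
  by (simp_all add: fun_space_def)

lemma pointed_faces_fun_space:
  assumes "pointed_faces Y" "a \<in> S"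
  shows "pointed_faces (fun_space S a Y)"
proof -
  interpret Y: pointed_faces Y by fact
  show ?thesis
    by standard
      (use assms(2) in \<open>auto simp: Y.base_closed Y.face_base PiE_iff intro!: Y.face_closed Y.face_face restrict_ext simp del: One_nat_def\<close>)
qed

text \<open>
  Surjectivity of \<open>h\<close> is essential: a basepoint entry at an index missed by \<open>h\<close> would be lost in
  \<open>sharp t h y\<close>.
\<close>

lemma sharp_smash_proj:
  assumes "h \<in> surjections t s"
  shows "sharp t h (smash_proj Z s n y) = smash_proj Z t n (sharp t h y)"
proof -
  have h: "h ` {1..t} = {1..s}" using assms by (simp add: surjections_def)
  then have hk: "h k \<in> {1..s}" if "k \<in> {1..t}" for k using that by blast
  have "(\<exists>k\<in>{1..t}. sharp t h y k = base Z n) \<longleftrightarrow> (\<exists>k\<in>h ` {1..t}. y k = base Z n)"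
    by (auto simp: sharp_def)
  then have "(\<exists>k\<in>{1..t}. sharp t h y k = base Z n) \<longleftrightarrow> (\<exists>k\<in>{1..s}. y k = base Z n)"
    unfolding h .
  then show ?thesis using hk by (auto simp: smash_proj_def sharp_def intro!: restrict_ext)
qed

lemma pointed_map_sharp:
  assumes "h \<in> surjections t s"
  shows "pointed_map (smash_power Z s) n (smash_power Z t) n (sharp t h)"
proof -
  have hk: "h k \<in> {1..s}" if "k \<in> {1..t}" for k using assms that by (auto simp: surjections_def)
  have "sharp t h y \<in> {1..t} \<rightarrow>\<^sub>E A" if "y \<in> {1..s} \<rightarrow>\<^sub>E A" for y :: "nat \<Rightarrow> 'a" and A
    using that hk by (auto simp: sharp_def)
  moreover have "sharp t h (\<lambda>k\<in>{1..s}. b) = (\<lambda>k\<in>{1..t}. b)" for b :: 'a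
    using hk by (auto simp: sharp_def intro!: restrict_ext)
  ultimately show ?thesis
    by (auto simp: pointed_map_def sharp_smash_proj[OF assms] simp del: PiE_iff intro!: imageI)
qed

lemma sharp_smash_map:
  assumes "h \<in> surjections t s"
  shows "sharp t h (smash_proj W s n (\<lambda>k\<in>{1..s}. f (x k))) = smash_proj W t n (\<lambda>k\<in>{1..t}. f (sharp t h x k))"
proof -
  have hk: "h k \<in> {1..s}" if "k \<in> {1..t}" for k using assms that by (auto simp: surjections_def)
  have "sharp t h (\<lambda>k\<in>{1..s}. f (x k)) = (\<lambda>k\<in>{1..t}. f (sharp t h x k))"
    using hk by (auto simp: sharp_def intro!: restrict_ext)
  then show ?thesis by (simp only: sharp_smash_proj[OF assms])
qed

section \<open>Modules of natural transformations\<close>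

text \<open>
  Naturality squares compose with sums and multiples because the functors act by linear maps; this is
  what makes the natural transformations a module.
\<close>

locale linear_functor = cring R for R :: "('r, 'x) ring_scheme" (structure) +
  fixes F :: "('r, 'm) omega_functor"
  assumes module_obj: "1 \<le> s \<Longrightarrow> module R (fun_obj F s)"
    and linear_mor: "\<lbrakk>1 \<le> s; 1 \<le> t; h \<in> surjections t s\<rbrakk> \<Longrightarrow>
      linear_map R (fun_obj F s) (fun_obj F t) (fun_mor F t s h)"

locale functor_pair = F: linear_functor R F + G: linear_functor R G
  for R :: "('r, 'x) ring_scheme" (structure)
    and F :: "('r, 'm) omega_functor" and G :: "('r, 'n) omega_functor"
begin

lemma nat_transI:
  assumes lin: "\<And>s. 1 \<le> s \<Longrightarrow> linear_map R (fun_obj F s) (fun_obj G s) (f s)"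
    and nat: "\<And>s t h c. \<lbrakk>1 \<le> s; 1 \<le> t; h \<in> surjections t s; c \<in> carrier (fun_obj F s)\<rbrakk> \<Longrightarrow>
      f t (fun_mor F t s h c) = fun_mor G t s h (f s c)"
  shows "(\<lambda>s\<in>{1..}. \<lambda>c\<in>carrier (fun_obj F s). f s c) \<in> nat_trans R F G"
proof -
  have "(\<lambda>c\<in>carrier (fun_obj F s). f s c) \<in> linear_maps R (fun_obj F s) (fun_obj G s)" if "1 \<le> s" for s
    by (rule linear_map.linear[OF linear_map_cong[OF lin[OF that]]]) simp
  moreover have "fun_mor F t s h c \<in> carrier (fun_obj F t)"
    if "1 \<le> s" "1 \<le> t" "h \<in> surjections t s" "c \<in> carrier (fun_obj F s)" for s t h c
    by (rule linear_map.closed[OF F.linear_mor[OF that(1-3)] that(4)])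
  ultimately show ?thesis using nat by (auto simp: nat_trans_def)
qed

lemma nat_trans_linear:
  "\<phi> \<in> nat_trans R F G \<Longrightarrow> 1 \<le> s \<Longrightarrow> linear_map R (fun_obj F s) (fun_obj G s) (\<phi> s)"
  by (intro linear_mapI_maps F.module_obj G.module_obj) (auto simp: nat_trans_def PiE_iff)

lemma nat_trans_natural:
  "\<lbrakk>\<phi> \<in> nat_trans R F G; 1 \<le> s; 1 \<le> t; h \<in> surjections t s; c \<in> carrier (fun_obj F s)\<rbrakk> \<Longrightarrow>
    \<phi> t (fun_mor F t s h c) = fun_mor G t s h (\<phi> s c)"
  by (auto simp: nat_trans_def)

lemma nat_trans_closed:
  "\<phi> \<in> nat_trans R F G \<Longrightarrow> 1 \<le> s \<Longrightarrow> c \<in> carrier (fun_obj F s) \<Longrightarrow> \<phi> s c \<in> carrier (fun_obj G s)"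
  by (rule linear_map.closed[OF nat_trans_linear])

text \<open>
  Natural transformations are stored as extensional functions, in the index as well as in the
  argument of each component, so that agreement on the relevant values gives equality.
\<close>

lemma nat_trans_eqI:
  assumes \<phi>: "\<phi> \<in> nat_trans R F G" and \<psi>: "\<psi> \<in> nat_trans R F G"
    and eq: "\<And>s c. 1 \<le> s \<Longrightarrow> c \<in> carrier (fun_obj F s) \<Longrightarrow> \<phi> s c = \<psi> s c"
  shows "\<phi> = \<psi>"
proof (rule extensionalityI[of _ "{1..}"])
  show "\<phi> \<in> extensional {1..}" "\<psi> \<in> extensional {1..}"
    using \<phi> \<psi> by (auto simp: nat_trans_def PiE_iff)
  fix s :: nat assume "s \<in> {1..}"
  then show "\<phi> s = \<psi> s"
    using \<phi> \<psi> eq by (intro extensionalityI[of _ "carrier (fun_obj F s)"]) (auto simp: nat_trans_def PiE_iff)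
qed

lemma Hom_module_sel:
  "carrier (Hom_module R F G) = nat_trans R F G"
  "1 \<le> s \<Longrightarrow> c \<in> carrier (fun_obj F s) \<Longrightarrow> zero (Hom_module R F G) s c = \<zero>\<^bsub>fun_obj G s\<^esub>"
  "1 \<le> s \<Longrightarrow> c \<in> carrier (fun_obj F s) \<Longrightarrow>
    (\<phi> \<oplus>\<^bsub>Hom_module R F G\<^esub> \<psi>) s c = \<phi> s c \<oplus>\<^bsub>fun_obj G s\<^esub> \<psi> s c"
  "1 \<le> s \<Longrightarrow> c \<in> carrier (fun_obj F s) \<Longrightarrow>
    (r \<odot>\<^bsub>Hom_module R F G\<^esub> \<phi>) s c = r \<odot>\<^bsub>fun_obj G s\<^esub> \<phi> s c"
  by (simp_all add: Hom_module_def)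

lemma Hom_zero_closed: "\<zero>\<^bsub>Hom_module R F G\<^esub> \<in> nat_trans R F G"
  unfolding Hom_module_def ring_record_simps
  by (rule nat_transI)
    (simp_all add: linear_map_zero F.module_obj G.module_obj linear_map.zero[OF G.linear_mor])

lemma Hom_add_closed:
  assumes "\<phi> \<in> nat_trans R F G" "\<psi> \<in> nat_trans R F G"
  shows "\<phi> \<oplus>\<^bsub>Hom_module R F G\<^esub> \<psi> \<in> nat_trans R F G"
  unfolding Hom_module_def ring_record_simps
proof (rule nat_transI)
  fix s :: nat assume s: "1 \<le> s"
  interpret f: linear_map R "fun_obj F s" "fun_obj G s" "\<phi> s" by (rule nat_trans_linear[OF assms(1) s])
  interpret g: linear_map R "fun_obj F s" "fun_obj G s" "\<psi> s" by (rule nat_trans_linear[OF assms(2) s])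
  show "linear_map R (fun_obj F s) (fun_obj G s) (\<lambda>c. \<phi> s c \<oplus>\<^bsub>fun_obj G s\<^esub> \<psi> s c)"
    by (rule linear_mapI)
      (auto simp: f.add g.add f.smult g.smult f.cod.M.a_ac f.cod.smult_r_distr F.module_obj[OF s] G.module_obj[OF s])
qed (simp add: nat_trans_natural[OF assms(1)] nat_trans_natural[OF assms(2)]
    linear_map.add[OF G.linear_mor] nat_trans_closed[OF assms(1)] nat_trans_closed[OF assms(2)])

lemma Hom_smult_closed:
  assumes "r \<in> carrier R" "\<phi> \<in> nat_trans R F G"
  shows "r \<odot>\<^bsub>Hom_module R F G\<^esub> \<phi> \<in> nat_trans R F G"
  unfolding Hom_module_def module.simps ring_record_simps
proof (rule nat_transI)
  fix s :: nat assume s: "1 \<le> s"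
  interpret f: linear_map R "fun_obj F s" "fun_obj G s" "\<phi> s" by (rule nat_trans_linear[OF assms(2) s])
  show "linear_map R (fun_obj F s) (fun_obj G s) (\<lambda>c. r \<odot>\<^bsub>fun_obj G s\<^esub> \<phi> s c)"
    by (rule linear_mapI)
      (auto simp: f.add f.smult f.cod.smult_r_distr F.module_obj[OF s] G.module_obj[OF s] assms(1)
        f.cod.smult_assoc1[symmetric] F.m_comm)
qed (simp add: nat_trans_natural[OF assms(2)] linear_map.smult[OF G.linear_mor] assms(1) nat_trans_closed[OF assms(2)])

lemma Hom_minus_closed:
  assumes "\<phi> \<in> nat_trans R F G"
  shows "(\<lambda>s\<in>{1..}. \<lambda>c\<in>carrier (fun_obj F s). \<ominus>\<^bsub>fun_obj G s\<^esub> \<phi> s c) \<in> nat_trans R F G"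
proof (rule nat_transI)
  fix s :: nat assume s: "1 \<le> s"
  show "linear_map R (fun_obj F s) (fun_obj G s) (\<lambda>c. \<ominus>\<^bsub>fun_obj G s\<^esub> \<phi> s c)"
    using linear_map_alt_sign[OF nat_trans_linear[OF assms s], of 1] by (simp add: alt_sign_def)
qed (simp add: nat_trans_natural[OF assms] linear_map.minus[OF G.linear_mor] nat_trans_closed[OF assms])

lemma module_Hom: "module R (Hom_module R F G)"
proof -
  have ab: "abelian_group (fun_obj G s)" if "1 \<le> s" for s
    using G.module_obj[OF that] by (simp add: module_def)
  then have am: "abelian_monoid (fun_obj G s)" if "1 \<le> s" for s
    using that by (simp add: abelian_group_def)
  show ?thesis
  proof (rule moduleI)
    show "abelian_group (Hom_module R F G)"
    proof (rule abelian_groupI)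
      fix x assume "x \<in> carrier (Hom_module R F G)"
      then have x: "x \<in> nat_trans R F G" by (simp add: Hom_module_sel)
      show "\<exists>y\<in>carrier (Hom_module R F G). y \<oplus>\<^bsub>Hom_module R F G\<^esub> x = \<zero>\<^bsub>Hom_module R F G\<^esub>"
        unfolding Hom_module_sel
      proof (rule bexI[OF _ Hom_minus_closed[OF x]],
          rule nat_trans_eqI[OF Hom_add_closed[OF Hom_minus_closed[OF x] x] Hom_zero_closed])
        fix s c assume s: "1 \<le> s" and c: "c \<in> carrier (fun_obj F s)"
        show "((\<lambda>s\<in>{1..}. \<lambda>c\<in>carrier (fun_obj F s). \<ominus>\<^bsub>fun_obj G s\<^esub> x s c) \<oplus>\<^bsub>Hom_module R F G\<^esub> x) s c
          = \<zero>\<^bsub>Hom_module R F G\<^esub> s c"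
          using s c abelian_group.l_neg[OF ab[OF s] nat_trans_closed[OF x s c]]
          by (simp add: Hom_module_sel)
      qed
    qed (auto simp: Hom_module_sel(1) intro!: Hom_add_closed Hom_zero_closed nat_trans_eqI,
      (simp add: Hom_module_sel abelian_monoid.a_ac[OF am] abelian_monoid.l_zero[OF am] nat_trans_closed)+)
  next
    show "cring R" by (rule F.is_cring)
  qed (auto simp: Hom_module_sel(1) intro!: Hom_add_closed Hom_smult_closed nat_trans_eqI,
      (simp add: Hom_module_sel module.smult_l_distr[OF G.module_obj] module.smult_r_distr[OF G.module_obj]
        module.smult_assoc1[OF G.module_obj] module.smult_one[OF G.module_obj] nat_trans_closed)+)
qed

lemma linear_map_eval:
  assumes "1 \<le> s" "c \<in> carrier (fun_obj F s)"
  shows "linear_map R (Hom_module R F G) (fun_obj G s) (\<lambda>\<phi>. \<phi> s c)"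
  by (rule linear_mapI) (use assms in \<open>auto simp: Hom_module_sel nat_trans_closed module_Hom G.module_obj\<close>)

text \<open>
  The operations on natural transformations are pointwise, hence so is linearity of a map into them.
\<close>

lemma linear_map_into_Hom:
  assumes L: "module R L" and f: "\<And>x. x \<in> carrier L \<Longrightarrow> f x \<in> nat_trans R F G"
    and lin: "\<And>s c. 1 \<le> s \<Longrightarrow> c \<in> carrier (fun_obj F s) \<Longrightarrow> linear_map R L (fun_obj G s) (\<lambda>x. f x s c)"
  shows "linear_map R L (Hom_module R F G) f"
proof (rule linear_mapI)
  fix x y assume xy: "x \<in> carrier L" "y \<in> carrier L"
  show "f (x \<oplus>\<^bsub>L\<^esub> y) = f x \<oplus>\<^bsub>Hom_module R F G\<^esub> f y"
  proof (rule nat_trans_eqI)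
    show "f (x \<oplus>\<^bsub>L\<^esub> y) \<in> nat_trans R F G"
      using L xy by (intro f) (simp add: module_def abelian_groupE)
    show "f (x \<oplus>\<^bsub>L\<^esub> y) s c = (f x \<oplus>\<^bsub>Hom_module R F G\<^esub> f y) s c" if "1 \<le> s" "c \<in> carrier (fun_obj F s)" for s c
      using linear_map.add[OF lin[OF that] xy] by (simp add: Hom_module_sel(3)[OF that])
  qed (intro Hom_add_closed f xy)
next
  fix r x assume rx: "r \<in> carrier R" "x \<in> carrier L"
  show "f (r \<odot>\<^bsub>L\<^esub> x) = r \<odot>\<^bsub>Hom_module R F G\<^esub> f x"
  proof (rule nat_trans_eqI)
    show "f (r \<odot>\<^bsub>L\<^esub> x) \<in> nat_trans R F G"
      by (intro f module.smult_closed[OF L] rx)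
    show "f (r \<odot>\<^bsub>L\<^esub> x) s c = (r \<odot>\<^bsub>Hom_module R F G\<^esub> f x) s c" if "1 \<le> s" "c \<in> carrier (fun_obj F s)" for s c
      using linear_map.smult[OF lin[OF that] rx] by (simp add: Hom_module_sel(4)[OF that])
  qed (intro Hom_smult_closed f rx)
qed (use L module_Hom f in \<open>auto simp: Hom_module_sel(1)\<close>)

end

section \<open>The bicomplex of natural transformations\<close>

lemma M_functor_sel [simp]:
  "fun_obj (M_functor R Z n) s = chains R (smash_power Z s) n"
  "fun_mor (M_functor R Z n) t s h = chains_map R (smash_power Z t) n (sharp t h)"
  by (simp_all add: M_functor_def)

context cring
begin

lemma linear_functor_M: "linear_functor R (M_functor R Z n)"
proof (intro linear_functor.intro linear_functor_axioms.intro is_cring, unfold M_functor_sel)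
  show "module R (chains R (smash_power Z s) n)" for s
    by (rule module_chains)
  show "linear_map R (chains R (smash_power Z s) n) (chains R (smash_power Z t) n)
      (chains_map R (smash_power Z t) n (sharp t h))" if "h \<in> surjections t s" for s t h
    by (rule linear_map_chains_map[OF pointed_map_sharp[OF that]])
qed

lemma functor_pair_M: "functor_pair R (M_functor R Z m) (M_functor R W n)"
  by (intro functor_pair.intro linear_functor_M)

text \<open>
  The boundary is a natural transformation \<open>M\<^sub>n(Z) \<rightarrow> M\<^sub>n\<^sub>-\<^sub>1(Z)\<close>.
\<close>

lemma boundary_sharp:
  assumes Z: "pointed_faces Z" and h: "h \<in> surjections t s"
    and c: "c \<in> carrier (chains R (smash_power Z s) n)"
  shows "chains_map R (smash_power Z t) (n - 1) (sharp t h) (boundary R (smash_power Z s) n c)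
    = boundary R (smash_power Z t) n (chains_map R (smash_power Z t) n (sharp t h) c)"
proof (rule boundary_natural[where g = "\<lambda>_. sharp t h", OF _ _ _ _ c])
  fix n i z
  show "sharp t h (face (smash_power Z s) (Suc n) i z) = face (smash_power Z t) (Suc n) i (sharp t h z)"
    unfolding smash_power_sel diff_Suc_1 by (rule sharp_smash_map[OF h])
qed (rule pointed_faces_smash_power[OF Z] pointed_map_sharp[OF h])+

text \<open>
  The two differentials are pre- and postcomposition with boundaries, which commute on the nose; each
  squares to zero because \<open>\<partial>\<partial> = 0\<close>.
\<close>

lemma commuting_bicomplex_G:
  assumes X: "pointed_faces X" and Y: "pointed_faces Y"
  shows "commuting_bicomplex R (G_bicomplex R X Y)"
proof -
  let ?W = "G_bicomplex R X Y"
  have bi: "bi_module ?W p q = Hom_module R (M_functor R X p) (M_functor R Y q)" for p q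
    by (simp add: G_bicomplex_def)
  have carrier: "carrier (bi_module ?W p q) = nat_trans R (M_functor R X p) (M_functor R Y q)" for p q
    unfolding bi by (rule functor_pair.Hom_module_sel(1)[OF functor_pair_M])
  have mod: "module R (bi_module ?W p q)" for p q
    unfolding bi by (rule functor_pair.module_Hom[OF functor_pair_M])
  have zero: "\<zero>\<^bsub>bi_module ?W p q\<^esub> s c = \<zero>\<^bsub>chains R (smash_power Y s) q\<^esub>"
    if "1 \<le> s" "c \<in> carrier (chains R (smash_power X s) p)" for p q s c
    using functor_pair.Hom_module_sel(2)[OF functor_pair_M] that unfolding bi by fastforce
  note bX = linear_map_boundary[OF pointed_faces_smash_power[OF X]]
  note bY = linear_map_boundary[OF pointed_faces_smash_power[OF Y]]
  note linear = functor_pair.nat_trans_linear[OF functor_pair_M, unfolded M_functor_sel]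
  note natural = functor_pair.nat_trans_natural[OF functor_pair_M, unfolded M_functor_sel]
  note eval = functor_pair.linear_map_eval[OF functor_pair_M[where Z = X and W = Y], folded bi, unfolded M_functor_sel]
  note eqI = functor_pair.nat_trans_eqI[OF functor_pair_M, unfolded M_functor_sel]
  have hdiff: "hdiff ?W p q \<phi> s c = \<phi> s (boundary R (smash_power X s) p c)"
    if "1 \<le> s" "c \<in> carrier (chains R (smash_power X s) p)" for p q \<phi> s c
    using that by (simp add: G_bicomplex_def)
  have vdiff: "vdiff ?W p q \<phi> s c = boundary R (smash_power Y s) q (\<phi> s c)"
    if "1 \<le> s" "c \<in> carrier (chains R (smash_power X s) p)" for p q \<phi> s c
    using that by (simp add: G_bicomplex_def)
  have lin_h: "linear_map R (bi_module ?W (p - 1) q) (bi_module ?W p q) (hdiff ?W p q)" for p q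
    unfolding bi[of p q]
  proof (rule functor_pair.linear_map_into_Hom[OF functor_pair_M mod])
    fix \<phi> assume "\<phi> \<in> carrier (bi_module ?W (p - 1) q)"
    then have \<phi>: "\<phi> \<in> nat_trans R (M_functor R X (p - 1)) (M_functor R Y q)" by (simp add: carrier)
    have "(\<lambda>s\<in>{1..}. \<lambda>c\<in>carrier (fun_obj (M_functor R X p) s). \<phi> s (boundary R (smash_power X s) p c))
        \<in> nat_trans R (M_functor R X p) (M_functor R Y q)"
    proof (rule functor_pair.nat_transI[OF functor_pair_M], unfold M_functor_sel)
      show "linear_map R (chains R (smash_power X s) p) (chains R (smash_power Y s) q)
          (\<lambda>c. \<phi> s (boundary R (smash_power X s) p c))" if "1 \<le> s" for s
        by (rule linear_map_comp[OF bX linear[OF \<phi> that]])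
      fix s t h c assume st: "1 \<le> s" "1 \<le> t" and h: "h \<in> surjections t s"
        and c: "c \<in> carrier (chains R (smash_power X s) p)"
      show "\<phi> t (boundary R (smash_power X t) p (chains_map R (smash_power X t) p (sharp t h) c))
        = chains_map R (smash_power Y t) q (sharp t h) (\<phi> s (boundary R (smash_power X s) p c))"
        unfolding boundary_sharp[OF X h c, symmetric]
        by (rule natural[OF \<phi> st h linear_map.closed[OF bX c]])
    qed
    then show "hdiff ?W p q \<phi> \<in> nat_trans R (M_functor R X p) (M_functor R Y q)"
      by (simp add: G_bicomplex_def)
  next
    fix s c assume s: "1 \<le> s" and "c \<in> carrier (fun_obj (M_functor R X p) s)"
    then have c: "c \<in> carrier (chains R (smash_power X s) p)" by simp
    show "linear_map R (bi_module ?W (p - 1) q) (fun_obj (M_functor R Y q) s) (\<lambda>\<phi>. hdiff ?W p q \<phi> s c)"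
      unfolding hdiff[OF s c] M_functor_sel by (rule eval[OF s linear_map.closed[OF bX c]])
  qed
  have lin_v: "linear_map R (bi_module ?W p q) (bi_module ?W p (q - 1)) (vdiff ?W p q)" for p q
    unfolding bi[of p "q - 1"]
  proof (rule functor_pair.linear_map_into_Hom[OF functor_pair_M mod])
    fix \<phi> assume "\<phi> \<in> carrier (bi_module ?W p q)"
    then have \<phi>: "\<phi> \<in> nat_trans R (M_functor R X p) (M_functor R Y q)" by (simp add: carrier)
    have "(\<lambda>s\<in>{1..}. \<lambda>c\<in>carrier (fun_obj (M_functor R X p) s). boundary R (smash_power Y s) q (\<phi> s c))
        \<in> nat_trans R (M_functor R X p) (M_functor R Y (q - 1))"
    proof (rule functor_pair.nat_transI[OF functor_pair_M], unfold M_functor_sel)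
      show "linear_map R (chains R (smash_power X s) p) (chains R (smash_power Y s) (q - 1))
          (\<lambda>c. boundary R (smash_power Y s) q (\<phi> s c))" if "1 \<le> s" for s
        by (rule linear_map_comp[OF linear[OF \<phi> that] bY])
      fix s t h c assume st: "1 \<le> s" "1 \<le> t" and h: "h \<in> surjections t s"
        and c: "c \<in> carrier (chains R (smash_power X s) p)"
      show "boundary R (smash_power Y t) q (\<phi> t (chains_map R (smash_power X t) p (sharp t h) c))
        = chains_map R (smash_power Y t) (q - 1) (sharp t h) (boundary R (smash_power Y s) q (\<phi> s c))"
        unfolding natural[OF \<phi> st h c]
        by (rule boundary_sharp[OF Y h linear_map.closed[OF linear[OF \<phi> st(1)] c], symmetric])
    qed
    then show "vdiff ?W p q \<phi> \<in> nat_trans R (M_functor R X p) (M_functor R Y (q - 1))"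
      by (simp add: G_bicomplex_def)
  next
    fix s c assume s: "1 \<le> s" and "c \<in> carrier (fun_obj (M_functor R X p) s)"
    then have c: "c \<in> carrier (chains R (smash_power X s) p)" by simp
    show "linear_map R (bi_module ?W p q) (fun_obj (M_functor R Y (q - 1)) s) (\<lambda>\<phi>. vdiff ?W p q \<phi> s c)"
      unfolding vdiff[OF s c] M_functor_sel by (rule linear_map_comp[OF eval[OF s c] bY])
  qed
  note h_closed = linear_map.closed[OF lin_h, unfolded carrier]
  note v_closed = linear_map.closed[OF lin_v, unfolded carrier]
  have zero_closed: "\<zero>\<^bsub>bi_module ?W p q\<^esub> \<in> nat_trans R (M_functor R X p) (M_functor R Y q)" for p q
    unfolding bi by (rule functor_pair.Hom_zero_closed[OF functor_pair_M])
  show ?thesis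
  proof (rule commuting_bicomplex.intro)
    show "cring R" by (rule is_cring)
    fix p q \<phi>
    {
      assume "\<phi> \<in> carrier (bi_module ?W (p - 2) q)"
      then have \<phi>: "\<phi> \<in> nat_trans R (M_functor R X (p - 1 - 1)) (M_functor R Y q)" by (simp add: carrier)
      show "hdiff ?W p q (hdiff ?W (p - 1) q \<phi>) = \<zero>\<^bsub>bi_module ?W p q\<^esub>"
      proof (rule eqI[OF h_closed[OF h_closed[OF \<phi>]] zero_closed])
        fix s c assume s: "1 \<le> s" and c: "c \<in> carrier (chains R (smash_power X s) p)"
        have "hdiff ?W p q (hdiff ?W (p - 1) q \<phi>) s c = \<phi> s \<zero>\<^bsub>chains R (smash_power X s) (p - 1 - 1)\<^esub>"
          using boundary_boundary[OF pointed_faces_smash_power[OF X] c]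
          by (simp add: hdiff[OF s] c linear_map.closed[OF bX c])
        then show "hdiff ?W p q (hdiff ?W (p - 1) q \<phi>) s c = \<zero>\<^bsub>bi_module ?W p q\<^esub> s c"
          using linear_map.zero[OF linear[OF \<phi> s]] by (simp add: zero[OF s c])
      qed
    }
    {
      assume "\<phi> \<in> carrier (bi_module ?W p q)"
      then have \<phi>: "\<phi> \<in> nat_trans R (M_functor R X p) (M_functor R Y q)" by (simp add: carrier)
      have "vdiff ?W p (q - 1) (vdiff ?W p q \<phi>) = \<zero>\<^bsub>bi_module ?W p (q - 1 - 1)\<^esub>"
      proof (rule eqI[OF v_closed[OF v_closed[OF \<phi>]] zero_closed])
        fix s c assume s: "1 \<le> s" and c: "c \<in> carrier (chains R (smash_power X s) p)"
        show "vdiff ?W p (q - 1) (vdiff ?W p q \<phi>) s c = \<zero>\<^bsub>bi_module ?W p (q - 1 - 1)\<^esub> s c"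
          using boundary_boundary[OF pointed_faces_smash_power[OF Y] linear_map.closed[OF linear[OF \<phi> s] c]]
          by (simp add: vdiff[OF s c] zero[OF s c])
      qed
      then show "vdiff ?W p (q - 1) (vdiff ?W p q \<phi>) = \<zero>\<^bsub>bi_module ?W p (q - 2)\<^esub>" by simp
    }
    {
      assume "\<phi> \<in> carrier (bi_module ?W (p - 1) q)"
      then have \<phi>: "\<phi> \<in> nat_trans R (M_functor R X (p - 1)) (M_functor R Y q)" by (simp add: carrier)
      show "vdiff ?W p q (hdiff ?W p q \<phi>) = hdiff ?W p (q - 1) (vdiff ?W (p - 1) q \<phi>)"
      proof (rule eqI[OF v_closed[OF h_closed[OF \<phi>]] h_closed[OF v_closed[OF \<phi>]]])
        fix s c assume s: "1 \<le> s" and c: "c \<in> carrier (chains R (smash_power X s) p)"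
        show "vdiff ?W p q (hdiff ?W p q \<phi>) s c = hdiff ?W p (q - 1) (vdiff ?W (p - 1) q \<phi>) s c"
          by (simp add: vdiff[OF s] hdiff[OF s] c linear_map.closed[OF bX c])
      qed
    }
  qed (rule mod lin_h lin_v)+
qed

end

section \<open>The bicomplex of cosimplicial chains\<close>

lemma pointed_map_coface:
  assumes X: "pointed_faces X" and p: "0 < p" "i \<le> nat p"
  shows "pointed_map (level_power X Y (nat (p - 1))) q (level_power X Y (nat p)) q (coface X (nat p) i)"
proof -
  interpret X: pointed_faces X by fact
  obtain n where n: "p = int (Suc n)" using p(1) that[of "nat p - 1"] by simp
  then show ?thesis
    using p(2) X.face_closed[of i n] X.face_base[of i n] X.base_closed
    by (auto simp: pointed_map_def coface_def nat_add_distrib PiE_iff intro!: restrict_ext)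
qed

context cring
begin

text \<open>
  The vertical differential comes from the faces of \<open>Y\<close> and the horizontal one from the faces of
  \<open>X\<close>, which act on the values and on the arguments of functions and so commute. The identities
  between faces of \<open>X\<close> turn into the cosimplicial identities between the coface maps.
\<close>

lemma commuting_bicomplex_D:
  assumes X: "pointed_faces X" and Y: "pointed_faces Y"
  shows "commuting_bicomplex R (D_bicomplex R X Y)"
proof -
  let ?W = "D_bicomplex R X Y"
  interpret X: pointed_faces X by fact
  have pf: "pointed_faces (level_power X Y n)" for n
    by (rule pointed_faces_fun_space[OF Y X.base_closed])
  have bi: "bi_module ?W p q = (if p < 0 then free_module R {} else chains R (level_power X Y (nat p)) q)" for p q
    by (simp add: D_bicomplex_def)
  have zero: "\<zero>\<^bsub>bi_module ?W p q\<^esub> = (\<lambda>v. \<zero>)" for p q by (simp add: bi chains_def)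
  have mod: "module R (bi_module ?W p q)" for p q by (simp add: bi module_chains module_free_module)
  have hdiff_pos: "hdiff ?W p q = alternating_map R (level_power X Y (nat p)) q (nat p) (coface X (nat p))"
    if "0 < p" for p q
    using that by (auto simp: D_bicomplex_def alternating_map_def atMost_atLeast0)
  have hdiff_nonpos: "hdiff ?W p q c = \<zero>\<^bsub>bi_module ?W p q\<^esub>" if "p \<le> 0" for p q c
    using that by (simp add: zero) (simp add: D_bicomplex_def)
  have vdiff_nonneg: "vdiff ?W p q = boundary R (level_power X Y (nat p)) q" if "0 \<le> p" for p q
    using that by (auto simp: D_bicomplex_def)
  have vdiff_neg: "vdiff ?W p q c = \<zero>\<^bsub>bi_module ?W p (q - 1)\<^esub>" if "p < 0" for p q c
    using that by (simp add: zero) (simp add: D_bicomplex_def)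
  have lin_h: "linear_map R (bi_module ?W (p - 1) q) (bi_module ?W p q) (hdiff ?W p q)" for p q
  proof (cases "0 < p")
    case True
    then show ?thesis
      by (auto simp: bi hdiff_pos intro!: linear_map_alternating_map pointed_map_coface X)
  next
    case False
    show ?thesis
      by (rule linear_map_cong[OF linear_map_zero[OF mod mod]]) (use False in \<open>simp add: hdiff_nonpos\<close>)
  qed
  have lin_v: "linear_map R (bi_module ?W p q) (bi_module ?W p (q - 1)) (vdiff ?W p q)" for p q
  proof (cases "0 \<le> p")
    case True
    then show ?thesis by (simp add: bi vdiff_nonneg linear_map_boundary pf)
  next
    case False
    show ?thesis
      by (rule linear_map_cong[OF linear_map_zero[OF mod mod]]) (use False in \<open>simp add: vdiff_neg\<close>)
  qed
  show ?thesis
  proof (rule commuting_bicomplex.intro)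
    show "cring R" by (rule is_cring)
    fix p q c
    {
      assume c: "c \<in> carrier (bi_module ?W (p - 2) q)"
      show "hdiff ?W p q (hdiff ?W (p - 1) q c) = \<zero>\<^bsub>bi_module ?W p q\<^esub>"
      proof (cases "1 < p")
        case True
        then obtain n where p: "p = int (Suc (Suc n))" using that[of "nat p - 2"] by simp
        then have np: "nat p = Suc (Suc n)" "nat (p - 1) = Suc n" "nat (p - 2) = n" by auto
        have c': "c \<in> carrier (chains R (level_power X Y n) q)" using c True by (simp add: bi np)
        have "alternating_map R (level_power X Y (Suc (Suc n))) q (Suc (Suc n)) (coface X (Suc (Suc n)))
            (alternating_map R (level_power X Y (Suc n)) q (Suc n) (coface X (Suc n)) c)
            = \<zero>\<^bsub>chains R (level_power X Y (Suc (Suc n))) q\<^esub>"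
        proof (rule alternating_map_square_coface[OF _ _ _ c'])
          show "pointed_map (level_power X Y n) q (level_power X Y (Suc n)) q (coface X (Suc n) i)"
            if "i \<le> Suc n" for i
            using pointed_map_coface[OF X, of "int (Suc n)" i Y q] that by (simp add: nat_add_distrib)
          show "pointed_map (level_power X Y (Suc n)) q (level_power X Y (Suc (Suc n))) q (coface X (Suc (Suc n)) i)"
            if "i \<le> Suc (Suc n)" for i
            using pointed_map_coface[OF X, of "int (Suc (Suc n))" i Y q] that by (simp add: nat_add_distrib)
          show "coface X (Suc (Suc n)) j (coface X (Suc n) i v) = coface X (Suc (Suc n)) i (coface X (Suc n) (j - 1) v)"
            if "i < j" "j \<le> Suc (Suc n)" for i j v
            using that X.face_closed[of i "Suc n"] X.face_closed[of j "Suc n"]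
            by (auto simp: coface_def X.face_face intro!: restrict_ext)
        qed
        then show ?thesis using True by (simp add: hdiff_pos bi np)
      next
        case False
        then show ?thesis using linear_map.zero[OF lin_h] by (simp add: hdiff_nonpos)
      qed
    }
    {
      assume c: "c \<in> carrier (bi_module ?W p q)"
      show "vdiff ?W p (q - 1) (vdiff ?W p q c) = \<zero>\<^bsub>bi_module ?W p (q - 2)\<^esub>"
        using c boundary_boundary[OF pf] by (cases "p < 0") (auto simp: vdiff_neg zero, auto simp: bi vdiff_nonneg chains_def)
    }
    {
      assume c: "c \<in> carrier (bi_module ?W (p - 1) q)"
      show "vdiff ?W p q (hdiff ?W p q c) = hdiff ?W p (q - 1) (vdiff ?W (p - 1) q c)"
      proof (cases "0 < p")
        case p: True
        have c': "c \<in> carrier (chains R (level_power X Y (nat (p - 1))) q)" using c p by (simp add: bi)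
        show ?thesis
        proof (cases "0 < q")
          case q: True
          then obtain m where m: "nat q = Suc m" "nat (q - 1) = m" using that[of "nat q - 1"] by auto
          obtain n where n: "nat p = Suc n" "nat (p - 1) = n" using p that[of "nat p - 1"] by auto
          have "alternating_map R (level_power X Y (nat p)) (q - 1) (nat q) (face (level_power X Y (nat p)) (nat q))
              (alternating_map R (level_power X Y (nat p)) q (nat p) (coface X (nat p)) c)
            = alternating_map R (level_power X Y (nat p)) (q - 1) (nat p) (coface X (nat p))
              (alternating_map R (level_power X Y (nat (p - 1))) (q - 1) (nat q) (face (level_power X Y (nat (p - 1))) (nat q)) c)"
            by (rule alternating_map_commute[OF _ _ _ _ _ c'])
              (use n X.face_closed[of _ n] pointed_map_coface[OF X p] pointed_faces.pointed_map_face[OF pf q]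
                in \<open>auto simp: coface_def intro!: restrict_ext\<close>)
          then show ?thesis using p q by (simp add: hdiff_pos vdiff_nonneg boundary_pos)
        next
          case False
          have "hdiff ?W p (q - 1) \<zero>\<^bsub>bi_module ?W (p - 1) (q - 1)\<^esub> = \<zero>\<^bsub>bi_module ?W p (q - 1)\<^esub>"
            by (rule linear_map.zero[OF lin_h])
          then show ?thesis using p False by (simp add: vdiff_nonneg boundary_nonpos bi)
        qed
      next
        case False
        then show ?thesis using linear_map.zero[OF lin_v] by (simp add: hdiff_nonpos)
      qed
    }
  qed (rule mod lin_h lin_v)+
qed

end

section \<open>The homomorphism \<open>\<epsilon>\<close> of bicomplexes\<close>

locale two_spaces = cring R + X: pointed_faces X + Y: pointed_faces Y
  for R :: "('r, 'x) ring_scheme" (structure) and X :: "'a sspace" and Y :: "'b sspace"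
begin

text \<open>
  The map \<open>v \<mapsto> v(x\<^sub>1)\<cdots>v(x\<^sub>s)\<close>, as a function of \<open>v\<close> for a fixed tuple \<open>x\<close> and also as a
  function of \<open>x\<close> for a fixed \<open>v\<close>. Both points of view are used: the second defines \<open>\<epsilon>\<close>,
  the first shows that it is compatible with the differentials.
\<close>

definition eval_at :: "nat \<Rightarrow> nat \<Rightarrow> (nat \<Rightarrow> 'a) \<Rightarrow> ('a \<Rightarrow> 'b) \<Rightarrow> (nat \<Rightarrow> 'b)" where
  "eval_at s q x v = smash_proj Y s q (\<lambda>k\<in>{1..s}. v (x k))"

abbreviation Hom_bi :: "int \<Rightarrow> int \<Rightarrow> ('r, nat \<Rightarrow> ((nat \<Rightarrow> 'a) \<Rightarrow> 'r) \<Rightarrow> ((nat \<Rightarrow> 'b) \<Rightarrow> 'r)) module" where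
  "Hom_bi p q \<equiv> Hom_module R (M_functor R X p) (M_functor R Y q)"

lemma pair: "functor_pair R (M_functor R X p) (M_functor R Y q)"
  by (rule functor_pair_M)

lemmas Hom_sel = functor_pair.Hom_module_sel[OF pair, unfolded M_functor_sel]
lemmas Hom_linear = functor_pair.nat_trans_linear[OF pair, unfolded M_functor_sel]
lemmas Hom_natural = functor_pair.nat_trans_natural[OF pair, unfolded M_functor_sel]
lemmas Hom_closed = functor_pair.nat_trans_closed[OF pair, unfolded M_functor_sel]
lemmas Hom_eqI = functor_pair.nat_trans_eqI[OF pair, unfolded M_functor_sel]
lemmas Hom_eval = functor_pair.linear_map_eval[OF pair, unfolded M_functor_sel]
lemmas module_Hom_bi = functor_pair.module_Hom[OF pair]

lemma D_bi: "bi_module (D_bicomplex R X Y) p q =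
    (if p < 0 then free_module R {} else chains R (level_power X Y (nat p)) q)"
  by (simp add: D_bicomplex_def)

lemma G_bi: "bi_module (G_bicomplex R X Y) p q = Hom_bi p q"
  by (simp add: G_bicomplex_def)

lemma level_power_faces: "pointed_faces (level_power X Y n)"
  by (rule pointed_faces_fun_space[OF Y.pointed_faces_axioms X.base_closed])

lemma eval_at_simplex:
  assumes "x \<in> simplices (smash_power X s) p" "v \<in> simplices (level_power X Y p) q"
  shows "eval_at s q x v \<in> simplices (smash_power Y s) q"
  using smash_simplex_PiE[OF X.base_closed assms(1)] assms(2)
  by (auto simp: eval_at_def PiE_iff intro!: imageI)

lemma pointed_map_eval_at:
  assumes "x \<in> simplices (smash_power X s) p"
  shows "pointed_map (level_power X Y p) q (smash_power Y s) q (eval_at s (nat q) x)"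
proof -
  have "x \<in> {1..s} \<rightarrow>\<^sub>E simplices X p" by (rule smash_simplex_PiE[OF X.base_closed assms])
  then have "(\<lambda>k\<in>{1..s}. (\<lambda>x\<in>simplices X p. base Y (nat q)) (x k)) = (\<lambda>k\<in>{1..s}. base Y (nat q))"
    by (auto intro!: restrict_ext)
  then have "eval_at s (nat q) x (base (level_power X Y p) (nat q)) = base (smash_power Y s) (nat q)"
    by (simp add: eval_at_def smash_proj_base del: One_nat_def)
  then show ?thesis using eval_at_simplex[OF assms] unfolding pointed_map_def by blast
qed

lemma pointed_map_eval_arg:
  assumes p: "0 \<le> p" and q: "0 \<le> q" and v: "v \<in> simplices (level_power X Y (nat p)) (nat q)"
  shows "pointed_map (smash_power X s) p (smash_power Y s) q (\<lambda>x. eval_at s (nat q) x v)"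
proof -
  have "v (base X (nat p)) = base Y (nat q)" using v by simp
  then have "eval_at s (nat q) (base (smash_power X s) (nat p)) v = base (smash_power Y s) (nat q)"
    unfolding eval_at_def smash_power_sel by (rule smash_restrict_base)
  then show ?thesis using eval_at_simplex[OF _ v] q unfolding pointed_map_def by blast
qed

lemma eps_class_alt:
  "eps_class R X Y p q v = (\<lambda>s\<in>{1..}. \<lambda>c\<in>carrier (chains R (smash_power X s) p).
     chains_map R (smash_power Y s) q (\<lambda>x. eval_at s (nat q) x v) c)"
  by (simp add: eps_class_def eval_at_def)

text \<open>
  Applying \<open>v\<close> to the entries of a tuple commutes with rearranging and repeating the entries.
\<close>

lemma eps_class_nat_trans:
  assumes p: "0 \<le> p" and q: "0 \<le> q" and v: "v \<in> simplices (level_power X Y (nat p)) (nat q)"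
  shows "eps_class R X Y p q v \<in> nat_trans R (M_functor R X p) (M_functor R Y q)"
  unfolding eps_class_alt
proof (rule functor_pair.nat_transI[OF pair, of p q "\<lambda>s c. chains_map R (smash_power Y s) q (\<lambda>x. eval_at s (nat q) x v) c",
      unfolded M_functor_sel])
  note ev = pointed_map_eval_arg[OF p q v]
  show "linear_map R (chains R (smash_power X s) p) (chains R (smash_power Y s) q)
      (chains_map R (smash_power Y s) q (\<lambda>x. eval_at s (nat q) x v))" for s
    by (rule linear_map_chains_map[OF ev])
  fix s t h c assume h: "h \<in> surjections t s" and c: "c \<in> carrier (chains R (smash_power X s) p)"
  note shX = pointed_map_sharp[OF h, of X p] and shY = pointed_map_sharp[OF h, of Y q]
  have "chains_map R (smash_power Y t) q (\<lambda>x. eval_at t (nat q) x v) (chains_map R (smash_power X t) p (sharp t h) c)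
      = chains_map R (smash_power Y t) q (\<lambda>x. eval_at t (nat q) (sharp t h x) v) c"
    by (rule chains_map_comp[OF shX ev c])
  also have "\<dots> = chains_map R (smash_power Y t) q (\<lambda>x. sharp t h (eval_at s (nat q) x v)) c"
    unfolding eval_at_def sharp_smash_map[OF h] ..
  also have "\<dots> = chains_map R (smash_power Y t) q (sharp t h)
      (chains_map R (smash_power Y s) q (\<lambda>x. eval_at s (nat q) x v) c)"
    by (rule chains_map_comp[OF ev shY c, symmetric])
  finally show "chains_map R (smash_power Y t) q (\<lambda>x. eval_at t (nat q) x v) (chains_map R (smash_power X t) p (sharp t h) c)
    = chains_map R (smash_power Y t) q (sharp t h) (chains_map R (smash_power Y s) q (\<lambda>x. eval_at s (nat q) x v) c)" .
qed

lemma linear_map_eps: "linear_map R (bi_module (D_bicomplex R X Y) p q) (Hom_bi p q) (eps_bi R X Y p q)"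
proof (cases "p < 0")
  case True
  then show ?thesis unfolding D_bi eps_bi_def
    by (auto intro!: linear_map_lin_ext module_Hom_bi)
next
  case False
  have "linear_map R (chains R (level_power X Y (nat p)) q) (Hom_bi p q) (eps_bi R X Y p q)"
    unfolding chains_def eps_bi_def
    by (rule linear_map_lin_ext[OF module_Hom_bi])
      (use False in \<open>auto simp: Hom_sel(1) simp del: fun_space_sel intro!: eps_class_nat_trans\<close>)
  then show ?thesis using False by (simp add: D_bi)
qed

lemma linear_map_eps_chains:
  "0 \<le> p \<Longrightarrow> linear_map R (chains R (level_power X Y (nat p)) q) (Hom_bi p q) (eps_bi R X Y p q)"
  using linear_map_eps[of p q] by (simp add: D_bi)

lemma eps_simplex:
  assumes p: "0 \<le> p" and q: "0 \<le> q" and v: "v \<in> simplices (level_power X Y (nat p)) (nat q)"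
    and v0: "v \<noteq> base (level_power X Y (nat p)) (nat q)"
  shows "eps_bi R X Y p q (simplex_class R (level_power X Y (nat p)) q v) = eps_class R X Y p q v"
  unfolding eps_bi_def simplex_class_eq if_not_P[OF v0]
  by (rule lin_ext_delta[OF module_Hom_bi, where A = "simplices (level_power X Y (nat p)) (nat q)"])
    (use p q v in \<open>auto simp: Hom_sel(1) simp del: fun_space_sel intro!: eps_class_nat_trans\<close>)

text \<open>
  At a fixed basis element, \<open>\<epsilon>\<close> is induced by a pointed map in the variable \<open>v\<close>, and so the
  general facts on induced maps apply to it.
\<close>

lemma eps_eval:
  assumes p: "0 \<le> p" and s: "1 \<le> s" and x: "x \<in> simplices (smash_power X s) (nat p)"
    and c: "c \<in> carrier (chains R (level_power X Y (nat p)) q)"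
  shows "eps_bi R X Y p q c s (simplex_class R (smash_power X s) p x)
    = chains_map R (smash_power Y s) q (eval_at s (nat q) x) c"
proof (rule chains_eqI[OF _ linear_map_chains_map[OF pointed_map_eval_at[OF x]] _ c])
  have xc: "simplex_class R (smash_power X s) p x \<in> carrier (chains R (smash_power X s) p)"
    by (rule simplex_class_closed[OF p x])
  show "linear_map R (chains R (level_power X Y (nat p)) q) (chains R (smash_power Y s) q)
      (\<lambda>c. eps_bi R X Y p q c s (simplex_class R (smash_power X s) p x))"
    by (rule linear_map_comp[OF linear_map_eps_chains[OF p] Hom_eval[OF s xc]])
  fix v assume q: "0 \<le> q" and v: "v \<in> simplices (level_power X Y (nat p)) (nat q)"
    "v \<noteq> base (level_power X Y (nat p)) (nat q)"
  have "eps_bi R X Y p q (simplex_class R (level_power X Y (nat p)) q v) s (simplex_class R (smash_power X s) p x)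
      = chains_map R (smash_power Y s) q (\<lambda>x. eval_at s (nat q) x v) (simplex_class R (smash_power X s) p x)"
    unfolding eps_simplex[OF p q v] eps_class_alt using s xc by simp
  also have "\<dots> = simplex_class R (smash_power Y s) q (eval_at s (nat q) x v)"
    by (rule chains_map_class[OF pointed_map_eval_arg[OF p q v(1)] p x])
  also have "\<dots> = chains_map R (smash_power Y s) q (eval_at s (nat q) x)
      (simplex_class R (level_power X Y (nat p)) q v)"
    by (rule chains_map_class[OF pointed_map_eval_at[OF x] q v(1), symmetric])
  finally show "eps_bi R X Y p q (simplex_class R (level_power X Y (nat p)) q v) s (simplex_class R (smash_power X s) p x)
    = chains_map R (smash_power Y s) q (eval_at s (nat q) x) (simplex_class R (level_power X Y (nat p)) q v)" .
qed

lemma D_bi_neg: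
  assumes "p < 0 \<or> q < 0" "c \<in> carrier (bi_module (D_bicomplex R X Y) p q)"
  shows "c = \<zero>\<^bsub>bi_module (D_bicomplex R X Y) p q\<^esub>"
  using assms chains_neg[of q] by (auto simp: D_bi free_module_def fun_eq_iff chains_def split: if_splits)

text \<open>
  Outside the quadrant \<open>p, q \<ge> 0\<close> source or target of the transformations is the zero functor.
\<close>

lemma Hom_bi_neg:
  assumes "p < 0 \<or> q < 0" and \<phi>: "\<phi> \<in> carrier (Hom_bi p q)"
  shows "\<phi> = \<zero>\<^bsub>Hom_bi p q\<^esub>"
proof (rule Hom_eqI)
  show \<phi>': "\<phi> \<in> nat_trans R (M_functor R X p) (M_functor R Y q)" using \<phi> by (simp add: Hom_sel(1))
  show "\<zero>\<^bsub>Hom_bi p q\<^esub> \<in> nat_trans R (M_functor R X p) (M_functor R Y q)"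
    by (rule functor_pair.Hom_zero_closed[OF pair])
  fix s c assume s: "1 \<le> s" and c: "c \<in> carrier (chains R (smash_power X s) p)"
  have "\<phi> s c = \<zero>\<^bsub>chains R (smash_power Y s) q\<^esub>"
  proof (cases "p < 0")
    case True
    then have "c = \<zero>\<^bsub>chains R (smash_power X s) p\<^esub>" using c chains_neg by blast
    then show ?thesis using linear_map.zero[OF Hom_linear[OF \<phi>' s]] by simp
  next
    case False
    then show ?thesis using Hom_closed[OF \<phi>' s c] chains_neg[of q] assms(1) by blast
  qed
  then show "\<phi> s c = \<zero>\<^bsub>Hom_bi p q\<^esub> s c" by (simp add: Hom_sel(2)[OF s c])
qed

lemma Hom_bi_eqI:
  assumes p: "0 \<le> p" and \<phi>: "\<phi> \<in> carrier (Hom_bi p q)" and \<psi>: "\<psi> \<in> carrier (Hom_bi p q)"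
    and eq: "\<And>s x. \<lbrakk>1 \<le> s; x \<in> simplices (smash_power X s) (nat p); x \<noteq> base (smash_power X s) (nat p)\<rbrakk> \<Longrightarrow>
      \<phi> s (simplex_class R (smash_power X s) p x) = \<psi> s (simplex_class R (smash_power X s) p x)"
  shows "\<phi> = \<psi>"
proof (rule Hom_eqI)
  show n: "\<phi> \<in> nat_trans R (M_functor R X p) (M_functor R Y q)" "\<psi> \<in> nat_trans R (M_functor R X p) (M_functor R Y q)"
    using \<phi> \<psi> by (simp_all add: Hom_sel(1))
  fix s c assume s: "1 \<le> s" and c: "c \<in> carrier (chains R (smash_power X s) p)"
  show "\<phi> s c = \<psi> s c"
    by (rule chains_eqI[OF Hom_linear[OF n(1) s] Hom_linear[OF n(2) s] eq[OF s] c])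
qed

text \<open>
  For a fixed \<open>x\<close>, evaluation at \<open>x\<close> is a map from the function space to \<open>Y\<^sup>\<and>\<^sup>s\<close> that
  commutes with faces, since these are taken in \<open>Y\<close> on both sides. Compatibility with \<open>d''\<close> is naturality of the boundary.
\<close>

lemma eps_vdiff:
  assumes c: "c \<in> carrier (bi_module (D_bicomplex R X Y) p q)"
  shows "eps_bi R X Y p (q - 1) (vdiff (D_bicomplex R X Y) p q c)
    = vdiff (G_bicomplex R X Y) p q (eps_bi R X Y p q c)"
proof -
  interpret D: commuting_bicomplex R "D_bicomplex R X Y"
    by (rule commuting_bicomplex_D[OF X.pointed_faces_axioms Y.pointed_faces_axioms])
  interpret G: commuting_bicomplex R "G_bicomplex R X Y"
    by (rule commuting_bicomplex_G[OF X.pointed_faces_axioms Y.pointed_faces_axioms])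
  have lhs: "eps_bi R X Y p (q - 1) (vdiff (D_bicomplex R X Y) p q c) \<in> carrier (Hom_bi p (q - 1))"
    by (rule linear_map.closed[OF linear_map_eps linear_map.closed[OF D.vdiff c]])
  have e: "eps_bi R X Y p q c \<in> carrier (Hom_bi p q)"
    by (rule linear_map.closed[OF linear_map_eps c])
  have rhs: "vdiff (G_bicomplex R X Y) p q (eps_bi R X Y p q c) \<in> carrier (Hom_bi p (q - 1))"
    using linear_map.closed[OF G.vdiff[of p q]] e by (simp add: G_bi)
  show ?thesis
  proof (cases "0 \<le> p")
    case False
    then show ?thesis using Hom_bi_neg[OF _ lhs] Hom_bi_neg[OF _ rhs] by simp
  next
    case p: True
    have c': "c \<in> carrier (chains R (level_power X Y (nat p)) q)" using c p by (simp add: D_bi)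
    have dc: "vdiff (D_bicomplex R X Y) p q c = boundary R (level_power X Y (nat p)) q c"
      using p by (simp add: D_bicomplex_def)
    have bc: "boundary R (level_power X Y (nat p)) q c \<in> carrier (chains R (level_power X Y (nat p)) (q - 1))"
      by (rule linear_map.closed[OF linear_map_boundary[OF level_power_faces] c'])
    show ?thesis
    proof (rule Hom_bi_eqI[OF p lhs rhs])
      fix s x assume s: "1 \<le> s" and x: "x \<in> simplices (smash_power X s) (nat p)"
      have "chains_map R (smash_power Y s) (q - 1) (eval_at s (nat (q - 1)) x) (boundary R (level_power X Y (nat p)) q c)
          = boundary R (smash_power Y s) q (chains_map R (smash_power Y s) q (eval_at s (nat q) x) c)"
      proof (rule boundary_natural[where g = "\<lambda>n. eval_at s n x", OF level_power_faces _ _ _ c'])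
        show "pointed_faces (smash_power Y s)"
          by (rule pointed_faces_smash_power[OF Y.pointed_faces_axioms])
        show "pointed_map (level_power X Y (nat p)) (int n) (smash_power Y s) (int n) (eval_at s n x)" for n
          using pointed_map_eval_at[OF x, of "int n"] by simp
        fix n i v assume i: "i \<le> Suc n"
        have "x \<in> {1..s} \<rightarrow>\<^sub>E simplices X (nat p)" by (rule smash_simplex_PiE[OF X.base_closed x])
        then show "eval_at s n x (face (level_power X Y (nat p)) (Suc n) i v)
            = face (smash_power Y s) (Suc n) i (eval_at s (Suc n) x v)"
          unfolding eval_at_def smash_power_sel diff_Suc_1
          by (subst smash_proj_restrict_comp[where g = "face Y (Suc n) i", OF Y.face_base[OF i]])
            (auto intro!: arg_cong[where f = "smash_proj Y s n"] restrict_ext)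
      qed
      then show "eps_bi R X Y p (q - 1) (vdiff (D_bicomplex R X Y) p q c) s (simplex_class R (smash_power X s) p x)
        = vdiff (G_bicomplex R X Y) p q (eps_bi R X Y p q c) s (simplex_class R (smash_power X s) p x)"
        using s simplex_class_closed[OF p x]
        by (simp add: dc eps_eval[OF p s x bc] eps_eval[OF p s x c'] G_bicomplex_def)
    qed
  qed
qed

lemma chains_map_id: "0 \<le> n \<Longrightarrow> c \<in> carrier (chains R Z n) \<Longrightarrow> chains_map R Z n (\<lambda>z. z) c = c"
  by (rule chains_eqI[of Z n "chains R Z n" "chains_map R Z n (\<lambda>z. z)" "\<lambda>c. c"])
    (auto intro!: linear_map_chains_map linear_mapI module_chains chains_map_class simp: pointed_map_def)

text \<open>
  On simplices the claim is \<open>(\<delta>\<^sup>i v)(x\<^sub>1)\<cdots>(\<delta>\<^sup>i v)(x\<^sub>s) = v(d\<^sub>i x\<^sub>1)\<cdots>v(d\<^sub>i x\<^sub>s)\<close>. The right-hand side is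
  evaluation of \<open>v\<close> at \<open>d\<^sub>i(x\<^sub>1\<cdots>x\<^sub>s)\<close>, also when some \<open>d\<^sub>i x\<^sub>k\<close> is the basepoint, as \<open>v\<close> is
  pointed.
\<close>

lemma eps_hdiff:
  assumes c: "c \<in> carrier (bi_module (D_bicomplex R X Y) (p - 1) q)"
  shows "eps_bi R X Y p q (hdiff (D_bicomplex R X Y) p q c)
    = hdiff (G_bicomplex R X Y) p q (eps_bi R X Y (p - 1) q c)"
proof -
  interpret D: commuting_bicomplex R "D_bicomplex R X Y"
    by (rule commuting_bicomplex_D[OF X.pointed_faces_axioms Y.pointed_faces_axioms])
  interpret G: commuting_bicomplex R "G_bicomplex R X Y"
    by (rule commuting_bicomplex_G[OF X.pointed_faces_axioms Y.pointed_faces_axioms])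
  have e: "eps_bi R X Y (p - 1) q c \<in> carrier (Hom_bi (p - 1) q)"
    by (rule linear_map.closed[OF linear_map_eps c])
  show ?thesis
  proof (cases "0 < p \<and> 0 \<le> q")
    case False
    then have "c = \<zero>\<^bsub>bi_module (D_bicomplex R X Y) (p - 1) q\<^esub>"
      by (intro D_bi_neg[OF _ c]) auto
    then show ?thesis
      using linear_map.zero[OF D.hdiff] linear_map.zero[OF G.hdiff] linear_map.zero[OF linear_map_eps]
      by (simp add: G_bi)
  next
    case True
    then have p: "0 < p" "0 \<le> p" "0 \<le> p - 1" and q: "0 \<le> q" by auto
    have lhs: "eps_bi R X Y p q (hdiff (D_bicomplex R X Y) p q c) \<in> carrier (Hom_bi p q)"
      by (rule linear_map.closed[OF linear_map_eps linear_map.closed[OF D.hdiff c]])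
    have rhs: "hdiff (G_bicomplex R X Y) p q (eps_bi R X Y (p - 1) q c) \<in> carrier (Hom_bi p q)"
      using linear_map.closed[OF G.hdiff[of p q]] e by (simp add: G_bi)
    have c': "c \<in> carrier (chains R (level_power X Y (nat (p - 1))) q)" using c p by (simp add: D_bi)
    have dc: "hdiff (D_bicomplex R X Y) p q c
        = alternating_map R (level_power X Y (nat p)) q (nat p) (coface X (nat p)) c"
      using p by (simp add: D_bicomplex_def alternating_map_def atMost_atLeast0)
    have bc: "alternating_map R (level_power X Y (nat p)) q (nat p) (coface X (nat p)) c
        \<in> carrier (chains R (level_power X Y (nat p)) q)"
      by (rule linear_map.closed[OF linear_map_alternating_map c'])
        (rule pointed_map_coface[OF X.pointed_faces_axioms p(1)])
    show ?thesis
    proof (rule Hom_bi_eqI[OF p(2) lhs rhs])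
      fix s x assume s: "1 \<le> s" and x: "x \<in> simplices (smash_power X s) (nat p)"
      let ?d = "\<lambda>i. face (smash_power X s) (nat p) i x"
      note pmf = pointed_faces.pointed_map_face[OF pointed_faces_smash_power[OF X.pointed_faces_axioms] p(1)]
      have d: "?d i \<in> simplices (smash_power X s) (nat (p - 1))" if "i \<le> nat p" for i
        using pmf[OF that] x p by (auto simp: pointed_map_def simp del: smash_power_sel)
      have xx: "x \<in> {1..s} \<rightarrow>\<^sub>E simplices X (nat p)" by (rule smash_simplex_PiE[OF X.base_closed x])
      have pp: "nat p - 1 = nat (p - 1)" by simp
      interpret e: linear_map R "chains R (smash_power X s) (p - 1)" "chains R (smash_power Y s) q" "eps_bi R X Y (p - 1) q c s"
        using e by (intro Hom_linear[OF _ s]) (simp add: Hom_sel(1))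
      have "eps_bi R X Y p q (hdiff (D_bicomplex R X Y) p q c) s (simplex_class R (smash_power X s) p x)
          = chains_map R (smash_power Y s) q (eval_at s (nat q) x)
             (alternating_map R (level_power X Y (nat p)) q (nat p) (coface X (nat p)) c)"
        unfolding dc by (rule eps_eval[OF p(2) s x bc])
      \<comment> \<open>The identity map is inserted to fit the square form of \<open>alternating_map_natural\<close>.\<close>
      also have "\<dots> = alternating_map R (smash_power Y s) q (nat p) (\<lambda>i. eval_at s (nat q) (?d i))
          (chains_map R (level_power X Y (nat (p - 1))) q (\<lambda>v. v) c)"
      proof (rule alternating_map_natural[OF _ _ _ _ _ c'])
        show "pointed_map (level_power X Y (nat (p - 1))) q (level_power X Y (nat p)) q (coface X (nat p) i)"
          if "i \<le> nat p" for i
          by (rule pointed_map_coface[OF X.pointed_faces_axioms p(1) that])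
        show "pointed_map (level_power X Y (nat (p - 1))) q (smash_power Y s) q (eval_at s (nat q) (?d i))"
          if "i \<le> nat p" for i
          by (rule pointed_map_eval_at[OF d[OF that]])
        show "pointed_map (level_power X Y (nat p)) q (smash_power Y s) q (eval_at s (nat q) x)"
          by (rule pointed_map_eval_at[OF x])
        show "pointed_map (level_power X Y (nat (p - 1))) q (level_power X Y (nat (p - 1))) q (\<lambda>v. v)"
          by (simp add: pointed_map_def)
        fix i v assume i: "i \<le> nat p" and v: "v \<in> simplices (level_power X Y (nat (p - 1))) (nat q)"
        have "v (base X (nat (p - 1))) = base Y (nat q)" using v by simp
        then show "eval_at s (nat q) x (coface X (nat p) i v) = eval_at s (nat q) (?d i) v"
          unfolding eval_at_def smash_power_sel pp
          by (subst smash_proj_restrict_comp[where g = v])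
            (use xx in \<open>auto simp: coface_def intro!: arg_cong[where f = "smash_proj Y s (nat q)"] restrict_ext\<close>)
      qed
      also have "\<dots> = (\<Oplus>\<^bsub>chains R (smash_power Y s) q\<^esub> i\<in>{..nat p}. alt_sign (chains R (smash_power Y s) q) (int i)
          (chains_map R (smash_power Y s) q (eval_at s (nat q) (?d i)) c))"
        unfolding alternating_map_def chains_map_id[OF q c'] ..
      also have "\<dots> = (\<Oplus>\<^bsub>chains R (smash_power Y s) q\<^esub> i\<in>{..nat p}. eps_bi R X Y (p - 1) q c s
          (alt_sign (chains R (smash_power X s) (p - 1)) (int i) (simplex_class R (smash_power X s) (p - 1) (?d i))))"
      proof (rule e.cod.M.finsum_cong')
        fix i assume "i \<in> {..nat p}"
        then have i: "i \<le> nat p" by simp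
        show "alt_sign (chains R (smash_power Y s) q) (int i)
          (chains_map R (smash_power Y s) q (eval_at s (nat q) (?d i)) c) = eps_bi R X Y (p - 1) q c s
          (alt_sign (chains R (smash_power X s) (p - 1)) (int i) (simplex_class R (smash_power X s) (p - 1) (?d i)))"
          unfolding eps_eval[OF p(3) s d[OF i] c', symmetric]
          by (rule e.alt_sign[OF simplex_class_closed[OF p(3) d[OF i]], symmetric])
      next
        show "(\<lambda>i. eps_bi R X Y (p - 1) q c s (alt_sign (chains R (smash_power X s) (p - 1)) (int i)
          (simplex_class R (smash_power X s) (p - 1) (?d i)))) \<in> {..nat p} \<rightarrow> carrier (chains R (smash_power Y s) q)"
          using d by (auto intro!: e.closed alt_sign_closed module_chains simplex_class_closed[OF p(3)] simp del: smash_power_sel)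
      qed simp
      also have "\<dots> = eps_bi R X Y (p - 1) q c s (\<Oplus>\<^bsub>chains R (smash_power X s) (p - 1)\<^esub> i\<in>{..nat p}.
          alt_sign (chains R (smash_power X s) (p - 1)) (int i) (simplex_class R (smash_power X s) (p - 1) (?d i)))"
        using d by (intro e.finsum[symmetric]) 
          (auto intro!: alt_sign_closed module_chains simplex_class_closed[OF p(3)] simp del: smash_power_sel)
      also have "\<dots> = eps_bi R X Y (p - 1) q c s (boundary R (smash_power X s) p (simplex_class R (smash_power X s) p x))"
        unfolding boundary_pos[OF p(1)]
        by (rule arg_cong[where f = "eps_bi R X Y (p - 1) q c s"], rule alternating_map_class[OF pmf p(2) x, symmetric])
      finally show "eps_bi R X Y p q (hdiff (D_bicomplex R X Y) p q c) s (simplex_class R (smash_power X s) p x)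
        = hdiff (G_bicomplex R X Y) p q (eps_bi R X Y (p - 1) q c) s (simplex_class R (smash_power X s) p x)"
        using s simplex_class_closed[OF p(2) x] by (simp add: G_bicomplex_def)
    qed
  qed
qed

end

section \<open>Bijectivity of \<open>\<epsilon>\<close> in a fixed bidegree\<close>

text \<open>
  Indices start at \<open>1\<close>, so that the enumeration is a tuple indexed by \<open>\<langle>card A\<rangle>\<close>; for a
  nonempty set of nonbase simplices it is a nonbase simplex of a smash power.
\<close>

definition enum :: "'a set \<Rightarrow> nat \<Rightarrow> 'a" where
  "enum A = (SOME e. e \<in> {1..card A} \<rightarrow>\<^sub>E A \<and> bij_betw e {1..card A} A)"

lemma enum:
  assumes "finite A"
  shows "enum A \<in> {1..card A} \<rightarrow>\<^sub>E A" "bij_betw (enum A) {1..card A} A"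
proof -
  obtain e where e: "bij_betw e {1..card A} A"
    using ex_bij_betw_nat_finite_1[OF assms] by blast
  then have "restrict e {1..card A} \<in> {1..card A} \<rightarrow>\<^sub>E A \<and> bij_betw (restrict e {1..card A}) {1..card A} A"
    by (auto simp: bij_betw_def inj_on_restrict_eq)
  then have "\<exists>e. e \<in> {1..card A} \<rightarrow>\<^sub>E A \<and> bij_betw e {1..card A} A"
    by (rule exI[where x = "restrict e {1..card A}"])
  then have "enum A \<in> {1..card A} \<rightarrow>\<^sub>E A \<and> bij_betw (enum A) {1..card A} A"
    unfolding enum_def by (rule someI_ex)
  then show "enum A \<in> {1..card A} \<rightarrow>\<^sub>E A" "bij_betw (enum A) {1..card A} A" by auto
qed

locale two_spaces_at = two_spaces R X Y
  for R :: "('r, 'x) ring_scheme" (structure) and X :: "'a sspace" and Y :: "'b sspace" +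
  fixes p q :: int
  assumes p: "0 \<le> p" and q: "0 \<le> q" and finite_X: "finite (simplices X (nat p))"
begin

abbreviation "XS \<equiv> simplices X (nat p)"
abbreviation "x\<^sub>0 \<equiv> base X (nat p)"
abbreviation "YS \<equiv> simplices Y (nat q)"
abbreviation "y\<^sub>0 \<equiv> base Y (nat q)"

definition nonbase_maps :: "('a \<Rightarrow> 'b) set" where
  "nonbase_maps = simplices (level_power X Y (nat p)) (nat q) - {base (level_power X Y (nat p)) (nat q)}"

definition supp :: "('a \<Rightarrow> 'b) \<Rightarrow> 'a set" where
  "supp v = {x \<in> XS. v x \<noteq> y\<^sub>0}"

text \<open>
  For \<open>A\<close> contained in the support of \<open>v\<close> this tuple encodes the restriction of \<open>v\<close> to \<open>A\<close>.
\<close>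

definition along :: "'a set \<Rightarrow> ('a \<Rightarrow> 'b) \<Rightarrow> (nat \<Rightarrow> 'b)" where
  "along A v = (\<lambda>k\<in>{1..card A}. v (enum A k))"

text \<open>
  The coordinates of a natural transformation \<open>\<phi>\<close>: with \<open>A = supp v\<close>, the coefficient of the
  restriction of \<open>v\<close> to \<open>A\<close> in the value of \<open>\<phi>\<close> at the enumeration of \<open>A\<close>.
\<close>

definition top_coeff :: "(nat \<Rightarrow> ((nat \<Rightarrow> 'a) \<Rightarrow> 'r) \<Rightarrow> ((nat \<Rightarrow> 'b) \<Rightarrow> 'r)) \<Rightarrow> ('a \<Rightarrow> 'b) \<Rightarrow> 'r" where
  "top_coeff \<phi> v = (if v \<in> nonbase_maps
     then \<phi> (card (supp v)) (simplex_class R (smash_power X (card (supp v))) p (enum (supp v))) (along (supp v) v)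
     else \<zero>)"

lemma nonbase_mapsD:
  assumes "v \<in> nonbase_maps"
  shows "v \<in> simplices (level_power X Y (nat p)) (nat q)"
    and "v \<noteq> base (level_power X Y (nat p)) (nat q)"
    and "v \<in> XS \<rightarrow>\<^sub>E YS" "v x\<^sub>0 = y\<^sub>0" "supp v \<noteq> {}"
proof -
  show v: "v \<in> simplices (level_power X Y (nat p)) (nat q)"
    and v': "v \<noteq> base (level_power X Y (nat p)) (nat q)"
    using assms by (auto simp: nonbase_maps_def)
  show ve: "v \<in> XS \<rightarrow>\<^sub>E YS" "v x\<^sub>0 = y\<^sub>0" using v by auto
  show "supp v \<noteq> {}"
  proof
    assume "supp v = {}"
    then have "v = (\<lambda>x\<in>XS. y\<^sub>0)"
      using ve(1) by (intro extensionalityI[of _ XS]) (auto simp: supp_def PiE_iff)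
    then show False using v' by simp
  qed
qed

lemma nonbase_mapsI:
  assumes "v \<in> XS \<rightarrow>\<^sub>E YS" "v x\<^sub>0 = y\<^sub>0" "supp v \<noteq> {}"
  shows "v \<in> nonbase_maps"
proof -
  from assms(3) obtain x where "x \<in> XS" "v x \<noteq> y\<^sub>0" by (auto simp: supp_def)
  then show ?thesis using assms(1,2) by (auto simp: nonbase_maps_def)
qed

lemma supp_subset: "v \<in> nonbase_maps \<Longrightarrow> supp v \<subseteq> XS - {x\<^sub>0}"
  using nonbase_mapsD(4) by (auto simp: supp_def)

lemma finite_supp: "finite (supp v)"
  using finite_X by (simp add: supp_def)

lemma nonbase_maps_eqI:
  assumes "u \<in> nonbase_maps" "v \<in> nonbase_maps" "supp u = supp v" "\<And>x. x \<in> supp u \<Longrightarrow> u x = v x"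
  shows "u = v"
proof (rule extensionalityI[of _ XS])
  show "u \<in> extensional XS" "v \<in> extensional XS"
    using nonbase_mapsD(3)[OF assms(1)] nonbase_mapsD(3)[OF assms(2)] by (auto simp: PiE_iff)
  fix x assume x: "x \<in> XS"
  show "u x = v x"
  proof (cases "x \<in> supp u")
    case False
    then have "u x = y\<^sub>0" "v x = y\<^sub>0" using x assms(3) by (auto simp: supp_def)
    then show ?thesis by simp
  qed (rule assms(4))
qed

lemma card_pos: "finite A \<Longrightarrow> A \<noteq> {} \<Longrightarrow> 1 \<le> card A"
  by (simp add: Suc_le_eq card_gt_0_iff)

lemma enum_simplex:
  assumes "A \<subseteq> XS - {x\<^sub>0}" "A \<noteq> {}"
  shows "enum A \<in> simplices (smash_power X (card A)) (nat p)"
    and "enum A \<noteq> base (smash_power X (card A)) (nat p)"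
    and "simplex_class R (smash_power X (card A)) p (enum A) \<in> carrier (chains R (smash_power X (card A)) p)"
proof -
  have A: "finite A" using assms(1) finite_X by (meson finite_Diff finite_subset)
  have "enum A \<in> {1..card A} \<rightarrow>\<^sub>E XS - {x\<^sub>0}" using enum(1)[OF A] assms(1) by (auto simp: PiE_iff)
  then have "enum A \<in> simplices (smash_power X (card A)) (nat p) \<and> enum A \<noteq> base (smash_power X (card A)) (nat p)"
    using smash_nonbase_iff[OF card_pos[OF A assms(2)] X.base_closed] by blast
  then show "enum A \<in> simplices (smash_power X (card A)) (nat p)"
    "enum A \<noteq> base (smash_power X (card A)) (nat p)" by auto
  then show "simplex_class R (smash_power X (card A)) p (enum A) \<in> carrier (chains R (smash_power X (card A)) p)"
    by (intro simplex_class_closed[OF p])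
qed

lemma along_nonbase:
  assumes "v \<in> nonbase_maps" "A \<subseteq> supp v"
  shows "along A v \<in> {1..card A} \<rightarrow>\<^sub>E YS - {y\<^sub>0}"
proof -
  have "finite A" using assms(2) finite_supp by (rule finite_subset)
  then have "enum A k \<in> supp v" if "k \<in> {1..card A}" for k
    using enum(1)[of A] assms(2) that by blast
  then show ?thesis using nonbase_mapsD(3)[OF assms(1)] by (auto simp: along_def supp_def PiE_iff)
qed

lemma along_eqD:
  assumes A: "finite A" and eq: "along A u = along A v" and x: "x \<in> A"
  shows "u x = v x"
proof -
  have "x \<in> enum A ` {1..card A}" using enum(2)[OF A] x by (simp only: bij_betw_def)
  then obtain k where "x = enum A k" "k \<in> {1..card A}" by (rule imageE)
  then show ?thesis using fun_cong[OF eq, of k] by (simp add: along_def)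
qed

lemma chain_value:
  assumes "1 \<le> s" "c \<in> carrier (chains R (smash_power Y s) q)"
  shows "c y \<in> carrier R" "finite {y. c y \<noteq> \<zero>}" "y \<notin> {1..s} \<rightarrow>\<^sub>E YS - {y\<^sub>0} \<Longrightarrow> c y = \<zero>"
proof -
  have "simplices (smash_power Y s) (nat q) - {base (smash_power Y s) (nat q)} = {1..s} \<rightarrow>\<^sub>E YS - {y\<^sub>0}"
    using smash_nonbase_iff[OF assms(1) Y.base_closed] by blast
  then have c: "c \<in> carrier (free_module R ({1..s} \<rightarrow>\<^sub>E YS - {y\<^sub>0}))"
    using assms(2) q by (simp add: chains_def del: smash_power_sel)
  show "c y \<in> carrier R" "finite {y. c y \<noteq> \<zero>}" "y \<notin> {1..s} \<rightarrow>\<^sub>E YS - {y\<^sub>0} \<Longrightarrow> c y = \<zero>"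
    using free_moduleD(1-3)[OF c] by auto
qed

lemma top_chain_closed:
  assumes "\<phi> \<in> carrier (Hom_bi p q)" "A \<subseteq> XS - {x\<^sub>0}" "A \<noteq> {}"
  shows "\<phi> (card A) (simplex_class R (smash_power X (card A)) p (enum A)) \<in> carrier (chains R (smash_power Y (card A)) q)"
proof -
  have "finite A" using assms(2) finite_X by (meson finite_Diff finite_subset)
  then show ?thesis
    using assms(1) enum_simplex(3)[OF assms(2,3)] card_pos[OF _ assms(3)]
    by (intro Hom_closed) (auto simp: Hom_sel(1))
qed

text \<open>
  There are finitely many supports \<open>A\<close>, as \<open>X\<^sub>p\<close> is finite, and for each of them the value of \<open>\<phi>\<close>
  at the enumeration of \<open>A\<close> has finitely many nonzero coefficients.
\<close>

lemma top_coeff_closed: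
  assumes \<phi>: "\<phi> \<in> carrier (Hom_bi p q)"
  shows "top_coeff \<phi> \<in> carrier (free_module R nonbase_maps)"
proof (rule free_moduleI)
  let ?c = "\<lambda>A. \<phi> (card A) (simplex_class R (smash_power X (card A)) p (enum A))"
  have c: "?c A \<in> carrier (chains R (smash_power Y (card A)) q)" "1 \<le> card A" if "A \<subseteq> XS - {x\<^sub>0}" "A \<noteq> {}" for A
    using top_chain_closed[OF \<phi> that] card_pos[OF _ that(2)] that(1) finite_X by (auto intro: finite_subset)
  show "top_coeff \<phi> v \<in> carrier R" for v
  proof (cases "v \<in> nonbase_maps")
    case True
    note A = supp_subset[OF True] nonbase_mapsD(5)[OF True]
    show ?thesis using True chain_value(1)[OF c(2)[OF A] c(1)[OF A]] by (simp add: top_coeff_def)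
  qed (simp add: top_coeff_def)
  show "top_coeff \<phi> v = \<zero>" if "v \<notin> nonbase_maps" for v
    using that by (simp add: top_coeff_def)
  let ?V = "\<lambda>A. {v \<in> nonbase_maps. supp v = A \<and> ?c A (along A v) \<noteq> \<zero>}"
  have "finite (?V A)" if "A \<in> Pow (XS - {x\<^sub>0}) - {{}}" for A
  proof (rule inj_on_finite[of "along A" _ "{y. ?c A y \<noteq> \<zero>}"])
    have A: "A \<subseteq> XS - {x\<^sub>0}" "A \<noteq> {}" using that by auto
    then have fin: "finite A" using finite_X by (auto intro: finite_subset)
    show "finite {y. ?c A y \<noteq> \<zero>}" using c[OF A] by (intro chain_value(2))
    show "inj_on (along A) (?V A)"
      using along_eqD[OF fin] by (intro inj_onI nonbase_maps_eqI) auto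
  qed auto
  then have "finite (\<Union>A\<in>Pow (XS - {x\<^sub>0}) - {{}}. ?V A)"
    using finite_X by blast
  moreover have "{v. top_coeff \<phi> v \<noteq> \<zero>} \<subseteq> (\<Union>A\<in>Pow (XS - {x\<^sub>0}) - {{}}. ?V A)"
    using supp_subset nonbase_mapsD(5) by (fastforce simp: top_coeff_def split: if_splits)
  ultimately show "finite {v. top_coeff \<phi> v \<noteq> \<zero>}" by (rule finite_subset[rotated])
qed

lemma linear_map_top_coeff: "linear_map R (Hom_bi p q) (free_module R nonbase_maps) top_coeff"
proof (rule linear_mapI)
  note e = enum_simplex(3)[OF supp_subset nonbase_mapsD(5)]
  have s: "1 \<le> card (supp v)" if "v \<in> nonbase_maps" for v
    by (rule card_pos[OF finite_supp nonbase_mapsD(5)[OF that]])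
  fix \<phi> \<psi> assume "\<phi> \<in> carrier (Hom_bi p q)" "\<psi> \<in> carrier (Hom_bi p q)"
  show "top_coeff (\<phi> \<oplus>\<^bsub>Hom_bi p q\<^esub> \<psi>) = top_coeff \<phi> \<oplus>\<^bsub>free_module R nonbase_maps\<^esub> top_coeff \<psi>"
    using e s by (auto simp: top_coeff_def Hom_sel(3) chains_def fun_eq_iff)
next
  note e = enum_simplex(3)[OF supp_subset nonbase_mapsD(5)]
  have s: "1 \<le> card (supp v)" if "v \<in> nonbase_maps" for v
    by (rule card_pos[OF finite_supp nonbase_mapsD(5)[OF that]])
  fix r \<phi> assume "r \<in> carrier R" "\<phi> \<in> carrier (Hom_bi p q)"
  then show "top_coeff (r \<odot>\<^bsub>Hom_bi p q\<^esub> \<phi>) = r \<odot>\<^bsub>free_module R nonbase_maps\<^esub> top_coeff \<phi>"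
    using e s by (auto simp: top_coeff_def Hom_sel(4) chains_def fun_eq_iff)
qed (auto intro: module_Hom_bi module_free_module top_coeff_closed)

text \<open>
  Every nonbase simplex \<open>y\<close> of \<open>Y\<^sup>\<and>\<^sup>|\<^sup>A\<^sup>|\<close> is \<open>along A v\<close> for a pointed function \<open>v\<close> with support
  exactly \<open>A\<close>, so its coefficient is one of the coordinates.
\<close>

lemma top_coeff_determines:
  assumes \<phi>: "\<phi> \<in> carrier (Hom_bi p q)" and \<psi>: "\<psi> \<in> carrier (Hom_bi p q)"
    and eq: "top_coeff \<phi> = top_coeff \<psi>" and A: "A \<subseteq> XS - {x\<^sub>0}" "A \<noteq> {}"
  shows "\<phi> (card A) (simplex_class R (smash_power X (card A)) p (enum A))
    = \<psi> (card A) (simplex_class R (smash_power X (card A)) p (enum A))" (is "?f = ?g")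
proof
  fix y
  have fin: "finite A" using A(1) finite_X by (auto intro: finite_subset)
  note s = card_pos[OF fin A(2)]
  show "?f y = ?g y"
  proof (cases "y \<in> {1..card A} \<rightarrow>\<^sub>E YS - {y\<^sub>0}")
    case False
    then show ?thesis
      using chain_value(3)[OF s top_chain_closed[OF \<phi> A]] chain_value(3)[OF s top_chain_closed[OF \<psi> A]] by simp
  next
    case y: True
    let ?v = "\<lambda>x\<in>XS. if x \<in> A then y (inv_into {1..card A} (enum A) x) else y\<^sub>0"
    have inv: "inv_into {1..card A} (enum A) x \<in> {1..card A}" if "x \<in> A" for x
      using enum(2)[OF fin] that by (metis bij_betw_def inv_into_into)
    have inv_enum: "inv_into {1..card A} (enum A) (enum A k) = k" if "k \<in> {1..card A}" for k
      using enum(2)[OF fin] that by (rule bij_betw_inv_into_left)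
    have yv: "y k \<in> YS" "y k \<noteq> y\<^sub>0" if "k \<in> {1..card A}" for k using y that by (auto simp: PiE_iff)
    have supp: "supp ?v = A" using A(1) yv(2)[OF inv] by (auto simp: supp_def)
    have v: "?v \<in> nonbase_maps"
    proof (rule nonbase_mapsI)
      show "?v \<in> XS \<rightarrow>\<^sub>E YS" using yv(1)[OF inv] Y.base_closed by (auto simp: PiE_iff)
      show "?v x\<^sub>0 = y\<^sub>0" using A(1) X.base_closed by auto
      show "supp ?v \<noteq> {}" unfolding supp by (rule A(2))
    qed
    have "along A ?v k = y k" if "k \<in> {1..card A}" for k
    proof -
      have "enum A k \<in> A" using enum(1)[OF fin] that by (auto simp: PiE_iff)
      then show ?thesis using that A(1) inv_enum[OF that] by (auto simp: along_def)
    qed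
    then have "along A ?v = y"
      using y by (intro extensionalityI[of _ "{1..card A}"]) (auto simp: along_def PiE_iff)
    then show ?thesis
      using fun_cong[OF eq, of ?v] v unfolding top_coeff_def supp by simp
  qed
qed

text \<open>
  Write a basis tuple \<open>x\<close> with set of entries \<open>A\<close> as \<open>x = enum A \<circ> h\<close>. The map \<open>h\<close> is onto, so
  naturality at \<open>h\<close> expresses the value at \<open>x\<close> by the value at the enumeration of \<open>A\<close>.
\<close>

lemma inj_top_coeff: "inj_on top_coeff (carrier (Hom_bi p q))"
proof (rule inj_onI, rule Hom_bi_eqI[OF p])
  fix \<phi> \<psi> s x
  assume \<phi>: "\<phi> \<in> carrier (Hom_bi p q)" and \<psi>: "\<psi> \<in> carrier (Hom_bi p q)"
    and eq: "top_coeff \<phi> = top_coeff \<psi>"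
  assume s: "1 \<le> s" and "x \<in> simplices (smash_power X s) (nat p)" "x \<noteq> base (smash_power X s) (nat p)"
  then have x: "x \<in> {1..s} \<rightarrow>\<^sub>E XS - {x\<^sub>0}" using smash_nonbase_iff[OF s X.base_closed] by blast
  let ?A = "x ` {1..s}"
  have A: "?A \<subseteq> XS - {x\<^sub>0}" "?A \<noteq> {}" and fin: "finite ?A" using x s by auto
  note m = card_pos[OF fin A(2)]
  let ?h = "\<lambda>k\<in>{1..s}. inv_into {1..card ?A} (enum ?A) (x k)"
  have inv: "inv_into {1..card ?A} (enum ?A) ` ?A = {1..card ?A}"
    using bij_betw_inv_into[OF enum(2)[OF fin]] by (rule bij_betw_imp_surj_on)
  then have h: "?h \<in> surjections s (card ?A)"
    unfolding surjections_def by (auto simp: image_image)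
  have sh: "sharp s ?h (enum ?A) = x"
  proof (rule extensionalityI[of _ "{1..s}"])
    show "x \<in> extensional {1..s}" using x by (auto simp: PiE_iff)
    fix k assume k: "k \<in> {1..s}"
    then have "enum ?A (inv_into {1..card ?A} (enum ?A) (x k)) = x k"
      using enum(2)[OF fin] by (intro bij_betw_inv_into_right) auto
    then show "sharp s ?h (enum ?A) k = x k" using k by (simp add: sharp_def)
  qed (simp add: sharp_def)
  let ?e = "simplex_class R (smash_power X (card ?A)) p (enum ?A)"
  have xe: "simplex_class R (smash_power X s) p x = chains_map R (smash_power X s) p (sharp s ?h) ?e"
    using chains_map_class[OF pointed_map_sharp[OF h] p enum_simplex(1)[OF A]] by (simp only: sh)
  have "\<chi> s (simplex_class R (smash_power X s) p x)
      = chains_map R (smash_power Y s) q (sharp s ?h) (\<chi> (card ?A) ?e)"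
    if "\<chi> \<in> carrier (Hom_bi p q)" for \<chi>
    unfolding xe using that by (intro Hom_natural[OF _ m s h enum_simplex(3)[OF A]]) (simp add: Hom_sel(1))
  then show "\<phi> s (simplex_class R (smash_power X s) p x) = \<psi> s (simplex_class R (smash_power X s) p x)"
    using \<phi> \<psi> top_coeff_determines[OF \<phi> \<psi> eq A] by simp
qed

lemma chains_level_power: "chains R (level_power X Y (nat p)) q = free_module R nonbase_maps"
  using q by (simp add: chains_def nonbase_maps_def del: fun_space_sel)

text \<open>
  With \<open>A = supp u\<close>, the value of \<open>\<epsilon>[v]\<close> at the enumeration of \<open>A\<close> is the class of the restriction
  of \<open>v\<close> to \<open>A\<close>, or zero if that restriction takes the basepoint as a value.
\<close>

lemma top_coeff_eps_delta:
  assumes v: "v \<in> nonbase_maps"  and u: "u \<in> nonbase_maps"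
  shows "top_coeff (eps_bi R X Y p q (delta R v)) u =
    (if \<forall>x\<in>supp u. v x = u x then \<one> else \<zero>)"
proof -
  let ?A = "supp u" and ?s = "card (supp u)"
  have s: "1 \<le> ?s" by (rule card_pos[OF finite_supp nonbase_mapsD(5)[OF u]])
  note A = supp_subset[OF u] nonbase_mapsD(5)[OF u]
  have dv: "delta R v = simplex_class R (level_power X Y (nat p)) q v"
    using nonbase_mapsD(2)[OF v] by (simp add: simplex_class_eq del: fun_space_sel)
  have "eps_bi R X Y p q (delta R v) ?s (simplex_class R (smash_power X ?s) p (enum ?A))
      = simplex_class R (smash_power Y ?s) q (eval_at ?s (nat q) (enum ?A) v)"
    unfolding dv eps_simplex[OF p q nonbase_mapsD(1,2)[OF v]] eps_class_alt
    using s enum_simplex(3)[OF A]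
      chains_map_class[OF pointed_map_eval_arg[OF p q nonbase_mapsD(1)[OF v]] p enum_simplex(1)[OF A]]
    by simp
  also have "eval_at ?s (nat q) (enum ?A) v = smash_proj Y ?s (nat q) (along ?A v)"
    by (simp add: eval_at_def along_def)
  finally have eq: "top_coeff (eps_bi R X Y p q (delta R v)) u
      = simplex_class R (smash_power Y ?s) q (smash_proj Y ?s (nat q) (along ?A v)) (along ?A u)"
    using u by (simp add: top_coeff_def)
  have au: "along ?A u \<in> {1..?s} \<rightarrow>\<^sub>E YS - {y\<^sub>0}" by (rule along_nonbase[OF u subset_refl])
  then have au': "along ?A u \<noteq> base (smash_power Y ?s) (nat q)" "smash_proj Y ?s (nat q) (along ?A u) = along ?A u"
    using smash_nonbase_iff[OF s Y.base_closed] by (blast, auto simp: smash_proj_def PiE_iff)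
  show ?thesis
  proof (cases "\<forall>x\<in>?A. v x = u x")
    case True
    then have "along ?A v = along ?A u"
      using enum(1)[OF finite_supp[of u]] by (auto simp: along_def PiE_iff intro!: restrict_ext)
    then show ?thesis
      unfolding eq using True au' by (simp add: simplex_class_eq delta_def del: smash_power_sel)
  next
    case False
    then have "along ?A v \<noteq> along ?A u" using along_eqD[OF finite_supp] by metis
    then have "smash_proj Y ?s (nat q) (along ?A v) \<noteq> along ?A u"
      using au'(1) by (auto simp: smash_proj_def)
    then have "simplex_class R (smash_power Y ?s) q (smash_proj Y ?s (nat q) (along ?A v)) (along ?A u) = \<zero>"
      by (auto simp: simplex_class_eq delta_def chains_def)
    then show ?thesis unfolding eq using False by (simp only: if_False)
  qed
qed

text \<open>
  If \<open>u\<close> agrees with \<open>v\<close> on \<open>supp u\<close>, then \<open>supp u \<subseteq> supp v\<close>, with equality only for \<open>u = v\<close>: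
  the composite \<open>?T\<close> is unitriangular for the size of the support. As \<open>top_coeff\<close> is injective, a
  preimage under \<open>?T\<close> of the coordinates of \<open>\<phi>\<close> is a preimage of \<open>\<phi>\<close> under \<open>\<epsilon>\<close>.
\<close>

lemma bij_eps: "bij_betw (eps_bi R X Y p q) (carrier (chains R (level_power X Y (nat p)) q)) (carrier (Hom_bi p q))"
proof -
  have lin: "linear_map R (free_module R nonbase_maps) (Hom_bi p q) (eps_bi R X Y p q)"
    using linear_map_eps_chains[OF p, of q] by (simp only: chains_level_power)
  let ?T = "\<lambda>c. top_coeff (eps_bi R X Y p q c)"
  have bij: "bij_betw ?T (carrier (free_module R nonbase_maps)) (carrier (free_module R nonbase_maps))"
  proof (rule unitriangular_bij[where rank = "\<lambda>v. card (supp v)"])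
    show "linear_map R (free_module R nonbase_maps) (free_module R nonbase_maps) ?T"
      by (rule linear_map_comp[OF lin linear_map_top_coeff])
    show "?T (delta R v) v = \<one>" if "v \<in> nonbase_maps" for v
      using top_coeff_eps_delta[OF that that] by simp
    fix u v assume v: "v \<in> nonbase_maps" and ne: "?T (delta R v) u \<noteq> \<zero>"
    have u: "u \<in> nonbase_maps" using ne by (simp add: top_coeff_def split: if_splits)
    have uv: "\<forall>x\<in>supp u. v x = u x" using ne top_coeff_eps_delta[OF v u] by (simp split: if_splits)
    then have sub: "supp u \<subseteq> supp v" by (auto simp: supp_def)
    show "u = v \<or> card (supp u) < card (supp v)"
    proof (cases "supp u = supp v")
      case True
      then show ?thesis using nonbase_maps_eqI[OF u v] uv by simp
    next
      case False
      then show ?thesis using psubset_card_mono[OF finite_supp] sub by blast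
    qed
  qed
  show ?thesis unfolding chains_level_power
  proof (rule bij_betw_imageI)
    have "inj_on ?T (carrier (free_module R nonbase_maps))" using bij by (rule bij_betw_imp_inj_on)
    then show "inj_on (eps_bi R X Y p q) (carrier (free_module R nonbase_maps))"
      by (auto simp: inj_on_def)
    show "eps_bi R X Y p q ` carrier (free_module R nonbase_maps) = carrier (Hom_bi p q)"
    proof
      show "eps_bi R X Y p q ` carrier (free_module R nonbase_maps) \<subseteq> carrier (Hom_bi p q)"
        using linear_map.closed[OF lin] by (rule image_subsetI)
      show "carrier (Hom_bi p q) \<subseteq> eps_bi R X Y p q ` carrier (free_module R nonbase_maps)"
      proof
        fix \<phi> assume \<phi>: "\<phi> \<in> carrier (Hom_bi p q)"
        have "top_coeff \<phi> \<in> ?T ` carrier (free_module R nonbase_maps)"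
          using top_coeff_closed[OF \<phi>] bij_betw_imp_surj_on[OF bij] by simp
        then obtain c where c: "c \<in> carrier (free_module R nonbase_maps)" "top_coeff \<phi> = ?T c"
          by (rule imageE)
        have "\<phi> = eps_bi R X Y p q c"
          by (rule inj_onD[OF inj_top_coeff c(2) \<phi> linear_map.closed[OF lin c(1)]])
        then show "\<phi> \<in> eps_bi R X Y p q ` carrier (free_module R nonbase_maps)"
          using c(1) by (rule image_eqI)
      qed
    qed
  qed
qed

end

theorem theorem0p6:
  fixes R :: "('r, 'x) ring_scheme"
    and X :: "'a sspace"
    and Y :: "'b sspace"
  assumes "cring R"
    and "pointed_simplicial_set X"
    and "pointed_simplicial_set Y"
    and "gradual X"
  shows "chain_iso R (D_complex R X Y) (G_complex R X Y) (epsilon R X Y)"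
proof -
  have pf: "pointed_faces X" "pointed_faces Y"
    using assms by (auto intro: pointed_simplicial_set_faces)
  interpret two_spaces R X Y
    by (intro two_spaces.intro assms(1) pf)
  have bij: "bij_betw (eps_bi R X Y p q) (carrier (bi_module (D_bicomplex R X Y) p q)) (carrier (Hom_bi p q))" for p q
  proof (cases "0 \<le> p \<and> 0 \<le> q")
    case True
    then interpret two_spaces_at R X Y p q
      using assms(4) by unfold_locales (auto simp: gradual_def)
    show ?thesis using bij_eps p by (simp add: D_bi)
  next
    case False
    interpret e: linear_map R "bi_module (D_bicomplex R X Y) p q" "Hom_bi p q" "eps_bi R X Y p q"
      by (rule linear_map_eps)
    have "carrier (bi_module (D_bicomplex R X Y) p q) = {\<zero>\<^bsub>bi_module (D_bicomplex R X Y) p q\<^esub>}"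
      using D_bi_neg[of p q] False e.dom.M.zero_closed by (intro equalityI subsetI) auto
    moreover have "carrier (Hom_bi p q) = {\<zero>\<^bsub>Hom_bi p q\<^esub>}"
      using Hom_bi_neg[of p q] False e.cod.M.zero_closed by (intro equalityI subsetI) auto
    ultimately show ?thesis using e.zero by (simp add: bij_betw_def)
  qed
  have "chain_iso R (diagonal (D_bicomplex R X Y)) (diagonal (G_bicomplex R X Y))
      (\<lambda>n w. \<lambda>(p, q)\<in>diag_index n. eps_bi R X Y p q (w (p, q)))"
    by (rule diagonal_chain_iso[OF commuting_bicomplex_D[OF pf] commuting_bicomplex_G[OF pf]])
      (simp_all add: G_bi linear_map_eps bij eps_hdiff eps_vdiff)
  then show ?thesis
    by (simp add: D_complex_def G_complex_def epsilon_def[abs_def])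
qed

end
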